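(* The inverse $B_e^{-1}\colon Y'\times H\to X$ of the operator $B_e\colon X\to Y'\times H$, $B_eu:=(\mathrm{d}_tu+Au,\gamma_0u)$, is Lipschitz continuous with constant $$L_{B_e^{-1}}=\tfrac1{m_S}\big(1+\tfrac1{m_A}\big),\qquad m_S:=\min\big(1,m_A,\tfrac{m_A}{L_A^2}\big).$$
   Context: All linear spaces are over $\mathbb R$. Any Cartesian product of normed spaces $\mathcal X\times\mathcal Y$ is equipped with $\|(x,y)\|:=\|x\|_{\mathcal X}+\|y\|_{\mathcal Y}$. $V\hookrightarrow H\simeq H'\hookrightarrow V'$ is a Gelfand triple of Hilbert spaces, $T>0$, $\Xi:=(0,T)$. Set $Y:=L_2(\Xi;V)$ and $X:=L_2(\Xi;V)\cap H^1(\Xi;V')$. It is known that $X\hookrightarrow C(\overline\Xi;H)$, and $\gamma_t\colon X\to H$ denotes the trace $w\mapsto w(t)$. Define $\mathrm{d}_t\colon X\to Y'$ by $(\mathrm{d}_t w)(v):=\int_\Xi (\tfrac{\mathrm{d}w}{\mathrm{d}t}(t))(v(t))\,\mathrm{d}t$. $X$ is equipped with the norm $\|w\|_X:=\sqrt{\|w\|_Y^2+\|\mathrm{d}_tw\|_{Y'}^2+\|\gamma_Tw\|_H^2}$. For a.e. $t\in\Xi$, $A(t)\colon V\to V'$ is a possibly nonlinear operator, and $A\colon Y\to Y'$ is defined by $(Aw)(v):=\int_\Xi (A(t)w(t))(v(t))\,\mathrm{d}t$. It is assumed that $A\colon Y\to Y'$ is Lipschitz continuous, $\|Aw-Av\|_{Y'}\le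 L_A\|w-v\|_Y$, and strongly monotone, $(Aw-Av)(w-v)\ge m_A\|w-v\|_Y^2$, for all $w,v\in Y$, with constants $L_A,m_A>0$. It is known that for such $A$ the operator $B_e$ is invertible, i.e. $B_eu=(\ell,u_0)$ has a unique solution $u\in X$ for every $(\ell,u_0)\in Y'\times H$. *)

theory Defs
  imports "HOL-Analysis.Analysis"
begin

text \<open>
  Neither \<open>V\<close> nor its dual is assumed separable, so measurability of a vector-valued function means
  strong (Bochner) measurability, and the Bochner integral is defined without the class
  \<open>second_countable_topology\<close> required by the integral in the library.  For scalar functions the
  integral of the library is used.
\<close>

abbreviation time_measure :: "real \<Rightarrow> real measure" where
  "time_measure T \<equiv> lebesgue_on {0<..<T}"

definition strongly_measurable :: "'a measure \<Rightarrow> ('a \<Rightarrow> 'b::real_normed_vector) \<Rightarrow> bool" where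
  "strongly_measurable M f \<longleftrightarrow>
     (\<exists>s. (\<forall>n. simple_function M (s n)) \<and> (AE x in M. (\<lambda>n. s n x) \<longlonglongrightarrow> f x))"

definition has_strong_integral ::
    "'a measure \<Rightarrow> ('a \<Rightarrow> 'b::real_normed_vector) \<Rightarrow> 'b \<Rightarrow> bool" where
  "has_strong_integral M f y \<longleftrightarrow>
     strongly_measurable M f \<and>
     (\<exists>s. (\<forall>n. Bochner_Integration.simple_bochner_integrable M (s n)) \<and>
          (\<lambda>n. \<integral>\<^sup>+ x. ennreal (norm (f x - s n x)) \<partial>M) \<longlonglongrightarrow> 0 \<and>
          (\<lambda>n. Bochner_Integration.simple_bochner_integral M (s n)) \<longlonglongrightarrow> y)"

text \<open>
  An element of \<open>L\<^sub>2\<close> is represented by any function of its class modulo equality almost everywhere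
  on \<open>(0,T)\<close>; values outside \<open>(0,T)\<close> are irrelevant.  All norms and operators below depend only on
  the class.
\<close>

definition bochner_L2 :: "real \<Rightarrow> (real \<Rightarrow> 'b::real_normed_vector) set" where
  "bochner_L2 T =
     {f. strongly_measurable (time_measure T) f \<and>
         integrable (time_measure T) (\<lambda>t. (norm (f t))\<^sup>2)}"

definition bochner_L2_norm :: "real \<Rightarrow> (real \<Rightarrow> 'b::real_normed_vector) \<Rightarrow> real" where
  "bochner_L2_norm T f = sqrt (\<integral>t. (norm (f t))\<^sup>2 \<partial>time_measure T)"

text \<open>
  The dual \<open>Y'\<close> of \<open>Y = L\<^sub>2(0,T;V)\<close>.  Functionals are normalised to be zero off \<open>Y\<close>, so that
  equality in \<open>Y'\<close> is equality of functions.  Boundedness forces equal values on functions which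
  agree almost everywhere.
\<close>

definition L2_dual :: "real \<Rightarrow> ((real \<Rightarrow> 'v::real_normed_vector) \<Rightarrow> real) set" where
  "L2_dual T =
     {l. (\<forall>v\<in>bochner_L2 T. \<forall>w\<in>bochner_L2 T. l (\<lambda>t. v t + w t) = l v + l w) \<and>
         (\<forall>c. \<forall>v\<in>bochner_L2 T. l (\<lambda>t. c *\<^sub>R v t) = c * l v) \<and>
         (\<exists>C. \<forall>v\<in>bochner_L2 T. \<bar>l v\<bar> \<le> C * bochner_L2_norm T v) \<and>
         (\<forall>v. v \<notin> bochner_L2 T \<longrightarrow> l v = 0)}"

definition L2_dual_norm :: "real \<Rightarrow> ((real \<Rightarrow> 'v::real_normed_vector) \<Rightarrow> real) \<Rightarrow> real" where
  "L2_dual_norm T l = (SUP v\<in>{v \<in> bochner_L2 T. bochner_L2_norm T v \<le> 1}. \<bar>l v\<bar>)"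

definition L2_functional ::
    "real \<Rightarrow> (real \<Rightarrow> ('v::real_normed_vector \<Rightarrow>\<^sub>L real)) \<Rightarrow> (real \<Rightarrow> 'v) \<Rightarrow> real" where
  "L2_functional T F =
     (\<lambda>v. if v \<in> bochner_L2 T
          then \<integral>t. blinfun_apply (F t) (v t) \<partial>time_measure T else 0)"

definition is_test_function :: "real \<Rightarrow> (real \<Rightarrow> real) \<Rightarrow> bool" where
  "is_test_function T \<phi> \<longleftrightarrow>
     (\<forall>n x. (deriv ^^ n) \<phi> field_differentiable at x) \<and> closure {x. \<phi> x \<noteq> 0} \<subseteq> {0<..<T}"

definition is_weak_derivative ::
    "real \<Rightarrow> (real \<Rightarrow> 'b::real_normed_vector) \<Rightarrow> (real \<Rightarrow> 'b) \<Rightarrow> bool" where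
  "is_weak_derivative T f g \<longleftrightarrow>
     (\<forall>\<phi>. is_test_function T \<phi> \<longrightarrow>
        (\<exists>y. has_strong_integral (time_measure T) (\<lambda>t. deriv \<phi> t *\<^sub>R f t) y \<and>
             has_strong_integral (time_measure T) (\<lambda>t. \<phi> t *\<^sub>R g t) (- y)))"

definition bochner_H1 :: "real \<Rightarrow> (real \<Rightarrow> 'b::real_normed_vector) set" where
  "bochner_H1 T = {f \<in> bochner_L2 T. \<exists>g\<in>bochner_L2 T. is_weak_derivative T f g}"

text \<open>Unique up to equality almost everywhere.\<close>

definition weak_derivative ::
    "real \<Rightarrow> (real \<Rightarrow> 'b::real_normed_vector) \<Rightarrow> real \<Rightarrow> 'b" where
  "weak_derivative T f = (SOME g. g \<in> bochner_L2 T \<and> is_weak_derivative T f g)"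

text \<open>
  A Gelfand triple of real Hilbert spaces is given by the embedding \<open>j\<close> of \<open>V\<close> into \<open>H\<close>.  The
  embedding of \<open>H\<close> into \<open>V'\<close> is the Riesz isomorphism of \<open>H\<close> followed by the adjoint of \<open>j\<close>;
  \<open>V'\<close> carries the operator norm.
\<close>

definition gelfand_triple ::
    "('v::{real_inner, complete_space} \<Rightarrow> 'h::{real_inner, complete_space}) \<Rightarrow> bool" where
  "gelfand_triple j \<longleftrightarrow> bounded_linear j \<and> inj j \<and> closure (range j) = UNIV"

definition pivot_to_dual ::
    "('v::real_inner \<Rightarrow> 'h::real_inner) \<Rightarrow> 'h \<Rightarrow> ('v \<Rightarrow>\<^sub>L real)" where
  "pivot_to_dual j h = Blinfun (\<lambda>v. inner h (j v))"

definition in_dual ::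
    "('v::real_inner \<Rightarrow> 'h::real_inner) \<Rightarrow> (real \<Rightarrow> 'v) \<Rightarrow> real \<Rightarrow> ('v \<Rightarrow>\<^sub>L real)" where
  "in_dual j w = (\<lambda>t. pivot_to_dual j (j (w t)))"

definition X_space :: "('v::real_inner \<Rightarrow> 'h::real_inner) \<Rightarrow> real \<Rightarrow> (real \<Rightarrow> 'v) set" where
  "X_space j T = {w \<in> bochner_L2 T. in_dual j w \<in> bochner_H1 T}"

definition d_t ::
    "('v::real_inner \<Rightarrow> 'h::real_inner) \<Rightarrow> real \<Rightarrow> (real \<Rightarrow> 'v) \<Rightarrow> (real \<Rightarrow> 'v) \<Rightarrow> real" where
  "d_t j T w = L2_functional T (weak_derivative T (in_dual j w))"

text \<open>
  The value at \<open>t\<close> of the representative of \<open>w\<close> in \<open>C([0,T];H)\<close>, which is unique on \<open>[0,T]\<close>.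
\<close>

definition trace_at ::
    "('v::real_inner \<Rightarrow> 'h::real_inner) \<Rightarrow> real \<Rightarrow> real \<Rightarrow> (real \<Rightarrow> 'v) \<Rightarrow> 'h" where
  "trace_at j T t w =
     (SOME u. continuous_on {0..T} u \<and> (AE s in time_measure T. u s = j (w s))) t"

definition X_norm :: "('v::real_inner \<Rightarrow> 'h::real_inner) \<Rightarrow> real \<Rightarrow> (real \<Rightarrow> 'v) \<Rightarrow> real" where
  "X_norm j T w =
     sqrt ((bochner_L2_norm T w)\<^sup>2 + (L2_dual_norm T (d_t j T w))\<^sup>2 + (norm (trace_at j T T w))\<^sup>2)"

definition nemytskii ::
    "real \<Rightarrow> (real \<Rightarrow> 'v::real_normed_vector \<Rightarrow> ('v \<Rightarrow>\<^sub>L real)) \<Rightarrow>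
     (real \<Rightarrow> 'v) \<Rightarrow> (real \<Rightarrow> 'v) \<Rightarrow> real" where
  "nemytskii T A w = L2_functional T (\<lambda>t. A t (w t))"

definition B_e ::
    "('v::real_inner \<Rightarrow> 'h::real_inner) \<Rightarrow> real \<Rightarrow> (real \<Rightarrow> 'v \<Rightarrow> ('v \<Rightarrow>\<^sub>L real)) \<Rightarrow>
     (real \<Rightarrow> 'v) \<Rightarrow> ((real \<Rightarrow> 'v) \<Rightarrow> real) \<times> 'h" where
  "B_e j T A u = (\<lambda>v. d_t j T u v + nemytskii T A u v, trace_at j T 0 u)"

text \<open>
  As elements of \<open>X\<close> are represented by functions, this picks a representative of the preimage.
\<close>

definition B_e_inverse ::
    "('v::real_inner \<Rightarrow> 'h::real_inner) \<Rightarrow> real \<Rightarrow> (real \<Rightarrow> 'v \<Rightarrow> ('v \<Rightarrow>\<^sub>L real)) \<Rightarrow>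
     ((real \<Rightarrow> 'v) \<Rightarrow> real) \<times> 'h \<Rightarrow> real \<Rightarrow> 'v" where
  "B_e_inverse j T A = inv_into (X_space j T) (B_e j T A)"

definition data_norm :: "real \<Rightarrow> ((real \<Rightarrow> 'v::real_normed_vector) \<Rightarrow> real) \<times> 'h::real_normed_vector \<Rightarrow> real" where
  "data_norm T p = L2_dual_norm T (fst p) + norm (snd p)"

end

theory Submission
  imports Defs
begin

text \<open>
  Let \<open>u\<close> and \<open>v\<close> be the preimages of two data \<open>(l\<^sub>1, a)\<close> and \<open>(l\<^sub>2, b)\<close>, and put \<open>w = u - v\<close>,
  \<open>l = l\<^sub>1 - l\<^sub>2\<close> and \<open>\<delta> = A u - A v\<close>, so that \<open>d\<^sub>t w + \<delta> = l\<close> and \<open>w(0) = a - b\<close>.  Strong monotonicity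
  of \<open>A\<close> gives

  \<open>m\<^sub>A \<parallel>w\<parallel>\<^sup>2 \<le> \<delta>(w) \<le> \<parallel>l\<parallel> \<parallel>w\<parallel> - (d\<^sub>t w)(w)\<close>.

  The inverse of \<open>A\<close> is strongly monotone with constant \<open>m\<^sub>A / L\<^sub>A\<^sup>2\<close> and Lipschitz with constant
  \<open>1 / m\<^sub>A\<close>.  Comparing \<open>u\<close> and \<open>v\<close> through the point \<open>z\<close> with \<open>A z = A v - d\<^sub>t w\<close> therefore gives

  \<open>m\<^sub>A / L\<^sub>A\<^sup>2 \<parallel>d\<^sub>t w\<parallel>\<^sup>2 \<le> - (d\<^sub>t w)(w) + \<parallel>d\<^sub>t w\<parallel> \<parallel>l\<parallel> / m\<^sub>A\<close>.

  Adding the two inequalities and inserting \<open>2 (d\<^sub>t w)(w) = \<parallel>w(T)\<parallel>\<^sup>2 - \<parallel>w(0)\<parallel>\<^sup>2\<close> bounds \<open>m\<^sub>S \<parallel>w\<parallel>\<^sub>X\<^sup>2\<close> by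
  \<open>\<parallel>a - b\<parallel>\<^sup>2 + (1 + 1 / m\<^sub>A) \<parallel>l\<parallel> \<parallel>w\<parallel>\<^sub>X\<close>, and the constant follows (lemma
  \<open>lipschitz_bound_arithmetic\<close>).

  The point \<open>z\<close> is replaced by an explicit vector: a multiple of the identity plus a skew map that
  rotates the plane of \<open>w\<close> and \<open>\<delta>\<close> also maps \<open>\<delta>\<close> to \<open>w\<close>, and this linear map takes over the role of
  the inverse of \<open>A\<close> (\<open>L2_rotation_inequality\<close>).  Functionals are represented by vectors up to an
  arbitrarily small error (\<open>L2_approximate_Riesz\<close>), which carries the inequality over to the dual
  (\<open>L2_dual_rotation_inequality\<close>, \<open>inverse_monotonicity_inequality\<close>).

  The other ingredient is the theory of the space \<open>X\<close>: the existence of a continuous representative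
  with values in \<open>H\<close>, and the energy identity (\<open>continuous_representative\<close>, \<open>energy_identity\<close>).  Its
  scalar basis is the lemma of du Bois-Reymond, which turns a weak derivative into a primitive.  For
  almost all \<open>s\<close> and \<open>t\<close> it yields \<open>(w(t) - w(s), w(r)) = \<integral>\<^sub>s\<^sup>t w'(\<tau>)(w(r)) d\<tau>\<close> for almost all \<open>r\<close>
  (\<open>in_dual_increments\<close>).  Difference quotients, whose weak limit is \<open>w'\<close>
  (\<open>dual_quot_weak_convergence\<close>), and the convexity of the square of the norm then show that
  \<open>\<parallel>w(t)\<parallel>\<^sup>2\<close> has the weak derivative \<open>2 w'(t)(w(t))\<close>
  (\<open>weak_energy_identity\<close>).
\<close>

section \<open>Strongly measurable functions\<close>

lemma lebesgue_on_measurable_AE_cong: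
  fixes f g :: "real \<Rightarrow> real"
  assumes S: "S \<in> sets lebesgue" and f: "f \<in> borel_measurable (lebesgue_on S)"
    and ae: "AE x in lebesgue_on S. f x = g x"
  shows "g \<in> borel_measurable (lebesgue_on S)"
proof -
  have "(\<lambda>x. if x \<in> S then f x else 0) \<in> borel_measurable lebesgue"
    using f S by (simp add: borel_measurable_if)
  moreover have "AE x in lebesgue. (if x \<in> S then f x else 0) = (if x \<in> S then g x else 0)"
    using ae S by (auto simp: AE_restrict_space_iff)
  ultimately have "(\<lambda>x. if x \<in> S then g x else 0) \<in> borel_measurable lebesgue"
    by (rule borel_measurable_AE)
  then show ?thesis
    using S by (simp add: borel_measurable_if)
qed

lemma lebesgue_on_measurable_AE_LIMSEQ:
  fixes g :: "real \<Rightarrow> real"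
  assumes S: "S \<in> sets lebesgue" and s: "\<And>n. s n \<in> borel_measurable (lebesgue_on S)"
    and lim: "AE x in lebesgue_on S. (\<lambda>n. s n x) \<longlonglongrightarrow> g x"
  shows "g \<in> borel_measurable (lebesgue_on S)"
proof (rule lebesgue_on_measurable_AE_cong[OF S])
  show "(\<lambda>x. lim (\<lambda>n. s n x)) \<in> borel_measurable (lebesgue_on S)"
    using s by (rule borel_measurable_lim_metric)
  show "AE x in lebesgue_on S. lim (\<lambda>n. s n x) = g x"
    using lim by eventually_elim (rule limI)
qed

lemma strongly_measurable_compose2:
  assumes f: "strongly_measurable M f" and g: "strongly_measurable M g"
    and cont: "\<And>x y. isCont (\<lambda>p. h (fst p) (snd p)) (x, y)"
  shows "strongly_measurable M (\<lambda>t. h (f t) (g t))"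
proof -
  obtain s where s: "\<And>n. simple_function M (s n)" "AE x in M. (\<lambda>n. s n x) \<longlonglongrightarrow> f x"
    using f unfolding strongly_measurable_def by blast
  obtain r where r: "\<And>n. simple_function M (r n)" "AE x in M. (\<lambda>n. r n x) \<longlonglongrightarrow> g x"
    using g unfolding strongly_measurable_def by blast
  have "AE x in M. (\<lambda>n. h (s n x) (r n x)) \<longlonglongrightarrow> h (f x) (g x)"
    using s(2) r(2)
  proof eventually_elim
    case (elim x)
    have "(\<lambda>n. (s n x, r n x)) \<longlonglongrightarrow> (f x, g x)"
      using elim by (rule tendsto_Pair)
    from isCont_tendsto_compose[OF cont this] show ?case by simp
  qed
  moreover have "simple_function M (\<lambda>x. h (s n x) (r n x))" for n
    using s(1) r(1) by (rule simple_function_compose2)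
  ultimately show ?thesis
    unfolding strongly_measurable_def by (intro exI[of _ "\<lambda>n x. h (s n x) (r n x)"]) auto
qed

lemma strongly_measurable_compose:
  assumes f: "strongly_measurable M f" and cont: "\<And>x. isCont h x"
  shows "strongly_measurable M (\<lambda>t. h (f t))"
proof (rule strongly_measurable_compose2[OF f f, of "\<lambda>x y. h x"])
  show "isCont (\<lambda>p. h (fst p)) (x, y)" for x and y :: 'b
    using isCont_o2[where f=fst and g=h and a="(x, y)"] cont by (auto intro!: continuous_intros)
qed

lemma strongly_measurable_lincomb:
  assumes "strongly_measurable M f" "strongly_measurable M g"
  shows "strongly_measurable M (\<lambda>t. a *\<^sub>R f t + b *\<^sub>R g t)"
  by (rule strongly_measurable_compose2[OF assms, of "\<lambda>x y. a *\<^sub>R x + b *\<^sub>R y"])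
     (intro continuous_intros)

lemma strongly_measurable_simple: "simple_function M f \<Longrightarrow> strongly_measurable M f"
  unfolding strongly_measurable_def by (intro exI[of _ "\<lambda>n. f"]) auto

lemma strongly_measurable_real:
  fixes f :: "real \<Rightarrow> real"
  assumes "strongly_measurable (lebesgue_on S) f" "S \<in> sets lebesgue"
  shows "f \<in> borel_measurable (lebesgue_on S)"
proof -
  obtain s where s: "\<And>n. simple_function (lebesgue_on S) (s n)"
      "AE x in (lebesgue_on S). (\<lambda>n. s n x) \<longlonglongrightarrow> f x"
    using assms(1) unfolding strongly_measurable_def by blast
  show ?thesis
    by (rule lebesgue_on_measurable_AE_LIMSEQ[OF assms(2) borel_measurable_simple_function[OF s(1)] s(2)])
qed

lemma strongly_measurable_norm:
  fixes f :: "real \<Rightarrow> 'b::real_normed_vector"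
  assumes "strongly_measurable (lebesgue_on S) f" "S \<in> sets lebesgue"
  shows "(\<lambda>t. norm (f t)) \<in> borel_measurable (lebesgue_on S)"
  by (rule strongly_measurable_real, rule strongly_measurable_compose[OF assms(1), of norm])
     (use assms(2) in \<open>auto intro: continuous_intros\<close>)

text \<open>
  A strongly measurable function is almost everywhere a limit of points taken from the countably
  many values of an approximating sequence of simple functions.  A statement that holds almost
  everywhere for each fixed vector, and is closed in the vector, can thus be evaluated at such a
  function.
\<close>

lemma strongly_measurable_essential_range:
  assumes "strongly_measurable M f"
  obtains D where "countable D" "AE t in M. f t \<in> closure D"
proof -
  obtain s where s: "\<And>n. simple_function M (s n)" "AE x in M. (\<lambda>n. s n x) \<longlonglongrightarrow> f x"
    using assms unfolding strongly_measurable_def by blast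
  define D where "D = (\<Union>n. s n ` space M)"
  have "countable D"
    unfolding D_def using s(1) by (auto simp: simple_function_def intro!: countable_UN intro: countable_finite)
  moreover have "AE t in M. f t \<in> closure D"
    using s(2) AE_space
  proof eventually_elim
    case (elim t)
    then have "s n t \<in> closure D" for n
      unfolding D_def by (intro subsetD[OF closure_subset]) auto
    then show ?case
      by (intro closed_sequentially[OF closed_closure _ elim(1)]) simp
  qed
  ultimately show ?thesis by (rule that)
qed

section \<open>The spaces of square integrable functions\<close>

lemma time_interval_sets: "{0<..<T::real} \<inter> space lebesgue \<in> sets lebesgue"
  by simp

lemma finite_time_measure: "finite_measure (time_measure T)"
  by (rule finite_measure_lebesgue_on) simp

lemma integrable_bounded_time:
  fixes f :: "real \<Rightarrow> real"
  assumes "f \<in> borel_measurable (time_measure T)" "\<And>t. t \<in> {0<..<T} \<Longrightarrow> \<bar>f t\<bar> \<le> B"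
  shows "integrable (time_measure T) f"
  by (rule finite_measure.integrable_const_bound[OF finite_time_measure, of _ B])
     (use assms in auto)

lemma L2_strongly_measurable: "v \<in> bochner_L2 T \<Longrightarrow> strongly_measurable (time_measure T) v"
  and L2_norm_integrable: "v \<in> bochner_L2 T \<Longrightarrow> integrable (time_measure T) (\<lambda>t. (norm (v t))\<^sup>2)"
  by (auto simp: bochner_L2_def)

lemma L2_norm_measurable:
  assumes "v \<in> bochner_L2 T" shows "(\<lambda>t. norm (v t)) \<in> borel_measurable (time_measure T)"
  by (rule strongly_measurable_norm[OF L2_strongly_measurable[OF assms]]) simp

lemma L2_lincomb:
  assumes u: "u \<in> bochner_L2 T" and v: "v \<in> bochner_L2 T"
  shows "(\<lambda>t. a *\<^sub>R u t + b *\<^sub>R v t) \<in> bochner_L2 T"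
proof -
  let ?w = "\<lambda>t. a *\<^sub>R u t + b *\<^sub>R v t"
  have sm: "strongly_measurable (time_measure T) ?w"
    by (intro strongly_measurable_lincomb L2_strongly_measurable u v)
  have meas: "(\<lambda>t. norm (?w t)) \<in> borel_measurable (time_measure T)"
    by (rule strongly_measurable_norm[OF sm]) simp
  have "integrable (time_measure T) (\<lambda>t. (norm (?w t))\<^sup>2)"
  proof (rule Bochner_Integration.integrable_bound)
    show "integrable (time_measure T) (\<lambda>t. 2 * a\<^sup>2 * (norm (u t))\<^sup>2 + 2 * b\<^sup>2 * (norm (v t))\<^sup>2)"
      using u v by (intro Bochner_Integration.integrable_add integrable_mult_right L2_norm_integrable)
    show "(\<lambda>t. (norm (?w t))\<^sup>2) \<in> borel_measurable (time_measure T)"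
      using meas by measurable
    have "(norm (?w t))\<^sup>2 \<le> 2 * a\<^sup>2 * (norm (u t))\<^sup>2 + 2 * b\<^sup>2 * (norm (v t))\<^sup>2" for t
    proof -
      have "norm (?w t) \<le> \<bar>a\<bar> * norm (u t) + \<bar>b\<bar> * norm (v t)"
        by (metis norm_scaleR norm_triangle_ineq)
      then have "(norm (?w t))\<^sup>2 \<le> (\<bar>a\<bar> * norm (u t) + \<bar>b\<bar> * norm (v t))\<^sup>2"
        by (intro power_mono) auto
      also have "\<dots> \<le> 2 * (\<bar>a\<bar> * norm (u t))\<^sup>2 + 2 * (\<bar>b\<bar> * norm (v t))\<^sup>2"
        using sum_squares_bound[of "\<bar>a\<bar> * norm (u t)" "\<bar>b\<bar> * norm (v t)"]
        by (simp add: power2_sum)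
      finally show ?thesis by (simp add: power_mult_distrib)
    qed
    then show "AE t in time_measure T. norm ((norm (?w t))\<^sup>2)
        \<le> norm (2 * a\<^sup>2 * (norm (u t))\<^sup>2 + 2 * b\<^sup>2 * (norm (v t))\<^sup>2)"
      by (intro AE_I2) (simp add: abs_of_nonneg)
  qed
  with sm show ?thesis by (simp add: bochner_L2_def)
qed

lemma L2_diff: "u \<in> bochner_L2 T \<Longrightarrow> v \<in> bochner_L2 T \<Longrightarrow> u - v \<in> bochner_L2 T"
  using L2_lincomb[of u T v 1 "-1"] by (simp add: fun_diff_def)

lemma L2_scaleR: "u \<in> bochner_L2 T \<Longrightarrow> (\<lambda>t. c *\<^sub>R u t) \<in> bochner_L2 T"
  using L2_lincomb[of u T u c 0] by simp

lemma L2_simple: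
  assumes "simple_function (time_measure T) s" shows "s \<in> bochner_L2 T"
proof -
  have s2: "simple_function (time_measure T) (\<lambda>t. (norm (s t))\<^sup>2)"
    using assms by (rule simple_function_compose1)
  have fin: "finite ((\<lambda>t. (norm (s t))\<^sup>2) ` {0<..<T})"
    using s2 by (simp add: simple_function_def)
  have "integrable (time_measure T) (\<lambda>t. (norm (s t))\<^sup>2)"
  proof (rule integrable_bounded_time)
    show "\<bar>(norm (s t))\<^sup>2\<bar> \<le> Max ((\<lambda>t. (norm (s t))\<^sup>2) ` {0<..<T})" if "t \<in> {0<..<T}" for t
      using Max_ge[OF fin] that by simp
  qed (use s2 in \<open>rule borel_measurable_simple_function\<close>)
  then show ?thesis
    using strongly_measurable_simple[OF assms] by (simp add: bochner_L2_def)
qed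

lemma L2_const: "(\<lambda>t. \<xi>) \<in> bochner_L2 T"
  by (rule L2_simple) simp

lemma L2_pairing_integrable:
  assumes u: "u \<in> bochner_L2 T" and v: "v \<in> bochner_L2 T"
    and cont: "\<And>x y. isCont (\<lambda>p. h (fst p) (snd p)) (x, y)"
    and bound: "\<And>x y. \<bar>h x y\<bar> \<le> norm x * norm y"
  shows "integrable (time_measure T) (\<lambda>t. h (u t) (v t) :: real)"
proof (rule Bochner_Integration.integrable_bound)
  show "integrable (time_measure T) (\<lambda>t. (norm (u t))\<^sup>2 + (norm (v t))\<^sup>2)"
    using u v by (intro Bochner_Integration.integrable_add L2_norm_integrable)
  show "(\<lambda>t. h (u t) (v t)) \<in> borel_measurable (time_measure T)"
    by (rule strongly_measurable_real[OF strongly_measurable_compose2])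
       (use u v cont in \<open>auto intro: L2_strongly_measurable\<close>)
  have "\<bar>h (u t) (v t)\<bar> \<le> (norm (u t))\<^sup>2 + (norm (v t))\<^sup>2" for t
    using bound[of "u t" "v t"] sum_squares_bound[of "norm (u t)" "norm (v t)"]
      mult_nonneg_nonneg[OF norm_ge_zero norm_ge_zero, of "u t" "v t"]
    by linarith
  then show "AE t in time_measure T. norm (h (u t) (v t)) \<le> norm ((norm (u t))\<^sup>2 + (norm (v t))\<^sup>2)"
    by (intro AE_I2) (simp add: abs_of_nonneg)
qed

lemma L2_inner_integrable:
  fixes u v :: "real \<Rightarrow> 'v::real_inner"
  assumes "u \<in> bochner_L2 T" "v \<in> bochner_L2 T"
  shows "integrable (time_measure T) (\<lambda>t. inner (u t) (v t))"
  by (rule L2_pairing_integrable[OF assms]) (auto intro!: continuous_intros Cauchy_Schwarz_ineq2)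

lemma L2_blinfun_integrable:
  fixes g :: "real \<Rightarrow> ('v::real_normed_vector \<Rightarrow>\<^sub>L real)"
  assumes "g \<in> bochner_L2 T" "v \<in> bochner_L2 T"
  shows "integrable (time_measure T) (\<lambda>t. blinfun_apply (g t) (v t))"
proof (rule L2_pairing_integrable[OF assms])
  show "\<bar>blinfun_apply x y\<bar> \<le> norm x * norm y" for x :: "'v \<Rightarrow>\<^sub>L real" and y
    using norm_blinfun[of x y] by simp
qed (intro continuous_intros)

lemma L2_norm_product_integrable:
  assumes "u \<in> bochner_L2 T" "v \<in> bochner_L2 T"
  shows "integrable (time_measure T) (\<lambda>t. norm (u t) * norm (v t))"
  by (rule L2_pairing_integrable[OF assms, of "\<lambda>x y. norm x * norm y"]) (auto intro!: continuous_intros)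

lemma L2_norm_integrable1:
  assumes "u \<in> bochner_L2 T"
  shows "integrable (time_measure T) (\<lambda>t. norm (u t))"
  using L2_norm_product_integrable[OF assms L2_const[of "1::real"]] by simp

lemma L2_norm_nonneg: "0 \<le> bochner_L2_norm T v"
  by (simp add: bochner_L2_norm_def)

lemma L2_norm_square: "(bochner_L2_norm T v)\<^sup>2 = (\<integral>t. (norm (v t))\<^sup>2 \<partial>time_measure T)"
  by (simp add: bochner_L2_norm_def)

text \<open>
  Cutting the approximating simple functions off where they exceed twice the norm of the limit
  makes dominated convergence applicable.
\<close>

lemma L2_simple_approximation:
  assumes v: "v \<in> bochner_L2 T" and "e > 0"
  obtains s where "simple_function (time_measure T) s" "(\<integral>t. (norm (v t - s t))\<^sup>2 \<partial>time_measure T) < e"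
proof -
  let ?M = "time_measure T"
  obtain s where s: "\<And>n. simple_function ?M (s n)" "AE x in ?M. (\<lambda>n. s n x) \<longlonglongrightarrow> v x"
    using L2_strongly_measurable[OF v] unfolding strongly_measurable_def by blast
  define A where "A n = {t \<in> space ?M. norm (s n t) \<le> 2 * norm (v t)}" for n
  define r where "r n t = (if t \<in> A n then s n t else 0)" for n t
  have nm: "(\<lambda>t. norm (s n t)) \<in> borel_measurable ?M" for n
    by (rule borel_measurable_simple_function[OF simple_function_compose1[OF s(1)]])
  have A: "A n \<in> sets ?M" for n
    unfolding A_def using nm L2_norm_measurable[OF v] by measurable
  have r: "simple_function ?M (r n)" for n
    unfolding r_def by (rule simple_function_If_set[OF s(1)]) (use A in auto)
  have lim: "AE t in ?M. (\<lambda>n. r n t) \<longlonglongrightarrow> v t"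
    using s(2) AE_space
  proof eventually_elim
    case (elim t)
    show ?case
    proof (cases "v t = 0")
      case True
      then have "r n t = 0" for n by (auto simp: r_def A_def)
      with True show ?thesis by simp
    next
      case False
      then have "eventually (\<lambda>n. norm (s n t) < 2 * norm (v t)) sequentially"
        by (intro order_tendstoD(2)[OF tendsto_norm[OF elim(1)]]) auto
      then have "eventually (\<lambda>n. s n t = r n t) sequentially"
        by eventually_elim (use elim(2) in \<open>auto simp: r_def A_def\<close>)
      with elim(1) show ?thesis by (rule Lim_transform_eventually)
    qed
  qed
  have rn: "norm (r n t) \<le> 2 * norm (v t)" for n t
    by (auto simp: r_def A_def)
  have "(\<lambda>n. \<integral>t. (norm (v t - r n t))\<^sup>2 \<partial>?M) \<longlonglongrightarrow> (\<integral>t. 0 \<partial>?M)"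
  proof (rule integral_dominated_convergence)
    show "integrable ?M (\<lambda>t. 9 * (norm (v t))\<^sup>2)"
      using L2_norm_integrable[OF v] by simp
    show "(\<lambda>t. (norm (v t - r n t))\<^sup>2) \<in> borel_measurable ?M" for n
      using L2_norm_measurable[OF L2_diff[OF v L2_simple[OF r[of n]]]]
      by (simp add: fun_diff_def)
    show "AE t in ?M. (\<lambda>n. (norm (v t - r n t))\<^sup>2) \<longlonglongrightarrow> 0"
      using lim
    proof eventually_elim
      case (elim t)
      have "(\<lambda>n. (norm (v t - r n t))\<^sup>2) \<longlonglongrightarrow> (norm (v t - v t))\<^sup>2"
        by (intro tendsto_intros elim)
      then show ?case by simp
    qed
    have "norm (v t - r n t) \<le> 3 * norm (v t)" for t n
      using norm_triangle_ineq4[of "v t" "r n t"] rn[of n t] by simp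
    then have "(norm (v t - r n t))\<^sup>2 \<le> 9 * (norm (v t))\<^sup>2" for t n
      using power_mono[of "norm (v t - r n t)" "3 * norm (v t)" 2] by (simp add: power_mult_distrib)
    then show "AE t in ?M. norm ((norm (v t - r n t))\<^sup>2) \<le> 9 * (norm (v t))\<^sup>2" for n
      by simp
  qed simp
  then have "eventually (\<lambda>n. (\<integral>t. (norm (v t - r n t))\<^sup>2 \<partial>?M) < e) sequentially"
    using order_tendstoD(2)[of _ 0 sequentially e] \<open>e > 0\<close> by simp
  then obtain n where "(\<integral>t. (norm (v t - r n t))\<^sup>2 \<partial>?M) < e"
    by (auto simp: eventually_sequentially)
  with r show ?thesis by (rule that)
qed

section \<open>Test functions\<close>

definition smooth :: "(real \<Rightarrow> real) \<Rightarrow> bool" where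
  "smooth f \<longleftrightarrow> (\<forall>n x. (deriv ^^ n) f field_differentiable at x)"

lemma DERIV_locally_zero:
  fixes f :: "real \<Rightarrow> real"
  assumes "open S" "x \<in> S" "\<And>y. y \<in> S \<Longrightarrow> f y = 0"
  shows "(f has_field_derivative 0) (at x)"
proof -
  have "((\<lambda>x. 0) has_field_derivative 0) (at x)" by simp
  then show ?thesis
    by (rule DERIV_cong_ev[THEN iffD1, rotated -1])
       (use eventually_nhds_in_open[OF assms(1,2)] assms(3) in \<open>auto elim!: eventually_mono\<close>)
qed

text \<open>
  Smoothness of explicit functions is proved by exhibiting a set of functions that is closed under
  differentiation.
\<close>

lemma smooth_coinduct:
  assumes "f \<in> S" and S: "\<And>g. g \<in> S \<Longrightarrow> \<exists>g'\<in>S. \<forall>x. (g has_field_derivative g' x) (at x)"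
  shows "smooth f"
proof -
  have closed: "deriv g \<in> S \<and> (\<forall>x. g field_differentiable at x)" if g: "g \<in> S" for g
  proof -
    obtain g' where g': "g' \<in> S" "\<And>x. (g has_field_derivative g' x) (at x)"
      using S[OF g] by blast
    then have "deriv g = g'" by (auto intro: DERIV_imp_deriv)
    with g' show ?thesis by (auto simp: field_differentiable_def)
  qed
  have "(deriv ^^ n) f \<in> S" for n
    by (induction n) (use assms(1) closed in auto)
  with closed show ?thesis by (auto simp: smooth_def)
qed

lemma smooth_has_derivative: "smooth f \<Longrightarrow> (f has_field_derivative deriv f x) (at x)"
  unfolding smooth_def by (metis field_differentiable_derivI funpow_0)

lemma smooth_deriv: "smooth f \<Longrightarrow> smooth (deriv f)"
  unfolding smooth_def by (metis funpow_Suc_right o_apply)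

lemma smooth_antiderivative:
  assumes "smooth f" "\<And>x. (F has_field_derivative f x) (at x)"
  shows "smooth F"
proof (rule smooth_coinduct[of _ "insert F {f. smooth f}"])
  fix g assume "g \<in> insert F {f. smooth f}"
  then show "\<exists>g'\<in>insert F {f. smooth f}. \<forall>x. (g has_field_derivative g' x) (at x)"
    using assms smooth_has_derivative smooth_deriv by blast
qed simp

lemma smooth_add:
  assumes "smooth f" "smooth g" shows "smooth (\<lambda>x. f x + g x)"
proof (rule smooth_coinduct[of _ "{\<lambda>x. f x + g x |f g. smooth f \<and> smooth g}"])
  fix h assume "h \<in> {\<lambda>x. f x + g x |f g. smooth f \<and> smooth g}"
  then obtain f g where h: "h = (\<lambda>x. f x + g x)" "smooth f" "smooth g" by auto
  show "\<exists>h'\<in>{\<lambda>x. f x + g x |f g. smooth f \<and> smooth g}. \<forall>x. (h has_field_derivative h' x) (at x)"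
    by (rule bexI[of _ "\<lambda>x. deriv f x + deriv g x"])
       (use h in \<open>auto intro!: derivative_intros smooth_has_derivative intro: smooth_deriv\<close>)
qed (use assms in auto)

inductive_set sums_of_smooth_products :: "(real \<Rightarrow> real) set" where
  product: "smooth f \<Longrightarrow> smooth g \<Longrightarrow> (\<lambda>x. f x * g x) \<in> sums_of_smooth_products"
| sum: "p \<in> sums_of_smooth_products \<Longrightarrow> q \<in> sums_of_smooth_products
    \<Longrightarrow> (\<lambda>x. p x + q x) \<in> sums_of_smooth_products"

lemma smooth_mult:
  assumes "smooth f" "smooth g" shows "smooth (\<lambda>x. f x * g x)"
proof (rule smooth_coinduct[of _ sums_of_smooth_products])
  fix h assume "h \<in> sums_of_smooth_products"
  then show "\<exists>h'\<in>sums_of_smooth_products. \<forall>x. (h has_field_derivative h' x) (at x)"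
  proof induction
    case (product f g)
    show ?case
    proof (intro bexI allI)
      show "((\<lambda>x. f x * g x) has_field_derivative deriv f x * g x + f x * deriv g x) (at x)" for x
        using DERIV_mult[OF smooth_has_derivative[OF product(1)] smooth_has_derivative[OF product(2)], of x]
        by (simp add: mult.commute)
      show "(\<lambda>x. deriv f x * g x + f x * deriv g x) \<in> sums_of_smooth_products"
        using product by (intro sums_of_smooth_products.intros smooth_deriv)
    qed
  next
    case (sum p q)
    then obtain p' q' where p': "p' \<in> sums_of_smooth_products" "\<And>x. (p has_field_derivative p' x) (at x)"
      and q': "q' \<in> sums_of_smooth_products" "\<And>x. (q has_field_derivative q' x) (at x)" by blast
    show ?case
      by (rule bexI[of _ "\<lambda>x. p' x + q' x"])
         (use p' q' in \<open>auto intro!: derivative_intros sums_of_smooth_products.intros\<close>)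
  qed
qed (use assms in \<open>rule sums_of_smooth_products.product\<close>)

lemma smooth_const: "smooth (\<lambda>x. c)"
  by (rule smooth_coinduct[of _ "range (\<lambda>c x. c)"]) (auto intro!: derivative_eq_intros)

lemma smooth_affine:
  assumes "smooth f" shows "smooth (\<lambda>x. f (a * x + b))"
proof (rule smooth_coinduct[of _ "{\<lambda>x. c * f (a * x + b) |f c. smooth f}"])
  show "(\<lambda>x. f (a * x + b)) \<in> {\<lambda>x. c * f (a * x + b) |f c. smooth f}"
    using assms by (auto intro!: exI[of _ f] exI[of _ 1])
  fix h assume "h \<in> {\<lambda>x. c * f (a * x + b) |f c. smooth f}"
  then obtain f c where h: "h = (\<lambda>x. c * f (a * x + b))" "smooth f" by auto
  have "((\<lambda>x. c * f (a * x + b)) has_field_derivative c * (deriv f (a * x + b) * a)) (at x)" for x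
    by (intro DERIV_cmult DERIV_chain2[OF smooth_has_derivative[OF h(2)]])
       (auto intro!: derivative_eq_intros)
  then show "\<exists>h'\<in>{\<lambda>x. c * f (a * x + b) |f c. smooth f}. \<forall>x. (h has_field_derivative h' x) (at x)"
    using h by (intro bexI[of _ "\<lambda>x. (c * a) * deriv f (a * x + b)"])
      (auto simp: mult_ac intro!: exI[of _ "deriv f"] exI[of _ "c * a"] smooth_deriv)
qed

text \<open>
  The derivatives of \<open>exp (- 1 / x)\<close> have the form \<open>p (1 / x) * exp (- 1 / x)\<close> with a polynomial
  \<open>p\<close>, and all these functions vanish to infinite order at \<open>0\<close>.
\<close>

definition flat :: "real poly \<Rightarrow> real \<Rightarrow> real" where
  "flat p x = (if x \<le> 0 then 0 else poly p (1 / x) * exp (- (1 / x)))"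

lemma poly_times_exp_minus_tendsto: "((\<lambda>y. poly p y * exp (- y)) \<longlongrightarrow> 0) at_top" for p :: "real poly"
proof -
  have "((\<lambda>y. \<Sum>i\<le>degree p. coeff p i * (y ^ i / exp y)) \<longlongrightarrow> (\<Sum>i\<le>degree p. coeff p i * 0)) at_top"
    by (intro tendsto_intros tendsto_power_div_exp_0)
  then show ?thesis
    by (simp add: poly_altdef exp_minus field_simps sum_distrib_left sum_divide_distrib)
qed

lemma flat_tendsto_0: "(flat p \<longlongrightarrow> 0) (at 0)"
proof (rule filterlim_split_at)
  have "eventually (\<lambda>x::real. x \<le> 0) (at_left 0)"
    by (simp add: eventually_at_left_real eventually_at_filter)
  then show "(flat p \<longlongrightarrow> 0) (at_left 0)"
    by (intro tendsto_eventually) (auto simp: flat_def elim: eventually_mono)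
  have "((\<lambda>x. poly p (inverse x) * exp (- inverse x)) \<longlongrightarrow> 0) (at_right 0)"
    by (rule filterlim_compose[OF poly_times_exp_minus_tendsto filterlim_inverse_at_top_right])
  moreover have "eventually (\<lambda>x. poly p (inverse x) * exp (- inverse x) = flat p x) (at_right 0)"
    unfolding eventually_at_filter by (auto simp: flat_def inverse_eq_divide)
  ultimately show "(flat p \<longlongrightarrow> 0) (at_right 0)"
    by (rule Lim_transform_eventually)
qed

lemma flat_has_derivative:
  "(flat p has_field_derivative flat ([:0, 0, 1:] * (p - pderiv p)) x) (at x)"
proof (cases x "0::real" rule: linorder_cases)
  case less
  then have "(flat p has_field_derivative 0) (at x)"
    by (intro DERIV_locally_zero[of "{..<0}"]) (auto simp: flat_def)
  then show ?thesis using less by (simp add: flat_def)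
next
  case equal
  have "((\<lambda>h. (flat p (0 + h) - flat p 0) / h) \<longlongrightarrow> 0) (at 0)"
  proof (rule Lim_transform_eventually[OF flat_tendsto_0[of "[:0, 1:] * p"]])
    show "\<forall>\<^sub>F x in at 0. flat ([:0, 1:] * p) x = (flat p (0 + x) - flat p 0) / x"
      unfolding eventually_at_filter by (auto simp: flat_def)
  qed
  then show ?thesis using equal by (simp add: DERIV_def flat_def)
next
  case greater
  have "((\<lambda>x. poly p (1 / x) * exp (- (1 / x))) has_field_derivative
      poly ([:0, 0, 1:] * (p - pderiv p)) (1 / x) * exp (- (1 / x))) (at x)"
    using greater
    by (auto intro!: derivative_eq_intros DERIV_chain2[OF poly_DERIV] simp: field_simps power2_eq_square)
  then have "(flat p has_field_derivative
      poly ([:0, 0, 1:] * (p - pderiv p)) (1 / x) * exp (- (1 / x))) (at x)"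
    by (rule DERIV_cong_ev[THEN iffD1, rotated -1])
       (use eventually_nhds_in_open[of "{0<..}" x] greater in \<open>auto simp: flat_def elim!: eventually_mono\<close>)
  then show ?thesis using greater by (simp add: flat_def)
qed

lemma smooth_flat: "smooth (flat p)"
proof (rule smooth_coinduct[of _ "range flat"])
  fix g assume "g \<in> range flat"
  then obtain p where g: "g = flat p" by blast
  show "\<exists>g'\<in>range flat. \<forall>x. (g has_field_derivative g' x) (at x)"
  proof (rule bexI)
    show "\<forall>x. (g has_field_derivative flat ([:0, 0, 1:] * (p - pderiv p)) x) (at x)"
      unfolding g by (intro allI) (rule flat_has_derivative)
  qed (rule rangeI)
qed simp

lemma is_test_function_iff:
  assumes "T > 0"
  shows "is_test_function T \<phi> \<longleftrightarrow>
    smooth \<phi> \<and> (\<exists>a b. 0 < a \<and> a < b \<and> b < T \<and> (\<forall>x. x \<notin> {a..b} \<longrightarrow> \<phi> x = 0))"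
proof (intro iffI conjI)
  assume L: "is_test_function T \<phi>"
  then show "smooth \<phi>" by (simp add: is_test_function_def smooth_def)
  define K where "K = closure {x. \<phi> x \<noteq> 0}"
  have K: "K \<subseteq> {0<..<T}" using L by (simp add: K_def is_test_function_def)
  have out: "\<phi> x = 0" if "x \<notin> K" for x
    using that closure_subset[of "{x. \<phi> x \<noteq> 0}"] unfolding K_def by auto
  have "bounded K" using bounded_subset[OF bounded_box[of 0 T]] K by simp
  then have cK: "compact K" unfolding K_def by (simp add: compact_eq_bounded_closed)
  show "\<exists>a b. 0 < a \<and> a < b \<and> b < T \<and> (\<forall>x. x \<notin> {a..b} \<longrightarrow> \<phi> x = 0)"
  proof (cases "K = {}")
    case True
    then show ?thesis
      using out assms by (intro exI[of _ "T / 3"] exI[of _ "T / 2"]) auto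
  next
    case False
    obtain c where c: "c \<in> K" "\<And>x. x \<in> K \<Longrightarrow> c \<le> x"
      using compact_attains_inf[OF cK False] by auto
    obtain d where d: "d \<in> K" "\<And>x. x \<in> K \<Longrightarrow> x \<le> d"
      using compact_attains_sup[OF cK False] by auto
    have "0 < c" "c \<le> d" "d < T" using K c d by auto
    then show ?thesis
      using out c(2) d(2) by (intro exI[of _ c] exI[of _ "(d + T) / 2"]) force
  qed
next
  assume R: "smooth \<phi> \<and> (\<exists>a b. 0 < a \<and> a < b \<and> b < T \<and> (\<forall>x. x \<notin> {a..b} \<longrightarrow> \<phi> x = 0))"
  then obtain a b where ab: "0 < a" "b < T" "\<And>x. x \<notin> {a..b} \<Longrightarrow> \<phi> x = 0" by blast
  have "closure {x. \<phi> x \<noteq> 0} \<subseteq> {a..b}"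
    by (rule closure_minimal) (use ab(3) in blast, simp)
  also have "\<dots> \<subseteq> {0<..<T}" using ab by auto
  finally show "is_test_function T \<phi>" using R by (simp add: is_test_function_def smooth_def)
qed

lemma test_function_smooth: "is_test_function T \<phi> \<Longrightarrow> smooth \<phi>"
  by (simp add: is_test_function_def smooth_def)

lemma test_function_support:
  assumes "is_test_function T \<phi>" "T > 0"
  obtains a b where "0 < a" "a < b" "b < T" "\<And>x. x \<notin> {a..b} \<Longrightarrow> \<phi> x = 0"
  using assms is_test_function_iff by blast

lemma smooth_continuous: "smooth f \<Longrightarrow> continuous_on S f"
  by (meson DERIV_continuous_on has_field_derivative_at_within smooth_has_derivative)

lemma test_function_lincomb:
  assumes "is_test_function T f" "is_test_function T g" "T > 0"
  shows "is_test_function T (\<lambda>x. c * f x + d * g x)"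
proof -
  obtain a b where ab: "0 < a" "a < b" "b < T" "\<And>x. x \<notin> {a..b} \<Longrightarrow> f x = 0"
    by (rule test_function_support[OF assms(1,3)]) (rule that)
  obtain a' b' where ab': "0 < a'" "a' < b'" "b' < T" "\<And>x. x \<notin> {a'..b'} \<Longrightarrow> g x = 0"
    by (rule test_function_support[OF assms(2,3)]) (rule that)
  have "smooth (\<lambda>x. c * f x + d * g x)"
    using assms by (intro smooth_add smooth_mult smooth_const test_function_smooth)
  moreover have "c * f x + d * g x = 0" if "x \<notin> {min a a'..max b b'}" for x
  proof -
    have "x \<notin> {a..b}" "x \<notin> {a'..b'}" using that by auto
    then show ?thesis using ab(4) ab'(4) by simp
  qed
  ultimately show ?thesis
    unfolding is_test_function_iff[OF assms(3)]
    using ab ab' by (intro conjI exI[of _ "min a a'"] exI[of _ "max b b'"]) auto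
qed

lemma test_function_deriv:
  assumes "is_test_function T f" "T > 0"
  shows "is_test_function T (deriv f)"
proof -
  obtain a b where ab: "0 < a" "a < b" "b < T" "\<And>x. x \<notin> {a..b} \<Longrightarrow> f x = 0"
    by (rule test_function_support[OF assms]) (rule that)
  have "deriv f x = 0" if "x \<notin> {a..b}" for x
    by (rule DERIV_imp_deriv, rule DERIV_locally_zero[of "- {a..b}"])
       (use ab(4) that in \<open>auto simp: open_Compl\<close>)
  then show ?thesis
    unfolding is_test_function_iff[OF assms(2)]
    using ab smooth_deriv[OF test_function_smooth[OF assms(1)]] by blast
qed

lemma test_function_bounded:
  assumes "is_test_function T f" "T > 0"
  obtains B where "\<And>x. \<bar>f x\<bar> \<le> B"
proof -
  obtain a b where ab: "0 < a" "a < b" "b < T" "\<And>x. x \<notin> {a..b} \<Longrightarrow> f x = 0"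
    by (rule test_function_support[OF assms]) (rule that)
  have "compact (f ` {a..b})"
    by (intro compact_continuous_image smooth_continuous test_function_smooth[OF assms(1)]) simp
  then obtain B where "\<forall>x\<in>{a..b}. \<bar>f x\<bar> \<le> B"
    by (auto dest!: compact_imp_bounded simp: bounded_iff)
  then have "\<bar>f x\<bar> \<le> max B 0" for x
    using ab(4)[of x] by (cases "x \<in> {a..b}") (auto simp: max.coboundedI1)
  then show ?thesis by (rule that)
qed

text \<open>
  As \<open>n\<close> grows, the factors \<open>exp (- 1 / (n (x - a)))\<close> and \<open>exp (- 1 / (n (b - x)))\<close> tend to \<open>1\<close> on
  the interval.
\<close>

definition bump :: "real \<Rightarrow> real \<Rightarrow> nat \<Rightarrow> real \<Rightarrow> real" where
  "bump a b n x = flat 1 (real n * x + - (real n * a)) * flat 1 (- real n * x + real n * b)"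

lemma bump_bounds: "0 \<le> bump a b n x" "bump a b n x \<le> 1"
proof -
  have "0 \<le> flat 1 y \<and> flat 1 y \<le> 1" for y by (simp add: flat_def)
  then show "0 \<le> bump a b n x" "bump a b n x \<le> 1"
    unfolding bump_def by (auto intro: mult_le_one)
qed

lemma bump_pos: "0 < n \<Longrightarrow> a < x \<Longrightarrow> x < b \<Longrightarrow> 0 < bump a b n x"
  by (auto simp: bump_def flat_def not_le intro!: mult_pos_pos)

lemma bump_test_function:
  assumes "0 < a" "a < b" "b < T"
  shows "is_test_function T (bump a b n)"
proof -
  have "smooth (bump a b n)"
    unfolding bump_def by (intro smooth_mult smooth_affine smooth_flat)
  moreover have "bump a b n x = 0" if "x \<notin> {a..b}" for x
  proof (cases "x < a")
    case True
    then have "real n * x \<le> real n * a" by (intro mult_left_mono) auto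
    then show ?thesis by (simp add: bump_def flat_def)
  next
    case False
    with that have "real n * b \<le> real n * x" by (intro mult_left_mono) auto
    then show ?thesis by (simp add: bump_def flat_def)
  qed
  ultimately show ?thesis
    using assms by (subst is_test_function_iff) auto
qed

lemma flat_1_tendsto: "((\<lambda>x. flat 1 x) \<longlongrightarrow> 1) at_top"
proof -
  have "((\<lambda>x. exp (- (1 / x))) \<longlongrightarrow> exp (- (0::real))) at_top"
    by (intro tendsto_intros tendsto_divide_0[OF tendsto_const] filterlim_at_top_imp_at_infinity filterlim_ident)
  then have "((\<lambda>x. exp (- (1 / x))) \<longlongrightarrow> (1::real)) at_top"
    by simp
  then show ?thesis
  proof (rule Lim_transform_eventually)
    show "\<forall>\<^sub>F x in at_top. exp (- (1 / x)) = flat 1 x"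
      using eventually_gt_at_top[of "0::real"] by eventually_elim (simp add: flat_def)
  qed
qed

lemma bump_tendsto:
  assumes "0 < x" "x < b"
  shows "(\<lambda>n. bump (1 / real n) (b - 1 / real n) n x) \<longlonglongrightarrow> 1"
proof -
  have lin: "filterlim (\<lambda>n. real n * c + - 1) at_top sequentially" if "c > 0" for c
    using that
    by (intro filterlim_tendsto_add_at_top[OF tendsto_const, of _ _ "-1", unfolded add.commute[of "-1"]]
        filterlim_at_top_mult_tendsto_pos[OF tendsto_const that filterlim_real_sequentially])
  have "(\<lambda>n. flat 1 (real n * x + - 1) * flat 1 (real n * (b - x) + - 1)) \<longlonglongrightarrow> 1 * 1"
    using assms by (intro tendsto_mult filterlim_compose[OF flat_1_tendsto] lin) auto
  then have "(\<lambda>n. flat 1 (real n * x + - 1) * flat 1 (real n * (b - x) + - 1)) \<longlonglongrightarrow> 1"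
    by simp
  then show ?thesis
  proof (rule Lim_transform_eventually)
    show "\<forall>\<^sub>F n in sequentially. flat 1 (real n * x + - 1) * flat 1 (real n * (b - x) + - 1) =
        bump (1 / real n) (b - 1 / real n) n x"
      using eventually_gt_at_top[of 0] by eventually_elim (simp add: bump_def algebra_simps)
  qed
qed

section \<open>Primitives and difference quotients\<close>

definition prim :: "real \<Rightarrow> (real \<Rightarrow> real) \<Rightarrow> real \<Rightarrow> real" where
  "prim T f t = (\<integral>r. indicat_real {..t} r * f r \<partial>time_measure T)"

lemma lebesgue_on_indicator_measurable:
  assumes "A \<in> sets borel"
  shows "indicat_real A \<in> borel_measurable (lebesgue_on S)"
  using assms by (intro measurable_restrict_space1 borel_measurable_indicator) (metis sets_completionI_sets sets_lborel)

lemma integrable_indicator_mult: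
  assumes "integrable (time_measure T) f" "A \<in> sets borel"
  shows "integrable (time_measure T) (\<lambda>r. indicat_real A r * f r)"
proof (rule Bochner_Integration.integrable_bound[OF assms(1)])
  show "(\<lambda>r. indicat_real A r * f r) \<in> borel_measurable (time_measure T)"
    by (intro borel_measurable_times lebesgue_on_indicator_measurable assms borel_measurable_integrable)
qed (auto simp: indicator_def)

lemma time_measure_AE_neq: "AE r in time_measure T. r \<noteq> x"
proof -
  have "AE r in lebesgue. r \<noteq> x"
    by (rule AE_completion) (rule AE_lborel_singleton)
  then show ?thesis by (auto simp: AE_restrict_space_iff elim: eventually_mono)
qed

lemma prim_diff:
  assumes "integrable (time_measure T) f" "s \<le> t"
  shows "prim T f t - prim T f s = (\<integral>r. indicat_real {s<..t} r * f r \<partial>time_measure T)"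
proof -
  have "prim T f t - prim T f s =
      (\<integral>r. indicat_real {..t} r * f r - indicat_real {..s} r * f r \<partial>time_measure T)"
    unfolding prim_def using assms
    by (intro Bochner_Integration.integral_diff[symmetric] integrable_indicator_mult) auto
  also have "\<dots> = (\<integral>r. indicat_real {s<..t} r * f r \<partial>time_measure T)"
    using assms(2) by (intro Bochner_Integration.integral_cong) (auto simp: indicator_def)
  finally show ?thesis .
qed

lemma prim_lincomb:
  assumes "integrable (time_measure T) f" "integrable (time_measure T) g"
  shows "prim T (\<lambda>r. a * f r + b * g r) t = a * prim T f t + b * prim T g t"
proof -
  have "prim T (\<lambda>r. a * f r + b * g r) t =
      (\<integral>r. a * (indicat_real {..t} r * f r) + b * (indicat_real {..t} r * g r) \<partial>time_measure T)"
    unfolding prim_def by (intro Bochner_Integration.integral_cong) (auto simp: algebra_simps)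
  also have "\<dots> = a * prim T f t + b * prim T g t"
    unfolding prim_def using assms
    by (subst Bochner_Integration.integral_add) (auto intro!: integrable_indicator_mult)
  finally show ?thesis .
qed

lemma prim_diff_bound:
  assumes "integrable (time_measure T) f" "integrable (time_measure T) g" "s \<le> t"
    and "\<And>r. r \<in> {0<..<T} \<Longrightarrow> \<bar>f r\<bar> \<le> g r"
  shows "\<bar>prim T f t - prim T f s\<bar> \<le> prim T g t - prim T g s"
proof -
  have "\<bar>prim T f t - prim T f s\<bar> \<le> (\<integral>r. \<bar>indicat_real {s<..t} r * f r\<bar> \<partial>time_measure T)"
    unfolding prim_diff[OF assms(1,3)] by (rule integral_abs_bound)
  also have "\<dots> \<le> (\<integral>r. indicat_real {s<..t} r * g r \<partial>time_measure T)"
    using assms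
    by (intro integral_mono integrable_abs integrable_indicator_mult) (auto simp: indicator_def)
  finally show ?thesis unfolding prim_diff[OF assms(2,3)] .
qed

lemma prim_mono:
  assumes "integrable (time_measure T) f" "s \<le> t" "\<And>r. r \<in> {0<..<T} \<Longrightarrow> 0 \<le> f r"
  shows "prim T f s \<le> prim T f t"
  using prim_diff_bound[OF assms(1,1,2)] assms(3) by force

lemma prim_le_0: "t \<le> 0 \<Longrightarrow> prim T f t = 0"
proof -
  assume "t \<le> 0"
  then have "prim T f t = (\<integral>r. 0 \<partial>time_measure T)"
    unfolding prim_def by (intro Bochner_Integration.integral_cong) (auto simp: indicator_def)
  then show ?thesis by simp
qed

lemma prim_ge_T: "T \<le> t \<Longrightarrow> prim T f t = (\<integral>r. f r \<partial>time_measure T)"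
  unfolding prim_def by (intro Bochner_Integration.integral_cong) (auto simp: indicator_def)

lemma prim_nonneg: "(\<And>r. r \<in> {0<..<T} \<Longrightarrow> 0 \<le> f r) \<Longrightarrow> 0 \<le> prim T f t"
  unfolding prim_def by (intro integral_nonneg_AE AE_I2) (auto simp: indicator_def)

lemma prim_le_integral:
  assumes "integrable (time_measure T) f" "\<And>r. r \<in> {0<..<T} \<Longrightarrow> 0 \<le> f r"
  shows "prim T f t \<le> (\<integral>r. f r \<partial>time_measure T)"
  unfolding prim_def using assms
  by (intro integral_mono integrable_indicator_mult) (auto simp: indicator_def)

lemma prim_continuous:
  assumes "integrable (time_measure T) f"
  shows "continuous_on S (prim T f)"
proof -
  have "isCont (prim T f) x" for x
    unfolding continuous_at_sequentially
  proof (intro allI impI, unfold comp_def)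
    fix X :: "nat \<Rightarrow> real" assume X: "X \<longlonglongrightarrow> x"
    show "(\<lambda>n. prim T f (X n)) \<longlonglongrightarrow> prim T f x"
      unfolding prim_def
    proof (rule integral_dominated_convergence)
      show "integrable (time_measure T) (\<lambda>r. \<bar>f r\<bar>)" using assms by (rule integrable_abs)
      show "AE r in time_measure T. (\<lambda>n. indicat_real {..X n} r * f r) \<longlonglongrightarrow> indicat_real {..x} r * f r"
        using time_measure_AE_neq[where T=T and x=x]
      proof eventually_elim
        case (elim r)
        have "\<forall>\<^sub>F n in sequentially. indicat_real {..x} r * f r = indicat_real {..X n} r * f r"
        proof (cases "r < x")
          case True
          show ?thesis
            using order_tendstoD(1)[OF X True] by eventually_elim (use True in \<open>simp add: indicator_def\<close>)
        next
          case False
          with elim have "x < r" by simp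
          show ?thesis
            using order_tendstoD(2)[OF X \<open>x < r\<close>] by eventually_elim (use \<open>x < r\<close> in \<open>simp add: indicator_def\<close>)
        qed
        then show ?case by (rule tendsto_eventually[OF eventually_mono]) auto
      qed
      show "(\<lambda>r. indicat_real {..X n} r * f r) \<in> borel_measurable (time_measure T)" for n
        using integrable_indicator_mult[OF assms, of "{..X n}"] by auto
      show "(\<lambda>r. indicat_real {..x} r * f r) \<in> borel_measurable (time_measure T)"
        using integrable_indicator_mult[OF assms, of "{..x}"] by auto
    qed (auto simp: indicator_def)
  qed
  then show ?thesis by (simp add: continuous_at_imp_continuous_on)
qed

lemma continuous_time_integrable:
  fixes f :: "real \<Rightarrow> real"
  assumes "continuous_on {0..T} f"
  shows "integrable (time_measure T) f"
    and "(\<integral>t. f t \<partial>time_measure T) = integral {0..T} f"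
proof -
  have "f \<in> borel_measurable (time_measure T)"
    by (rule continuous_imp_measurable_on_sets_lebesgue[OF continuous_on_subset[OF assms]]) auto
  moreover obtain B where "\<forall>x\<in>{0..T}. \<bar>f x\<bar> \<le> B"
    using compact_imp_bounded[OF compact_continuous_image[OF assms compact_Icc]] by (auto simp: bounded_iff)
  ultimately show int: "integrable (time_measure T) f"
    by (intro integrable_bounded_time[of f T B]) auto
  show "(\<integral>t. f t \<partial>time_measure T) = integral {0..T} f"
    using lebesgue_integral_eq_integral[OF int] by (simp add: integral_open_interval_real)
qed

lemma prim_has_derivative:
  assumes k: "continuous_on {0..T} k" and t: "t \<in> {0<..<T}"
  shows "(prim T k has_field_derivative k t) (at t)"
proof -
  have eq: "prim T k x = integral {0..x} k" if "x \<in> {0<..<T}" for x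
  proof -
    have "prim T k x = integral {0<..<T} (\<lambda>r. indicat_real {..x} r * k r)"
      unfolding prim_def
      by (intro lebesgue_integral_eq_integral integrable_indicator_mult continuous_time_integrable k) auto
    also have "\<dots> = integral {0<..<T} (\<lambda>r. if r \<in> {..x} then k r else 0)"
      by (intro integral_cong) (auto simp: indicator_def)
    also have "\<dots> = integral ({..x} \<inter> {0<..<T}) k"
      by (rule integral_restrict_Int)
    also have "\<dots> = integral {0..x} k"
    proof (rule integral_spike_set)
      show "negligible {y \<in> {..x} \<inter> {0<..<T} - {0..x}. k y \<noteq> 0}"
        by (rule negligible_subset[of "{}"]) auto
      show "negligible {y \<in> {0..x} - {..x} \<inter> {0<..<T}. k y \<noteq> 0}"
        by (rule negligible_subset[of "{0}"]) (use that in auto)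
    qed
    finally show ?thesis .
  qed
  have "((\<lambda>x. integral {0..x} k) has_field_derivative k t) (at t within {0..T})"
    by (rule integral_has_real_derivative[OF k]) (use t in auto)
  then have "((\<lambda>x. integral {0..x} k) has_field_derivative k t) (at t)"
    using t by (simp add: at_within_Icc_at)
  then show ?thesis
    by (rule DERIV_cong_ev[THEN iffD1, rotated -1])
       (use eventually_nhds_in_open[of "{0<..<T}" t] t eq in \<open>auto elim!: eventually_mono\<close>)
qed

lemma monotone_shift_integral_le:
  fixes P :: "real \<Rightarrow> real"
  assumes P: "continuous_on UNIV P" "\<And>x. 0 \<le> P x" "\<And>x. P x \<le> C" and "h > 0" "T > 0"
  shows "(\<integral>t. (P (t + h) - P t) / h \<partial>time_measure T) \<le> C"
proof -
  have c: "continuous_on S P" for S using P(1) continuous_on_subset by blast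
  then have i: "P integrable_on {a..b}" for a b by (rule integrable_continuous_real)
  have cs: "continuous_on {0..T} (\<lambda>t. P (t + h))"
    by (intro continuous_on_compose2[OF P(1)] continuous_intros) auto
  have "(\<integral>t. (P (t + h) - P t) / h \<partial>time_measure T) = (integral {0..T} (\<lambda>t. P (t + h)) - integral {0..T} P) / h"
    using continuous_time_integrable[OF cs] continuous_time_integrable[OF c] by simp
  also have "integral {0..T} (\<lambda>t. P (t + h)) = integral {h..T + h} P"
    using integral_shift_Icc_real[of 0 T P h] by (simp add: comp_def add.commute)
  also have "integral {h..T + h} P - integral {0..T} P = integral {T..T + h} P - integral {0..h} P"
    using Henstock_Kurzweil_Integration.integral_combine[of 0 h "T + h" P]
      Henstock_Kurzweil_Integration.integral_combine[of 0 T "T + h" P] i assms by simp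
  also have "\<dots> \<le> h * C"
  proof -
    have "integral {T..T + h} P \<le> integral {T..T + h} (\<lambda>x. C)"
      by (intro integral_le i) (use P in auto)
    moreover have "0 \<le> integral {0..h} P"
      by (intro Henstock_Kurzweil_Integration.integral_nonneg i) (use P in auto)
    ultimately show ?thesis using \<open>h > 0\<close> by simp
  qed
  finally show ?thesis using \<open>h > 0\<close> by (simp add: divide_right_mono field_simps)
qed

text \<open>
  Integrating the difference quotient of a monotone function telescopes to the difference of its
  averages over two intervals of length \<open>\<bar>h\<bar>\<close>.  Applied to the primitive of \<open>f \<ge> 0\<close>, this bounds the
  Steklov averages of \<open>f\<close> in \<open>L\<^sub>1\<close>.
\<close>

lemma prim_diffquot_integral_le:
  assumes f: "integrable (time_measure T) f" "\<And>r. r \<in> {0<..<T} \<Longrightarrow> 0 \<le> f r" and "h \<noteq> 0" "T > 0"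
  shows "(\<integral>t. (prim T f (t + h) - prim T f t) / h \<partial>time_measure T) \<le> (\<integral>t. f t \<partial>time_measure T)"
proof (cases "h > 0")
  case True
  then show ?thesis
    using assms
    by (intro monotone_shift_integral_le prim_continuous prim_nonneg prim_le_integral)
next
  case False
  have "(\<integral>t. (prim T f (t + h) - prim T f t) / h \<partial>time_measure T) =
      (\<integral>t. (prim T f (t + - h + h) - prim T f (t + h)) / (- h) \<partial>time_measure T)"
    by (intro Bochner_Integration.integral_cong) (auto simp: divide_simps)
  also have "\<dots> \<le> (\<integral>t. f t \<partial>time_measure T)"
    using assms False
    by (intro monotone_shift_integral_le[where P="\<lambda>t. prim T f (t + h)"] prim_nonneg prim_le_integral
        continuous_on_compose2[OF prim_continuous[OF f(1), of UNIV]] continuous_intros) auto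
  finally show ?thesis .
qed

text \<open>
  A measurable function is almost everywhere a limit of continuous ones; truncation provides a
  dominating constant.
\<close>

lemma continuous_dense_L1:
  fixes f :: "real \<Rightarrow> real"
  assumes f: "integrable (time_measure T) f" and "e > 0"
  obtains k where "continuous_on UNIV k" "(\<integral>t. \<bar>f t - k t\<bar> \<partial>time_measure T) < e"
proof -
  let ?M = "time_measure T"
  define c where "c m y = max (- real m) (min y (real m))" for m :: nat and y
  have cc: "isCont (c m) y" for m y
    unfolding c_def by (intro continuous_intros)
  have cb: "\<bar>c m y\<bar> \<le> real m" for m y unfolding c_def by auto
  have fm[measurable]: "f \<in> borel_measurable ?M" using f by auto
  have cfm[measurable]: "(\<lambda>t. c m (f t)) \<in> borel_measurable ?M" for m
    unfolding c_def by measurable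
  have cint: "integrable ?M (\<lambda>t. c m (f t))" for m
    by (rule integrable_bounded_time[OF cfm, of _ "real m"]) (use cb in auto)
  have "(\<lambda>m. \<integral>t. \<bar>f t - c m (f t)\<bar> \<partial>?M) \<longlonglongrightarrow> (\<integral>t. 0 \<partial>?M)"
  proof (rule integral_dominated_convergence)
    show "integrable ?M (\<lambda>t. \<bar>f t\<bar>)" using f by (rule integrable_abs)
    show "AE t in ?M. (\<lambda>m. \<bar>f t - c m (f t)\<bar>) \<longlonglongrightarrow> 0"
    proof (intro AE_I2 tendsto_eventually)
      fix t
      obtain n :: nat where "\<bar>f t\<bar> \<le> real n" using real_arch_simple by blast
      then show "\<forall>\<^sub>F m in sequentially. \<bar>f t - c m (f t)\<bar> = 0"
        by (intro eventually_sequentiallyI[of n]) (auto simp: c_def)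
    qed
    show "AE t in ?M. norm \<bar>f t - c m (f t)\<bar> \<le> \<bar>f t\<bar>" for m
      by (intro AE_I2) (auto simp: c_def)
  qed measurable
  then have "eventually (\<lambda>m. (\<integral>t. \<bar>f t - c m (f t)\<bar> \<partial>?M) < e / 2) sequentially"
    using order_tendstoD(2)[of _ 0 sequentially "e / 2"] \<open>e > 0\<close> by simp
  then obtain m where m: "(\<integral>t. \<bar>f t - c m (f t)\<bar> \<partial>?M) < e / 2"
    by (auto simp: eventually_sequentially)
  have "f measurable_on {0<..<T}"
    by (subst measurable_on_iff_borel_measurable) auto
  then obtain N g where N: "negligible N" and g: "\<And>n. continuous_on UNIV (g n)"
    and lim: "\<And>x. x \<notin> N \<Longrightarrow> (\<lambda>n. g n x) \<longlonglongrightarrow> (if x \<in> {0<..<T} then f x else 0)"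
    unfolding measurable_on_def by blast
  have gc: "continuous_on UNIV (\<lambda>t. c m (g n t))" for n
    using continuous_on_compose2[OF continuous_at_imp_continuous_on[of UNIV "c m"] g] cc by auto
  have gm[measurable]: "(\<lambda>t. c m (g n t)) \<in> borel_measurable ?M" for n
    by (rule continuous_imp_measurable_on_sets_lebesgue[OF continuous_on_subset[OF gc]]) auto
  have gint: "integrable ?M (\<lambda>t. c m (g n t))" for n
    by (rule integrable_bounded_time[OF gm, of _ "real m"]) (use cb in auto)
  have "AE t in lebesgue. t \<notin> N"
    using N by (intro AE_not_in) (simp add: negligible_iff_null_sets)
  then have ae: "AE t in ?M. t \<notin> N" by (auto simp: AE_restrict_space_iff elim: eventually_mono)
  have "(\<lambda>n. \<integral>t. \<bar>c m (f t) - c m (g n t)\<bar> \<partial>?M) \<longlonglongrightarrow> (\<integral>t. 0 \<partial>?M)"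
  proof (rule integral_dominated_convergence)
    show "integrable ?M (\<lambda>t. 2 * real m)" by (intro integrable_bounded_time) auto
    show "AE t in ?M. (\<lambda>n. \<bar>c m (f t) - c m (g n t)\<bar>) \<longlonglongrightarrow> 0"
      using ae AE_space
    proof eventually_elim
      case (elim t)
      then have "(\<lambda>n. g n t) \<longlonglongrightarrow> f t" using lim[of t] by simp
      then have "(\<lambda>n. \<bar>c m (f t) - c m (g n t)\<bar>) \<longlonglongrightarrow> \<bar>c m (f t) - c m (f t)\<bar>"
        by (intro tendsto_intros isCont_tendsto_compose[OF cc])
      then show ?case by simp
    qed
    show "AE t in ?M. norm \<bar>c m (f t) - c m (g n t)\<bar> \<le> 2 * real m" for n
    proof (intro AE_I2)
      show "norm \<bar>c m (f t) - c m (g n t)\<bar> \<le> 2 * real m" for t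
        using cb[of m "f t"] cb[of m "g n t"] by simp
    qed
  qed measurable
  then have "eventually (\<lambda>n. (\<integral>t. \<bar>c m (f t) - c m (g n t)\<bar> \<partial>?M) < e / 2) sequentially"
    using order_tendstoD(2)[of _ 0 sequentially "e / 2"] \<open>e > 0\<close> by simp
  then obtain n where n: "(\<integral>t. \<bar>c m (f t) - c m (g n t)\<bar> \<partial>?M) < e / 2"
    by (auto simp: eventually_sequentially)
  have "(\<integral>t. \<bar>f t - c m (g n t)\<bar> \<partial>?M) \<le> (\<integral>t. \<bar>f t - c m (f t)\<bar> + \<bar>c m (f t) - c m (g n t)\<bar> \<partial>?M)"
    using f cint gint by (intro integral_mono) auto
  also have "\<dots> = (\<integral>t. \<bar>f t - c m (f t)\<bar> \<partial>?M) + (\<integral>t. \<bar>c m (f t) - c m (g n t)\<bar> \<partial>?M)"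
    using f cint gint by (intro Bochner_Integration.integral_add) auto
  finally have "(\<integral>t. \<bar>f t - c m (g n t)\<bar> \<partial>?M) < e" using m n by simp
  with gc show ?thesis by (rule that)
qed

lemma prim_shift_integrable:
  assumes "integrable (time_measure T) f"
  shows "integrable (time_measure T) (\<lambda>t. (prim T f (t + h) - prim T f t) / h)"
proof (rule continuous_time_integrable)
  have "continuous_on {0..T} (\<lambda>t. prim T f (t + h))"
    by (intro continuous_on_compose2[OF prim_continuous[OF assms, of UNIV]] continuous_intros) auto
  then have "continuous_on {0..T} (\<lambda>t. inverse h * (prim T f (t + h) - prim T f t))"
    by (intro continuous_intros prim_continuous assms)
  then show "continuous_on {0..T} (\<lambda>t. (prim T f (t + h) - prim T f t) / h)"
    by (simp add: field_simps)
qed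

lemma prim_diffquot_abs_bound:
  assumes "integrable (time_measure T) f" "integrable (time_measure T) g"
    and "\<And>r. r \<in> {0<..<T} \<Longrightarrow> \<bar>f r\<bar> \<le> g r"
  shows "\<bar>(prim T f (t + h) - prim T f t) / h\<bar> \<le> (prim T g (t + h) - prim T g t) / h"
proof (cases h "0::real" rule: linorder_cases)
  case less
  have "\<bar>prim T f t - prim T f (t + h)\<bar> \<le> prim T g t - prim T g (t + h)"
    by (rule prim_diff_bound) (use less assms in auto)
  then have "\<bar>prim T f (t + h) - prim T f t\<bar> / \<bar>h\<bar> \<le> (prim T g t - prim T g (t + h)) / \<bar>h\<bar>"
    by (intro divide_right_mono) (auto simp: abs_minus_commute)
  then show ?thesis
    using less minus_divide_divide[of "prim T g (t + h) - prim T g t" h] by (simp add: abs_divide)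
next
  case greater
  have "\<bar>prim T f (t + h) - prim T f t\<bar> \<le> prim T g (t + h) - prim T g t"
    by (rule prim_diff_bound) (use greater assms in auto)
  then show ?thesis using greater by (simp add: abs_divide divide_right_mono)
qed simp

lemma prim_const_lipschitz:
  assumes "s \<le> t" "0 \<le> B"
  shows "prim T (\<lambda>r. B) t - prim T (\<lambda>r. B) s \<le> B * (t - s)"
proof -
  have int: "integrable (time_measure T) (\<lambda>r. B)" by (intro integrable_bounded_time) auto
  have "prim T (\<lambda>r. B) t - prim T (\<lambda>r. B) s = (\<integral>r. indicat_real {s<..t} r * B \<partial>time_measure T)"
    by (rule prim_diff[OF int assms(1)])
  also have "\<dots> = (\<integral>r. indicat_real {0<..<T} r * (indicat_real {s<..t} r * B) \<partial>lebesgue)"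
    by (subst integral_restrict_space) auto
  also have "\<dots> \<le> (\<integral>r. indicat_real {s<..t} r * B \<partial>lebesgue)"
  proof (rule integral_mono')
    show "integrable lebesgue (\<lambda>r. indicat_real {s<..t} r * B)"
      using assms by (intro integrable_mult_left integrable_real_indicator) auto
  qed (use assms in \<open>auto simp: indicator_def\<close>)
  also have "\<dots> = B * (t - s)"
    using assms by simp
  finally show ?thesis .
qed

lemma prim_const_diffquot_le:
  assumes "0 \<le> B" shows "(prim T (\<lambda>r. B) (t + h) - prim T (\<lambda>r. B) t) / h \<le> B"
proof (cases h "0::real" rule: linorder_cases)
  case less
  then show ?thesis
    using prim_const_lipschitz[of "t + h" t B T] assms by (simp add: field_simps)
next
  case greater
  then show ?thesis
    using prim_const_lipschitz[of t "t + h" B T] assms by (simp add: field_simps)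
qed (use assms in simp)

text \<open>
  The Lebesgue differentiation theorem in the mean.  For continuous functions it is the fundamental
  theorem of calculus, and difference quotients are bounded on \<open>L\<^sub>1\<close> uniformly in \<open>h\<close>.
\<close>

lemma prim_diffquot_L1:
  assumes f: "integrable (time_measure T) f" and T: "T > 0"
  shows "((\<lambda>h. \<integral>t. \<bar>(prim T f (t + h) - prim T f t) / h - f t\<bar> \<partial>time_measure T) \<longlongrightarrow> 0) (at 0)"
proof (rule LIM_I)
  let ?M = "time_measure T"
  let ?D = "\<lambda>f h t. (prim T f (t + h) - prim T f t) / h"
  fix e :: real assume "e > 0"
  obtain k where k: "continuous_on UNIV k" and fk: "(\<integral>t. \<bar>f t - k t\<bar> \<partial>?M) < e / 3"
    using continuous_dense_L1[OF f, of "e / 3"] \<open>e > 0\<close> by auto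
  have k': "continuous_on {0..T} k" using k continuous_on_subset by blast
  have kint: "integrable ?M k" by (rule continuous_time_integrable[OF k'])
  obtain B where B: "\<forall>x\<in>{0..T}. \<bar>k x\<bar> \<le> B"
    using compact_imp_bounded[OF compact_continuous_image[OF k' compact_Icc]] by (auto simp: bounded_iff)
  have B0: "0 \<le> B" using B T by (auto dest!: bspec[of _ _ 0])
  have Bint: "integrable ?M (\<lambda>t. B)" by (intro integrable_bounded_time) auto
  have Dk: "\<bar>?D k h t\<bar> \<le> B" for h t
  proof -
    have "\<bar>?D k h t\<bar> \<le> (prim T (\<lambda>r. B) (t + h) - prim T (\<lambda>r. B) t) / h"
      by (intro prim_diffquot_abs_bound kint Bint) (use B in auto)
    also have "\<dots> \<le> B" by (rule prim_const_diffquot_le[OF B0])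
    finally show ?thesis .
  qed
  have "((\<lambda>h. \<integral>t. \<bar>?D k h t - k t\<bar> \<partial>?M) \<longlongrightarrow> (\<integral>t. 0 \<partial>?M)) (at 0)"
    unfolding tendsto_at_iff_sequentially
  proof (intro allI impI, unfold comp_def)
    fix X :: "nat \<Rightarrow> real" assume X: "\<forall>n. X n \<in> UNIV - {0}" "X \<longlonglongrightarrow> 0"
    show "(\<lambda>n. \<integral>t. \<bar>?D k (X n) t - k t\<bar> \<partial>?M) \<longlonglongrightarrow> (\<integral>t. 0 \<partial>?M)"
    proof (rule integral_dominated_convergence)
      show "integrable ?M (\<lambda>t. 2 * B)" by (intro integrable_bounded_time) auto
      show "(\<lambda>t. \<bar>?D k (X n) t - k t\<bar>) \<in> borel_measurable ?M" for n
        using prim_shift_integrable[OF kint, of "X n"] kint by auto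
      show "AE t in ?M. (\<lambda>n. \<bar>?D k (X n) t - k t\<bar>) \<longlonglongrightarrow> 0"
      proof (intro AE_I2)
        fix t assume "t \<in> space ?M"
        then have "((\<lambda>h. ?D k h t) \<longlongrightarrow> k t) (at 0)"
          using prim_has_derivative[OF k', of t] by (simp add: DERIV_def)
        then have "(\<lambda>n. ?D k (X n) t) \<longlonglongrightarrow> k t"
          using X unfolding tendsto_at_iff_sequentially comp_def by blast
        then show "(\<lambda>n. \<bar>?D k (X n) t - k t\<bar>) \<longlonglongrightarrow> 0"
          by (simp add: tendsto_rabs_zero_iff LIM_zero_iff)
      qed
      show "AE t in ?M. norm \<bar>?D k (X n) t - k t\<bar> \<le> 2 * B" for n
      proof (intro AE_I2)
        fix t assume "t \<in> space ?M"
        then have "\<bar>k t\<bar> \<le> B" using B by simp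
        then show "norm \<bar>?D k (X n) t - k t\<bar> \<le> 2 * B" unfolding real_norm_def abs_abs using Dk[where h="X n" and t=t] by linarith
      qed
    qed simp
  qed
  then have "((\<lambda>h. \<integral>t. \<bar>?D k h t - k t\<bar> \<partial>?M) \<longlongrightarrow> 0) (at 0)" by simp
  from LIM_D[OF this, of "e / 3"] obtain d where "d > 0" and
    d: "\<forall>h. h \<noteq> 0 \<and> norm (h - 0) < d \<longrightarrow> norm ((\<integral>t. \<bar>?D k h t - k t\<bar> \<partial>?M) - 0) < e / 3"
    using \<open>e > 0\<close> by auto
  show "\<exists>d>0. \<forall>h. h \<noteq> 0 \<and> norm (h - 0) < d \<longrightarrow> norm ((\<integral>t. \<bar>?D f h t - f t\<bar> \<partial>?M) - 0) < e"
  proof (intro exI conjI allI impI)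
    fix h :: real assume h: "h \<noteq> 0 \<and> norm (h - 0) < d"
    have fkint: "integrable ?M (\<lambda>t. \<bar>f t - k t\<bar>)" "integrable ?M (\<lambda>t. f t - k t)" using f kint by auto
    let ?E = "\<lambda>r. \<bar>f r - k r\<bar>"
    have split: "?D f h t - ?D k h t = ?D (\<lambda>r. f r - k r) h t" for t
    proof -
      have p: "prim T (\<lambda>r. f r - k r) x = prim T f x - prim T k x" for x
        using prim_lincomb[OF f kint, of 1 "-1" x] by simp
      show ?thesis unfolding p by (simp add: diff_divide_distrib)
    qed
    have le: "\<bar>?D f h t - f t\<bar> \<le> ?D ?E h t + \<bar>?D k h t - k t\<bar> + ?E t" for t
    proof -
      have "\<bar>?D f h t - ?D k h t\<bar> \<le> ?D ?E h t"
        unfolding split by (intro prim_diffquot_abs_bound fkint) auto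
      then show ?thesis by linarith
    qed
    have "(\<integral>t. \<bar>?D f h t - f t\<bar> \<partial>?M) \<le> (\<integral>t. ?D ?E h t + \<bar>?D k h t - k t\<bar> + ?E t \<partial>?M)"
      by (intro integral_mono le Bochner_Integration.integrable_add integrable_abs Bochner_Integration.integrable_diff prim_shift_integrable f kint)
    also have "\<dots> = (\<integral>t. ?D ?E h t \<partial>?M) + (\<integral>t. \<bar>?D k h t - k t\<bar> \<partial>?M) + (\<integral>t. ?E t \<partial>?M)"
      by (simp add: Bochner_Integration.integral_add Bochner_Integration.integrable_add
          integrable_abs Bochner_Integration.integrable_diff prim_shift_integrable f kint)
    also have "\<dots> < e / 3 + e / 3 + e / 3"
    proof -
      have "(\<integral>t. ?D ?E h t \<partial>?M) \<le> (\<integral>t. ?E t \<partial>?M)"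
        by (rule prim_diffquot_integral_le) (use fkint h T in auto)
      moreover have "(\<integral>t. \<bar>?D k h t - k t\<bar> \<partial>?M) < e / 3"
        using d[rule_format, OF h] unfolding real_norm_def by linarith
      ultimately show ?thesis using fk by linarith
    qed
    finally show "norm ((\<integral>t. \<bar>?D f h t - f t\<bar> \<partial>?M) - 0) < e"
      by (simp add: abs_of_nonneg)
  qed (rule \<open>d > 0\<close>)
qed

lemma bounded_mult_integrable:
  fixes f \<psi> :: "real \<Rightarrow> real"
  assumes psi: "\<psi> \<in> borel_measurable (time_measure T)" "\<And>t. \<bar>\<psi> t\<bar> \<le> B"
    and f: "integrable (time_measure T) f"
  shows "integrable (time_measure T) (\<lambda>t. \<psi> t * f t)"
proof (rule Bochner_Integration.integrable_bound)
  show "integrable (time_measure T) (\<lambda>t. B * \<bar>f t\<bar>)" using f by auto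
  show "(\<lambda>t. \<psi> t * f t) \<in> borel_measurable (time_measure T)" using psi(1) f by auto
  show "AE t in time_measure T. norm (\<psi> t * f t) \<le> norm (B * \<bar>f t\<bar>)"
  proof (intro AE_I2)
    fix t
    have "\<bar>\<psi> t\<bar> * \<bar>f t\<bar> \<le> \<bar>B\<bar> * \<bar>f t\<bar>" using psi(2)[of t] by (intro mult_right_mono) auto
    then show "norm (\<psi> t * f t) \<le> norm (B * \<bar>f t\<bar>)" by (simp add: abs_mult)
  qed
qed

lemma prim_diffquot_weak:
  assumes f: "integrable (time_measure T) f" and T: "T > 0"
    and psi: "\<psi> \<in> borel_measurable (time_measure T)" "\<And>t. \<bar>\<psi> t\<bar> \<le> B"
  shows "((\<lambda>h. \<integral>t. \<psi> t * ((prim T f (t + h) - prim T f t) / h) \<partial>time_measure T)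
      \<longlongrightarrow> (\<integral>t. \<psi> t * f t \<partial>time_measure T)) (at 0)"
proof (rule LIM_zero_cancel, rule tendsto_rabs_zero_cancel, rule tendsto_sandwich[OF _ _ tendsto_const])
  let ?M = "time_measure T"
  let ?D = "\<lambda>h t. (prim T f (t + h) - prim T f t) / h"
  note mult = bounded_mult_integrable[OF psi]
  have "\<bar>(\<integral>t. \<psi> t * ?D h t \<partial>?M) - (\<integral>t. \<psi> t * f t \<partial>?M)\<bar> \<le> B * (\<integral>t. \<bar>?D h t - f t\<bar> \<partial>?M)" for h
  proof -
    note D = prim_shift_integrable[OF f, of h]
    have "\<bar>(\<integral>t. \<psi> t * ?D h t \<partial>?M) - (\<integral>t. \<psi> t * f t \<partial>?M)\<bar> = \<bar>\<integral>t. \<psi> t * ?D h t - \<psi> t * f t \<partial>?M\<bar>"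
      by (simp only: Bochner_Integration.integral_diff[OF mult[OF D] mult[OF f]])
    also have "\<dots> \<le> (\<integral>t. \<bar>\<psi> t * ?D h t - \<psi> t * f t\<bar> \<partial>?M)"
      by (rule integral_abs_bound)
    also have "\<dots> \<le> (\<integral>t. B * \<bar>?D h t - f t\<bar> \<partial>?M)"
    proof (rule integral_mono)
      show "integrable ?M (\<lambda>t. \<bar>\<psi> t * ?D h t - \<psi> t * f t\<bar>)"
        by (intro integrable_abs Bochner_Integration.integrable_diff mult D f)
      show "integrable ?M (\<lambda>t. B * \<bar>?D h t - f t\<bar>)"
        by (intro integrable_mult_right integrable_abs Bochner_Integration.integrable_diff D f)
      fix t
      have "\<bar>\<psi> t\<bar> * \<bar>?D h t - f t\<bar> \<le> B * \<bar>?D h t - f t\<bar>"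
        using psi(2) by (intro mult_right_mono) auto
      then show "\<bar>\<psi> t * ?D h t - \<psi> t * f t\<bar> \<le> B * \<bar>?D h t - f t\<bar>"
        by (simp only: right_diff_distrib[symmetric] abs_mult)
    qed
    finally show ?thesis by simp
  qed
  then show "\<forall>\<^sub>F h in at 0. \<bar>(\<integral>t. \<psi> t * ?D h t \<partial>?M) - (\<integral>t. \<psi> t * f t \<partial>?M)\<bar> \<le> B * (\<integral>t. \<bar>?D h t - f t\<bar> \<partial>?M)"
    by (intro always_eventually) auto
  show "((\<lambda>h. B * (\<integral>t. \<bar>?D h t - f t\<bar> \<partial>?M)) \<longlongrightarrow> 0) (at 0)"
    by (intro tendsto_mult_right_zero prim_diffquot_L1 f T)
qed (auto intro!: always_eventually)

definition zero_ext :: "real \<Rightarrow> (real \<Rightarrow> real) \<Rightarrow> real \<Rightarrow> real" where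
  "zero_ext T q t = (if t \<in> {0<..<T} then q t else 0)"

lemma zero_ext_integrable:
  assumes "integrable (time_measure T) q"
  shows "integrable lebesgue (\<lambda>t. zero_ext T q (t + h))"
proof -
  have "zero_ext T q = (\<lambda>t. indicator {0<..<T} t *\<^sub>R q t)" by (auto simp: zero_ext_def)
  then have "integrable lebesgue (zero_ext T q)"
    using assms by (simp add: integrable_restrict_space)
  from lebesgue_integrable_real_affine[OF this, of 1 h] show ?thesis
    by (simp add: add.commute)
qed

text \<open>
  The difference quotient is moved onto the test function, where it converges uniformly.
\<close>

lemma test_function_diffquot:
  assumes T: "T > 0" and psi: "is_test_function T \<psi>" and q: "integrable (time_measure T) q"
  shows "((\<lambda>h. \<integral>t. \<psi> t * ((zero_ext T q (t + h) - zero_ext T q t) / h) \<partial>time_measure T)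
      \<longlongrightarrow> - (\<integral>t. deriv \<psi> t * q t \<partial>time_measure T)) (at 0)"
proof -
  let ?M = "time_measure T"
  obtain a b where ab: "0 < a" "a < b" "b < T" "\<And>x. x \<notin> {a..b} \<Longrightarrow> \<psi> x = 0"
    by (rule test_function_support[OF psi T]) (rule that)
  obtain B where B: "\<And>x. \<bar>\<psi> x\<bar> \<le> B" by (rule test_function_bounded[OF psi T]) (rule that)
  obtain B' where B': "\<And>x. \<bar>deriv \<psi> x\<bar> \<le> B'"
    by (rule test_function_bounded[OF test_function_deriv[OF psi T] T]) (rule that)
  note sm = test_function_smooth[OF psi]
  have meas: "(\<lambda>t. \<psi> (t + c)) \<in> borel_measurable lebesgue" for c
  proof -
    have "continuous_on UNIV (\<lambda>t. \<psi> (t + c))"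
      by (rule continuous_on_compose2[OF smooth_continuous[OF sm, of UNIV]]) (auto intro!: continuous_intros)
    then have "(\<lambda>t. \<psi> (t + c)) \<in> borel_measurable lborel"
      using borel_measurable_continuous_onI by simp
    then show ?thesis by (rule measurable_completion)
  qed
  have q0eq: "zero_ext T q t = indicator {0<..<T} t *\<^sub>R q t" for t by (simp add: zero_ext_def)
  have q0: "integrable lebesgue (zero_ext T q)" using zero_ext_integrable[OF q, of 0] by simp
  have mult: "integrable lebesgue (\<lambda>t. \<psi> (t + c) * g t)" if g: "integrable lebesgue g" for g c
  proof (rule Bochner_Integration.integrable_bound)
    show "integrable lebesgue (\<lambda>t. B * \<bar>g t\<bar>)" using g by auto
    show "(\<lambda>t. \<psi> (t + c) * g t) \<in> borel_measurable lebesgue" using meas g by auto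
    show "AE t in lebesgue. norm (\<psi> (t + c) * g t) \<le> norm (B * \<bar>g t\<bar>)"
    proof (intro AE_I2)
      fix t
      have "\<bar>\<psi> (t + c)\<bar> * \<bar>g t\<bar> \<le> \<bar>B\<bar> * \<bar>g t\<bar>" using B[of "t + c"] by (intro mult_right_mono) auto
      then show "norm (\<psi> (t + c) * g t) \<le> norm (B * \<bar>g t\<bar>)" by (simp add: abs_mult)
    qed
  qed
  have shift: "(\<integral>t. \<psi> t * ((zero_ext T q (t + h) - zero_ext T q t) / h) \<partial>?M)
      = (\<integral>t. ((\<psi> (t - h) - \<psi> t) / h) * q t \<partial>?M)" for h
  proof -
    note q0h = zero_ext_integrable[OF q, of h]
    have "(\<integral>t. \<psi> t * ((zero_ext T q (t + h) - zero_ext T q t) / h) \<partial>?M)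
        = (\<integral>t. (\<psi> t * zero_ext T q (t + h) - \<psi> t * zero_ext T q t) / h \<partial>lebesgue)"
      unfolding integral_restrict_space[OF time_interval_sets]
      by (intro Bochner_Integration.integral_cong) (use ab in \<open>auto simp: indicator_def algebra_simps diff_divide_distrib\<close>)
    also have "\<dots> = ((\<integral>t. \<psi> t * zero_ext T q (t + h) \<partial>lebesgue) - (\<integral>t. \<psi> t * zero_ext T q t \<partial>lebesgue)) / h"
      using mult[OF q0h, of 0] mult[OF q0, of 0] by simp
    also have "(\<integral>t. \<psi> t * zero_ext T q (t + h) \<partial>lebesgue) = (\<integral>t. \<psi> (t - h) * zero_ext T q t \<partial>lebesgue)"
      by (subst lebesgue_integral_real_affine[of 1 _ "- h"]) auto
    also have "((\<integral>t. \<psi> (t - h) * zero_ext T q t \<partial>lebesgue) - (\<integral>t. \<psi> t * zero_ext T q t \<partial>lebesgue)) / h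
        = (\<integral>t. (\<psi> (t - h) * zero_ext T q t - \<psi> t * zero_ext T q t) / h \<partial>lebesgue)"
      using mult[OF q0, of "- h"] mult[OF q0, of 0] by simp
    also have "\<dots> = (\<integral>t. ((\<psi> (t - h) - \<psi> t) / h) * q t \<partial>?M)"
      unfolding integral_restrict_space[OF time_interval_sets] q0eq
      by (intro Bochner_Integration.integral_cong) (auto simp: algebra_simps diff_divide_distrib)
    finally show ?thesis .
  qed
  have lip: "\<bar>\<psi> (t - h) - \<psi> t\<bar> \<le> B' * \<bar>h\<bar>" for t h
  proof -
    have "norm (\<psi> (t - h) - \<psi> t) \<le> B' * norm ((t - h) - t)"
      by (rule field_differentiable_bound[of UNIV \<psi> "deriv \<psi>"])
         (use smooth_has_derivative[OF sm] B' in auto)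
    then show ?thesis by simp
  qed
  show ?thesis
    unfolding tendsto_at_iff_sequentially
  proof (intro allI impI, unfold comp_def shift)
    fix X :: "nat \<Rightarrow> real" assume X: "\<forall>n. X n \<in> UNIV - {0}" "X \<longlonglongrightarrow> 0"
    have "(\<lambda>n. \<integral>t. ((\<psi> (t - X n) - \<psi> t) / X n) * q t \<partial>?M) \<longlonglongrightarrow> (\<integral>t. - (deriv \<psi> t * q t) \<partial>?M)"
    proof (rule integral_dominated_convergence)
      have c: "continuous_on {0<..<T} (\<lambda>t. inverse (X n) * (\<psi> (t - X n) - \<psi> t))" for n
        by (intro continuous_intros smooth_continuous[OF sm]
            continuous_on_compose2[OF smooth_continuous[OF sm, of UNIV]]) auto
      have m: "(\<lambda>t. inverse (X n) * (\<psi> (t - X n) - \<psi> t)) \<in> borel_measurable ?M" for n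
        by (rule continuous_imp_measurable_on_sets_lebesgue[OF c]) simp
      show "(\<lambda>t. ((\<psi> (t - X n) - \<psi> t) / X n) * q t) \<in> borel_measurable ?M" for n
        using borel_measurable_times[OF m[of n] borel_measurable_integrable[OF q]]
        by (simp add: field_simps)
      have "deriv \<psi> \<in> borel_measurable ?M"
        by (rule continuous_imp_measurable_on_sets_lebesgue[OF smooth_continuous[OF smooth_deriv[OF sm]]]) simp
      then show "(\<lambda>t. - (deriv \<psi> t * q t)) \<in> borel_measurable ?M"
        using borel_measurable_integrable[OF q] by measurable
      show "integrable ?M (\<lambda>t. B' * \<bar>q t\<bar>)" using q by auto
      show "AE t in ?M. (\<lambda>n. ((\<psi> (t - X n) - \<psi> t) / X n) * q t) \<longlonglongrightarrow> - (deriv \<psi> t * q t)"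
      proof (intro AE_I2)
        fix t
        have lim: "((\<lambda>h. (\<psi> (t + h) - \<psi> t) / h) \<longlongrightarrow> deriv \<psi> t) (at 0)"
          using smooth_has_derivative[OF sm, of t] by (simp add: DERIV_def)
        have "(\<lambda>n. - X n) \<longlonglongrightarrow> 0" using tendsto_minus[OF X(2)] by simp
        then have "filterlim (\<lambda>n. - X n) (at 0) sequentially"
          using X(1) by (intro filterlim_atI) auto
        then have "(\<lambda>n. (\<psi> (t + - X n) - \<psi> t) / (- X n)) \<longlonglongrightarrow> deriv \<psi> t"
          by (rule filterlim_compose[OF lim])
        then have "(\<lambda>n. - ((\<psi> (t + - X n) - \<psi> t) / (- X n)) * q t) \<longlonglongrightarrow> - deriv \<psi> t * q t"
          by (intro tendsto_intros)
        then show "(\<lambda>n. ((\<psi> (t - X n) - \<psi> t) / X n) * q t) \<longlonglongrightarrow> - (deriv \<psi> t * q t)"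
          by simp
      qed
      show "AE t in ?M. norm (((\<psi> (t - X n) - \<psi> t) / X n) * q t) \<le> B' * \<bar>q t\<bar>" for n
      proof (intro AE_I2)
        fix t
        have "\<bar>(\<psi> (t - X n) - \<psi> t) / X n\<bar> \<le> B'"
          using lip[of t "X n"] X(1) by (simp add: abs_divide divide_le_eq)
        then have "\<bar>(\<psi> (t - X n) - \<psi> t) / X n\<bar> * \<bar>q t\<bar> \<le> B' * \<bar>q t\<bar>"
          by (rule mult_right_mono) simp
        then show "norm (((\<psi> (t - X n) - \<psi> t) / X n) * q t) \<le> B' * \<bar>q t\<bar>"
          unfolding real_norm_def abs_mult .
      qed
    qed
    then show "(\<lambda>n. \<integral>t. ((\<psi> (t - X n) - \<psi> t) / X n) * q t \<partial>?M) \<longlonglongrightarrow> - (\<integral>t. deriv \<psi> t * q t \<partial>?M)"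
      by simp
  qed
qed

section \<open>The lemma of du Bois-Reymond\<close>

lemma test_function_measurable:
  "is_test_function T \<phi> \<Longrightarrow> \<phi> \<in> borel_measurable (time_measure T)"
  by (rule continuous_imp_measurable_on_sets_lebesgue[OF smooth_continuous[OF test_function_smooth]]) auto

lemma test_function_mult_integrable:
  assumes "is_test_function T \<phi>" "T > 0" "integrable (time_measure T) f"
  shows "integrable (time_measure T) (\<lambda>t. \<phi> t * f t)"
proof -
  obtain B where "\<And>x. \<bar>\<phi> x\<bar> \<le> B" by (rule test_function_bounded[OF assms(1,2)]) (rule that)
  then show ?thesis
    by (intro bounded_mult_integrable[OF test_function_measurable[OF assms(1)] _ assms(3)])
qed

text \<open>
  The integrals of \<open>\<phi>\<close> against the difference quotients of the primitive converge to either side, up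
  to the sign.
\<close>

lemma prim_integration_by_parts:
  assumes T: "T > 0" and phi: "is_test_function T \<phi>" and g: "integrable (time_measure T) g"
  shows "(\<integral>t. deriv \<phi> t * prim T g t \<partial>time_measure T) = - (\<integral>t. \<phi> t * g t \<partial>time_measure T)"
proof -
  let ?M = "time_measure T"
  obtain a b where ab: "0 < a" "a < b" "b < T" "\<And>x. x \<notin> {a..b} \<Longrightarrow> \<phi> x = 0"
    by (rule test_function_support[OF phi T]) (rule that)
  obtain B where B: "\<And>x. \<bar>\<phi> x\<bar> \<le> B" by (rule test_function_bounded[OF phi T]) (rule that)
  have Pint: "integrable ?M (prim T g)"
    by (rule continuous_time_integrable[OF prim_continuous[OF g]])
  have "((\<lambda>h. \<integral>t. \<phi> t * ((prim T g (t + h) - prim T g t) / h) \<partial>?M)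
      \<longlongrightarrow> - (\<integral>t. deriv \<phi> t * prim T g t \<partial>?M)) (at 0)"
  proof (rule Lim_transform_eventually[OF test_function_diffquot[OF T phi Pint]])
    have "\<forall>\<^sub>F h::real in at 0. \<bar>h\<bar> < min a (T - b)"
      using ab by (intro eventually_at_ball'[of "min a (T - b)" 0 UNIV, THEN eventually_mono]) (auto simp: dist_real_def)
    then show "\<forall>\<^sub>F h in at 0. (\<integral>t. \<phi> t * ((zero_ext T (prim T g) (t + h) - zero_ext T (prim T g) t) / h) \<partial>?M)
        = (\<integral>t. \<phi> t * ((prim T g (t + h) - prim T g t) / h) \<partial>?M)"
    proof eventually_elim
      case (elim h)
      show ?case
      proof (intro Bochner_Integration.integral_cong refl)
        fix t
        show "\<phi> t * ((zero_ext T (prim T g) (t + h) - zero_ext T (prim T g) t) / h)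
            = \<phi> t * ((prim T g (t + h) - prim T g t) / h)"
        proof (cases "t \<in> {a..b}")
          case True
          then have "t + h \<in> {0<..<T}" "t \<in> {0<..<T}" using elim ab by auto
          then show ?thesis by (simp add: zero_ext_def)
        qed (simp add: ab(4))
      qed
    qed
  qed
  moreover have "((\<lambda>h. \<integral>t. \<phi> t * ((prim T g (t + h) - prim T g t) / h) \<partial>?M)
      \<longlongrightarrow> (\<integral>t. \<phi> t * g t \<partial>?M)) (at 0)"
    by (rule prim_diffquot_weak[OF g T test_function_measurable[OF phi] B])
  ultimately have "- (\<integral>t. deriv \<phi> t * prim T g t \<partial>?M) = (\<integral>t. \<phi> t * g t \<partial>?M)"
    by (rule tendsto_unique[rotated]) simp
  then show ?thesis by simp
qed

text \<open>
  Test functions approximate the indicator functions of intervals boundedly and pointwise, so the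
  primitive of \<open>u\<close> vanishes; by differentiation in the mean, so does \<open>u\<close>.
\<close>

lemma fundamental_lemma:
  assumes T: "T > 0" and u: "integrable (time_measure T) u"
    and orth: "\<And>\<phi>. is_test_function T \<phi> \<Longrightarrow> (\<integral>t. \<phi> t * u t \<partial>time_measure T) = 0"
  shows "AE t in time_measure T. u t = 0"
proof -
  let ?M = "time_measure T"
  have pos: "prim T u x = 0" if x: "0 < x" "x \<le> T" for x
  proof -
    have "(\<lambda>n. \<integral>t. bump (1 / real n) (x - 1 / real n) n t * u t \<partial>?M) \<longlonglongrightarrow> prim T u x"
      unfolding prim_def
    proof (rule integral_dominated_convergence)
      show "integrable ?M (\<lambda>t. \<bar>u t\<bar>)" using u by (rule integrable_abs)
      show "(\<lambda>t. indicat_real {..x} t * u t) \<in> borel_measurable ?M"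
        using integrable_indicator_mult[OF u, of "{..x}"] by auto
      show "(\<lambda>t. bump (1 / real n) (x - 1 / real n) n t * u t) \<in> borel_measurable ?M" for n
      proof -
        have "smooth (bump (1 / real n) (x - 1 / real n) n)"
          unfolding bump_def by (intro smooth_mult smooth_affine smooth_flat)
        then have "bump (1 / real n) (x - 1 / real n) n \<in> borel_measurable ?M"
          by (intro continuous_imp_measurable_on_sets_lebesgue smooth_continuous) auto
        then show ?thesis using u by auto
      qed
      show "AE t in ?M. norm (bump (1 / real n) (x - 1 / real n) n t * u t) \<le> \<bar>u t\<bar>" for n
        using bump_bounds by (intro AE_I2) (auto simp: abs_mult intro!: mult_left_le_one_le)
      show "AE t in ?M. (\<lambda>n. bump (1 / real n) (x - 1 / real n) n t * u t) \<longlonglongrightarrow> indicat_real {..x} t * u t"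
        using AE_space time_measure_AE_neq[where T=T and x=x]
      proof eventually_elim
        case (elim t)
        show ?case
        proof (cases "t < x")
          case True
          with elim have "(\<lambda>n. bump (1 / real n) (x - 1 / real n) n t * u t) \<longlonglongrightarrow> 1 * u t"
            by (intro tendsto_mult bump_tendsto tendsto_const) auto
          then show ?thesis using True by simp
        next
          case False
          with elim have "x < t" by simp
          have "bump (1 / real n) (x - 1 / real n) n t = 0" for n
          proof (cases "n = 0")
            case False
            then have "real n * x \<le> real n * t" using \<open>x < t\<close> by (intro mult_left_mono) auto
            moreover have "real n * (x - 1 / real n) = real n * x - 1"
              using False by (simp add: field_simps)
            ultimately show ?thesis by (simp add: bump_def flat_def)
          qed (simp add: bump_def flat_def)
          then show ?thesis using \<open>x < t\<close> by (simp add: indicator_def)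
        qed
      qed
    qed
    moreover have "\<forall>\<^sub>F n in sequentially. (\<integral>t. bump (1 / real n) (x - 1 / real n) n t * u t \<partial>?M) = 0"
    proof -
      obtain N :: nat where N: "2 / x < real N" using reals_Archimedean2 by blast
      show ?thesis
      proof (intro eventually_sequentiallyI[of N] orth bump_test_function)
        fix n assume n: "N \<le> n"
        then have nx: "2 / x < real n" using N by simp
        moreover have "0 < 2 / x" using x by simp
        ultimately have "0 < real n" by linarith
        then show n0: "0 < 1 / real n" by simp
        show "x - 1 / real n < T" using n0 x by linarith
        show "1 / real n < x - 1 / real n" using nx x \<open>0 < real n\<close> by (simp add: field_simps)
      qed
    qed
    ultimately have "(\<lambda>n. 0) \<longlonglongrightarrow> prim T u x" by (rule Lim_transform_eventually)
    then show ?thesis using LIMSEQ_unique[OF _ tendsto_const] by blast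
  qed
  have zero: "prim T u x = 0" for x
  proof (cases "x \<le> 0")
    case False
    then show ?thesis using pos[of x] pos[of T] prim_ge_T[of T x u] prim_ge_T[of T T u] T by (cases "x \<le> T") auto
  qed (rule prim_le_0)
  have "((\<lambda>h. \<integral>t. \<bar>u t\<bar> \<partial>?M) \<longlongrightarrow> 0) (at (0::real))"
    using prim_diffquot_L1[OF u T] by (simp add: zero)
  then have "(\<integral>t. \<bar>u t\<bar> \<partial>?M) = 0" by (simp add: tendsto_const_iff)
  then have "AE t in ?M. \<bar>u t\<bar> = 0"
    using u by (subst (asm) integral_nonneg_eq_0_iff_AE) auto
  then show ?thesis by simp
qed

lemma test_function_antiderivative:
  assumes T: "T > 0" and z: "is_test_function T \<zeta>" "(\<integral>t. \<zeta> t \<partial>time_measure T) = 0"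
  shows "is_test_function T (prim T \<zeta>)" "deriv (prim T \<zeta>) = \<zeta>"
proof -
  let ?M = "time_measure T"
  obtain a b where ab: "0 < a" "a < b" "b < T" "\<And>x. x \<notin> {a..b} \<Longrightarrow> \<zeta> x = 0"
    by (rule test_function_support[OF z(1) T]) (rule that)
  have c: "continuous_on {0..T} \<zeta>" by (rule smooth_continuous[OF test_function_smooth[OF z(1)]])
  have out: "prim T \<zeta> x = 0" if "x \<notin> {a..b}" for x
  proof (cases "x < a")
    case True
    have "prim T \<zeta> x = (\<integral>t. 0 \<partial>?M)"
      unfolding prim_def by (intro Bochner_Integration.integral_cong) (use True ab(4) in \<open>auto simp: indicator_def\<close>)
    then show ?thesis by simp
  next
    case False
    have "prim T \<zeta> x = (\<integral>t. \<zeta> t \<partial>?M)"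
      unfolding prim_def by (intro Bochner_Integration.integral_cong) (use False that ab(4) in \<open>auto simp: indicator_def\<close>)
    then show ?thesis using z(2) by simp
  qed
  have der: "(prim T \<zeta> has_field_derivative \<zeta> x) (at x)" for x
  proof (cases "x \<in> {a..b}")
    case True
    then show ?thesis using ab by (intro prim_has_derivative c) auto
  next
    case False
    have "(prim T \<zeta> has_field_derivative 0) (at x)"
      by (rule DERIV_locally_zero[of "- {a..b}"]) (use False out in \<open>auto simp: open_Compl\<close>)
    then show ?thesis using ab(4)[OF False] by simp
  qed
  then show "deriv (prim T \<zeta>) = \<zeta>" by (auto intro: DERIV_imp_deriv)
  have "smooth (prim T \<zeta>)"
    by (rule smooth_antiderivative[OF test_function_smooth[OF z(1)] der])
  then show "is_test_function T (prim T \<zeta>)"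
    unfolding is_test_function_iff[OF T] using ab(1-3) out by blast
qed

text \<open>
  A test function is a derivative of a test function exactly if its integral vanishes.  Subtracting
  from \<open>\<eta>\<close> a multiple of a fixed test function \<open>\<beta>\<close> with nonzero integral therefore shows that
  \<open>f - prim T g\<close> minus a constant is orthogonal to all test functions.
\<close>

lemma du_Bois_Reymond:
  assumes T: "T > 0" and f: "integrable (time_measure T) f" and g: "integrable (time_measure T) g"
    and weak: "\<And>\<phi>. is_test_function T \<phi> \<Longrightarrow>
      (\<integral>t. deriv \<phi> t * f t \<partial>time_measure T) = - (\<integral>t. \<phi> t * g t \<partial>time_measure T)"
  obtains c where "AE t in time_measure T. f t = c + prim T g t"
proof -
  let ?M = "time_measure T"
  define u where "u t = f t - prim T g t" for t
  have Pint: "integrable ?M (prim T g)"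
    by (rule continuous_time_integrable[OF prim_continuous[OF g]])
  have u: "integrable ?M u" unfolding u_def using f Pint by auto
  have du: "(\<integral>t. deriv \<phi> t * u t \<partial>?M) = 0" if phi: "is_test_function T \<phi>" for \<phi>
  proof -
    note d = test_function_deriv[OF phi T]
    have "(\<integral>t. deriv \<phi> t * u t \<partial>?M) = (\<integral>t. deriv \<phi> t * f t \<partial>?M) - (\<integral>t. deriv \<phi> t * prim T g t \<partial>?M)"
      unfolding u_def right_diff_distrib
      by (intro Bochner_Integration.integral_diff test_function_mult_integrable d T f Pint)
    then show ?thesis using weak[OF phi] prim_integration_by_parts[OF T phi g] by simp
  qed
  define \<beta> where "\<beta> = bump (T / 3) (2 * T / 3) 1"
  have beta: "is_test_function T \<beta>" unfolding \<beta>_def using T by (intro bump_test_function) auto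
  have tint: "integrable ?M \<phi>" if "is_test_function T \<phi>" for \<phi>
    by (rule continuous_time_integrable(1)[OF smooth_continuous[OF test_function_smooth[OF that]]])
  define I where "I = (\<integral>t. \<beta> t \<partial>?M)"
  have "I \<noteq> 0"
  proof
    assume "I = 0"
    then have "AE t in ?M. \<beta> t = 0"
      using tint[OF beta] bump_bounds unfolding I_def \<beta>_def
      by (subst (asm) integral_nonneg_eq_0_iff_AE) auto
    then have "AE t in lebesgue. 0 < t \<and> t < T \<longrightarrow> \<beta> t = 0"
      by (simp add: AE_restrict_space_iff)
    then have "AE t in lebesgue. t \<notin> {T / 3<..<2 * T / 3}"
      by eventually_elim (use bump_pos[of 1 "T/3" _ "2 * T / 3"] T in \<open>force simp: \<beta>_def\<close>)
    then have "{T / 3<..<2 * T / 3} \<in> null_sets lebesgue"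
      by (subst (asm) AE_iff_null_sets[symmetric]) auto
    then have "emeasure lebesgue {T / 3<..<2 * T / 3} = 0" by auto
    then show False using T by simp
  qed
  define c where "c = (\<integral>t. \<beta> t * u t \<partial>?M) / I"
  have cint: "integrable ?M (\<lambda>t. c)" by (intro integrable_bounded_time) auto
  have "AE t in ?M. u t - c = 0"
  proof (rule fundamental_lemma[OF T])
    show "integrable ?M (\<lambda>t. u t - c)" using u cint by auto
    fix \<eta> assume eta: "is_test_function T \<eta>"
    define J where "J = (\<integral>t. \<eta> t \<partial>?M)"
    define \<zeta> where "\<zeta> t = 1 * \<eta> t + (- (J / I)) * \<beta> t" for t
    have zeta: "is_test_function T \<zeta>" unfolding \<zeta>_def by (rule test_function_lincomb[OF eta beta T])
    have "(\<integral>t. \<zeta> t \<partial>?M) = J - J / I * I"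
      unfolding \<zeta>_def using tint[OF eta] tint[OF beta] by (simp add: J_def I_def)
    then have z0: "(\<integral>t. \<zeta> t \<partial>?M) = 0" using \<open>I \<noteq> 0\<close> by simp
    have "(\<integral>t. \<zeta> t * u t \<partial>?M) = 0"
      using du[OF test_function_antiderivative(1)[OF T zeta z0]]
      by (simp add: test_function_antiderivative(2)[OF T zeta z0])
    moreover have "(\<integral>t. \<zeta> t * u t \<partial>?M) = (\<integral>t. \<eta> t * u t - J / I * (\<beta> t * u t) \<partial>?M)"
      by (intro Bochner_Integration.integral_cong) (auto simp: \<zeta>_def algebra_simps)
    moreover have "\<dots> = (\<integral>t. \<eta> t * u t \<partial>?M) - J / I * (\<integral>t. \<beta> t * u t \<partial>?M)"
      using test_function_mult_integrable[OF eta T u] test_function_mult_integrable[OF beta T u] by simp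
    ultimately have eu: "(\<integral>t. \<eta> t * u t \<partial>?M) = J * c" by (simp add: c_def)
    have "(\<integral>t. \<eta> t * (u t - c) \<partial>?M) = (\<integral>t. \<eta> t * u t \<partial>?M) - (\<integral>t. \<eta> t * c \<partial>?M)"
      unfolding right_diff_distrib
      by (intro Bochner_Integration.integral_diff test_function_mult_integrable eta T u cint)
    also have "(\<integral>t. \<eta> t * c \<partial>?M) = J * c" by (simp add: J_def)
    finally show "(\<integral>t. \<eta> t * (u t - c) \<partial>?M) = 0" using eu by simp
  qed
  then have "AE t in ?M. f t = c + prim T g t" by eventually_elim (simp add: u_def)
  then show ?thesis by (rule that)
qed

section \<open>Scalarisation of weak derivatives\<close>

lemma has_strong_integral_apply:
  fixes F :: "real \<Rightarrow> ('v::real_normed_vector \<Rightarrow>\<^sub>L real)"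
  assumes "has_strong_integral (time_measure T) F y"
  shows "integrable (time_measure T) (\<lambda>t. blinfun_apply (F t) \<xi>)"
    and "(\<integral>t. blinfun_apply (F t) \<xi> \<partial>time_measure T) = blinfun_apply y \<xi>"
proof -
  let ?M = "time_measure T"
  obtain s where s: "\<And>n. Bochner_Integration.simple_bochner_integrable ?M (s n)"
      and lim: "(\<lambda>n. \<integral>\<^sup>+ x. ennreal (norm (F x - s n x)) \<partial>?M) \<longlonglongrightarrow> 0"
      and slim: "(\<lambda>n. Bochner_Integration.simple_bochner_integral ?M (s n)) \<longlonglongrightarrow> y"
    and F: "strongly_measurable ?M F"
    using assms unfolding has_strong_integral_def by blast
  have "has_bochner_integral ?M (\<lambda>t. blinfun_apply (F t) \<xi>) (blinfun_apply y \<xi>)"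
  proof (rule has_bochner_integral.intros)
    show "(\<lambda>t. blinfun_apply (F t) \<xi>) \<in> borel_measurable ?M"
      by (rule strongly_measurable_real[OF strongly_measurable_compose[OF F]])
         (auto intro!: continuous_intros)
    show "Bochner_Integration.simple_bochner_integrable ?M (\<lambda>t. blinfun_apply (s n t) \<xi>)" for n
      by (rule simple_bochner_integrable_compose2[OF _ s[of n] s[of n], of "\<lambda>a b. blinfun_apply a \<xi>"]) simp
    have lin: "linear (\<lambda>L::'v \<Rightarrow>\<^sub>L real. blinfun_apply L \<xi>)"
      by (rule linearI) (simp_all add: blinfun.add_left blinfun.scaleR_left)
    have "(\<lambda>n. blinfun_apply (Bochner_Integration.simple_bochner_integral ?M (s n)) \<xi>) \<longlonglongrightarrow> blinfun_apply y \<xi>"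
      by (intro tendsto_intros slim)
    then show "(\<lambda>n. Bochner_Integration.simple_bochner_integral ?M (\<lambda>t. blinfun_apply (s n t) \<xi>))
        \<longlonglongrightarrow> blinfun_apply y \<xi>"
      by (simp add: simple_bochner_integral_linear[OF lin s])
    show "(\<lambda>n. \<integral>\<^sup>+ t. norm (blinfun_apply (F t) \<xi> - blinfun_apply (s n t) \<xi>) \<partial>?M) \<longlonglongrightarrow> 0"
    proof (rule tendsto_sandwich[OF _ _ tendsto_const])
      have "(\<lambda>n. ennreal (norm \<xi>) * (\<integral>\<^sup>+ x. ennreal (norm (F x - s n x)) \<partial>?M)) \<longlonglongrightarrow> ennreal (norm \<xi>) * 0"
        by (intro ennreal_tendsto_cmult lim) simp
      then show "(\<lambda>n. ennreal (norm \<xi>) * (\<integral>\<^sup>+ x. ennreal (norm (F x - s n x)) \<partial>?M)) \<longlonglongrightarrow> 0"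
        by simp
      have "(\<integral>\<^sup>+ t. norm (blinfun_apply (F t) \<xi> - blinfun_apply (s n t) \<xi>) \<partial>?M)
          \<le> ennreal (norm \<xi>) * (\<integral>\<^sup>+ x. ennreal (norm (F x - s n x)) \<partial>?M)" for n
      proof -
        have sn: "simple_function ?M (s n)" using s[of n] by (rule simple_bochner_integrable.cases)
        have m: "(\<lambda>t. norm (F t - s n t)) \<in> borel_measurable ?M"
          by (rule strongly_measurable_real[OF strongly_measurable_compose2[OF F strongly_measurable_simple[OF sn], of "\<lambda>x y. norm (x - y)"]])
             (auto intro!: continuous_intros)
        have "(\<integral>\<^sup>+ t. norm (blinfun_apply (F t) \<xi> - blinfun_apply (s n t) \<xi>) \<partial>?M)
            \<le> (\<integral>\<^sup>+ t. ennreal (norm \<xi>) * ennreal (norm (F t - s n t)) \<partial>?M)"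
        proof (intro nn_integral_mono)
          fix t
          have "norm (blinfun_apply (F t - s n t) \<xi>) \<le> norm (F t - s n t) * norm \<xi>" by (rule norm_blinfun)
          then show "ennreal (norm (blinfun_apply (F t) \<xi> - blinfun_apply (s n t) \<xi>))
              \<le> ennreal (norm \<xi>) * ennreal (norm (F t - s n t))"
            by (simp add: blinfun.diff_left mult.commute flip: ennreal_mult)
        qed
        also have "\<dots> = ennreal (norm \<xi>) * (\<integral>\<^sup>+ t. ennreal (norm (F t - s n t)) \<partial>?M)"
          using m by (intro nn_integral_cmult) auto
        finally show ?thesis .
      qed
      then show "\<forall>\<^sub>F n in sequentially. (\<integral>\<^sup>+ t. norm (blinfun_apply (F t) \<xi> - blinfun_apply (s n t) \<xi>) \<partial>?M)
          \<le> ennreal (norm \<xi>) * (\<integral>\<^sup>+ x. ennreal (norm (F x - s n x)) \<partial>?M)"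
        by (intro always_eventually) auto
    qed auto
  qed
  then show "integrable ?M (\<lambda>t. blinfun_apply (F t) \<xi>)"
    and "(\<integral>t. blinfun_apply (F t) \<xi> \<partial>?M) = blinfun_apply y \<xi>"
    by (auto simp: has_bochner_integral_iff)
qed

lemma weak_derivative_apply:
  fixes f g :: "real \<Rightarrow> ('v::real_normed_vector \<Rightarrow>\<^sub>L real)"
  assumes "is_weak_derivative T f g" "is_test_function T \<phi>"
  shows "(\<integral>t. deriv \<phi> t * blinfun_apply (f t) \<xi> \<partial>time_measure T)
      = - (\<integral>t. \<phi> t * blinfun_apply (g t) \<xi> \<partial>time_measure T)"
proof -
  obtain y where y: "has_strong_integral (time_measure T) (\<lambda>t. deriv \<phi> t *\<^sub>R f t) y"
      "has_strong_integral (time_measure T) (\<lambda>t. \<phi> t *\<^sub>R g t) (- y)"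
    using assms unfolding is_weak_derivative_def by blast
  show ?thesis
    using has_strong_integral_apply(2)[OF y(1), of \<xi>] has_strong_integral_apply(2)[OF y(2), of \<xi>]
    by (simp add: blinfun.scaleR_left blinfun.minus_left)
qed

lemma pivot_to_dual_apply:
  assumes "bounded_linear j" shows "blinfun_apply (pivot_to_dual j h) v = inner h (j v)"
proof -
  have "bounded_linear (\<lambda>v. inner h (j v))"
    by (rule bounded_linear_compose[OF bounded_linear_inner_right assms])
  from bounded_linear_Blinfun_apply[OF this] show ?thesis
    by (simp add: pivot_to_dual_def)
qed

lemma L2_apply_integrable:
  fixes g :: "real \<Rightarrow> ('v::real_normed_vector \<Rightarrow>\<^sub>L real)"
  assumes "g \<in> bochner_L2 T" shows "integrable (time_measure T) (\<lambda>t. blinfun_apply (g t) \<xi>)"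
  by (rule L2_blinfun_integrable[OF assms L2_const])

lemma L2_bounded_linear:
  assumes w: "w \<in> bochner_L2 T" and j: "bounded_linear j"
  shows "(\<lambda>t. j (w t)) \<in> bochner_L2 T"
proof -
  interpret bounded_linear j by fact
  obtain K where K: "\<And>x. norm (j x) \<le> norm x * K" using bounded by blast
  have sm: "strongly_measurable (time_measure T) (\<lambda>t. j (w t))"
    by (rule strongly_measurable_compose[OF L2_strongly_measurable[OF w]]) (rule continuous[OF continuous_ident])
  have m: "(\<lambda>t. norm (j (w t))) \<in> borel_measurable (time_measure T)"
    by (rule strongly_measurable_norm[OF sm]) simp
  have "integrable (time_measure T) (\<lambda>t. (norm (j (w t)))\<^sup>2)"
  proof (rule Bochner_Integration.integrable_bound)
    show "integrable (time_measure T) (\<lambda>t. (norm (w t))\<^sup>2 * K\<^sup>2)" using L2_norm_integrable[OF w] by simp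
    show "(\<lambda>t. (norm (j (w t)))\<^sup>2) \<in> borel_measurable (time_measure T)" using m by measurable
    have "(norm (j (w t)))\<^sup>2 \<le> (norm (w t))\<^sup>2 * K\<^sup>2" for t
      using power_mono[OF K[of "w t"], of 2] by (simp add: power_mult_distrib)
    then show "AE t in time_measure T. norm ((norm (j (w t)))\<^sup>2) \<le> norm ((norm (w t))\<^sup>2 * K\<^sup>2)"
      by (intro AE_I2) simp
  qed
  with sm show ?thesis by (simp add: bochner_L2_def)
qed

text \<open>
  For each fixed vector the fundamental lemma gives equality almost everywhere; the exceptional
  sets are united over a countable set that is dense in the essential range of \<open>v\<close>.
\<close>

lemma weak_derivative_pairing_unique:
  fixes f g g' :: "real \<Rightarrow> ('v::real_normed_vector \<Rightarrow>\<^sub>L real)"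
  assumes T: "T > 0" and g: "is_weak_derivative T f g" "g \<in> bochner_L2 T"
    and g': "is_weak_derivative T f g'" "g' \<in> bochner_L2 T" and v: "v \<in> bochner_L2 T"
  shows "(\<integral>t. blinfun_apply (g t) (v t) \<partial>time_measure T) = (\<integral>t. blinfun_apply (g' t) (v t) \<partial>time_measure T)"
proof -
  let ?M = "time_measure T"
  have eq: "AE t in ?M. blinfun_apply (g t) \<xi> - blinfun_apply (g' t) \<xi> = 0" for \<xi>
  proof (rule fundamental_lemma[OF T])
    show "integrable ?M (\<lambda>t. blinfun_apply (g t) \<xi> - blinfun_apply (g' t) \<xi>)"
      by (intro Bochner_Integration.integrable_diff L2_apply_integrable g g')
    fix \<phi> assume phi: "is_test_function T \<phi>"
    have "(\<integral>t. \<phi> t * (blinfun_apply (g t) \<xi> - blinfun_apply (g' t) \<xi>) \<partial>?M)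
        = (\<integral>t. \<phi> t * blinfun_apply (g t) \<xi> \<partial>?M) - (\<integral>t. \<phi> t * blinfun_apply (g' t) \<xi> \<partial>?M)"
      unfolding right_diff_distrib
      by (intro Bochner_Integration.integral_diff test_function_mult_integrable phi T L2_apply_integrable g g')
    then show "(\<integral>t. \<phi> t * (blinfun_apply (g t) \<xi> - blinfun_apply (g' t) \<xi>) \<partial>?M) = 0"
      using weak_derivative_apply[OF g(1) phi, of \<xi>] weak_derivative_apply[OF g'(1) phi, of \<xi>] by simp
  qed
  obtain D where D: "countable D" "AE t in ?M. v t \<in> closure D"
    using strongly_measurable_essential_range[OF L2_strongly_measurable[OF v]] by blast
  have "AE t in ?M. \<forall>\<xi>\<in>D. blinfun_apply (g t) \<xi> - blinfun_apply (g' t) \<xi> = 0"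
    using eq by (simp add: AE_ball_countable[OF D(1)])
  then have "AE t in ?M. blinfun_apply (g t) (v t) = blinfun_apply (g' t) (v t)"
    using D(2)
  proof eventually_elim
    case (elim t)
    have "closed {\<xi>. blinfun_apply (g t) \<xi> = blinfun_apply (g' t) \<xi>}"
      by (intro closed_Collect_eq continuous_intros)
    moreover have "D \<subseteq> {\<xi>. blinfun_apply (g t) \<xi> = blinfun_apply (g' t) \<xi>}" using elim(1) by auto
    ultimately have "closure D \<subseteq> {\<xi>. blinfun_apply (g t) \<xi> = blinfun_apply (g' t) \<xi>}"
      by (rule closure_minimal[rotated])
    then show ?case using elim(2) by auto
  qed
  then show ?thesis
    using L2_blinfun_integrable[OF g(2) v] L2_blinfun_integrable[OF g'(2) v]
    by (intro integral_cong_AE) auto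
qed

section \<open>Primitives of functionals\<close>

text \<open>
  The value at \<open>\<xi>\<close> of the primitive of \<open>g\<close>.  Defining it for each vector separately avoids integrals
  with values in the dual space.
\<close>

definition dual_prim :: "real \<Rightarrow> (real \<Rightarrow> ('v::real_normed_vector \<Rightarrow>\<^sub>L real)) \<Rightarrow> real \<Rightarrow> 'v \<Rightarrow> real" where
  "dual_prim T g t \<xi> = prim T (\<lambda>r. blinfun_apply (g r) \<xi>) t"

lemma dual_prim_bound:
  assumes g: "g \<in> bochner_L2 T"
  shows "\<bar>dual_prim T g t \<xi>\<bar> \<le> (\<integral>r. norm (g r) \<partial>time_measure T) * norm \<xi>"
proof -
  let ?M = "time_measure T"
  have "\<bar>dual_prim T g t \<xi>\<bar> \<le> (\<integral>r. \<bar>indicat_real {..t} r * blinfun_apply (g r) \<xi>\<bar> \<partial>?M)"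
    unfolding dual_prim_def prim_def by (rule integral_abs_bound)
  also have "\<dots> \<le> (\<integral>r. norm (g r) * norm \<xi> \<partial>?M)"
  proof (intro integral_mono)
    show "integrable ?M (\<lambda>r. \<bar>indicat_real {..t} r * blinfun_apply (g r) \<xi>\<bar>)"
      by (intro integrable_abs integrable_indicator_mult L2_apply_integrable g) simp
    show "integrable ?M (\<lambda>r. norm (g r) * norm \<xi>)" using L2_norm_integrable1[OF g] by simp
    show "\<bar>indicat_real {..t} r * blinfun_apply (g r) \<xi>\<bar> \<le> norm (g r) * norm \<xi>" for r
      using norm_blinfun[of "g r" \<xi>] by (auto simp: indicator_def)
  qed
  finally show ?thesis using L2_norm_integrable1[OF g] by simp
qed

lemma dual_prim_bounded_linear:
  assumes g: "g \<in> bochner_L2 T"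
  shows "bounded_linear (dual_prim T g t)"
proof (rule bounded_linear_intro)
  note int = L2_apply_integrable[OF g]
  show "dual_prim T g t (x + y) = dual_prim T g t x + dual_prim T g t y" for x y
    using prim_lincomb[OF int[of x] int[of y], of 1 1 t] by (simp add: dual_prim_def blinfun.add_right)
  show "dual_prim T g t (r *\<^sub>R x) = r *\<^sub>R dual_prim T g t x" for r x
    using prim_lincomb[OF int[of x] int[of x], of r 0 t] by (simp add: dual_prim_def blinfun.scaleR_right)
  show "norm (dual_prim T g t x) \<le> norm x * (\<integral>r. norm (g r) \<partial>time_measure T)" for x
    using dual_prim_bound[OF g, of t x] by (simp add: mult.commute)
qed

lemma simple_function_expansion:
  fixes F :: "'v \<Rightarrow> real"
  assumes s: "simple_function (time_measure T) s" and t: "t \<in> {0<..<T}"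
  shows "F (s t) = (\<Sum>\<xi>\<in>s ` {0<..<T}. indicat_real {t \<in> {0<..<T}. s t = \<xi>} t * F \<xi>)"
proof -
  have fin: "finite (s ` {0<..<T})" using s by (simp add: simple_function_def)
  have "(\<Sum>\<xi>\<in>s ` {0<..<T}. indicat_real {t \<in> {0<..<T}. s t = \<xi>} t * F \<xi>)
      = (\<Sum>\<xi>\<in>s ` {0<..<T}. if \<xi> = s t then F \<xi> else 0)"
    using t by (intro sum.cong) (auto simp: indicator_def)
  also have "\<dots> = F (s t)" using fin t by simp
  finally show ?thesis ..
qed

lemma simple_level_set:
  assumes "simple_function (time_measure T) s"
  shows "{t \<in> {0<..<T}. s t = \<xi>} \<in> sets (time_measure T)"
proof (cases "\<xi> \<in> s ` {0<..<T}")
  case True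
  then have "s -` {\<xi>} \<inter> space (time_measure T) \<in> sets (time_measure T)"
    using assms by (auto simp: simple_function_def)
  also have "s -` {\<xi>} \<inter> space (time_measure T) = {t \<in> {0<..<T}. s t = \<xi>}" by auto
  finally show ?thesis .
next
  case False
  then have "{t \<in> {0<..<T}. s t = \<xi>} = {}" by auto
  then show ?thesis by (simp only: sets.empty_sets)
qed

lemma dual_prim_shift_measurable:
  assumes g: "g \<in> bochner_L2 T" and w: "w \<in> bochner_L2 T"
  shows "(\<lambda>t. dual_prim T g (t + h) (w t)) \<in> borel_measurable (time_measure T)"
proof -
  let ?M = "time_measure T"
  obtain s where s: "\<And>n. simple_function ?M (s n)" "AE t in ?M. (\<lambda>n. s n t) \<longlonglongrightarrow> w t"
    using L2_strongly_measurable[OF w] unfolding strongly_measurable_def by blast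
  show ?thesis
  proof (rule lebesgue_on_measurable_AE_LIMSEQ)
    show "AE t in ?M. (\<lambda>n. dual_prim T g (t + h) (s n t)) \<longlonglongrightarrow> dual_prim T g (t + h) (w t)"
      using s(2) by eventually_elim (rule bounded_linear.tendsto[OF dual_prim_bounded_linear[OF g]])
    fix n
    have c: "(\<lambda>t. dual_prim T g (t + h) \<xi>) \<in> borel_measurable ?M" for \<xi>
    proof (rule continuous_imp_measurable_on_sets_lebesgue)
      show "continuous_on {0<..<T} (\<lambda>t. dual_prim T g (t + h) \<xi>)"
        unfolding dual_prim_def
        by (intro continuous_on_compose2[OF prim_continuous[OF L2_apply_integrable[OF g], of UNIV]] continuous_intros) auto
    qed simp
    have "(\<lambda>t. \<Sum>\<xi>\<in>s n ` {0<..<T}. indicat_real {t \<in> {0<..<T}. s n t = \<xi>} t * dual_prim T g (t + h) \<xi>) \<in> borel_measurable ?M"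
      by (intro borel_measurable_sum borel_measurable_times c borel_measurable_indicator simple_level_set s)
    then show "(\<lambda>t. dual_prim T g (t + h) (s n t)) \<in> borel_measurable ?M"
      by (subst measurable_cong) (use simple_function_expansion[OF s(1)] in auto)
  qed simp
qed

definition dual_quot :: "real \<Rightarrow> (real \<Rightarrow> ('v::real_normed_vector \<Rightarrow>\<^sub>L real)) \<Rightarrow> real \<Rightarrow> real \<Rightarrow> 'v \<Rightarrow> real" where
  "dual_quot T g h t \<xi> = (dual_prim T g (t + h) \<xi> - dual_prim T g t \<xi>) / h"

lemma dual_quot_diff: "g \<in> bochner_L2 T \<Longrightarrow> dual_quot T g h t (x - y) = dual_quot T g h t x - dual_quot T g h t y"
  by (simp add: dual_quot_def diff_divide_distrib linear_diff[OF bounded_linear.linear[OF dual_prim_bounded_linear]])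

lemma dual_quot_integrable:
  assumes g: "g \<in> bochner_L2 T" and w: "w \<in> bochner_L2 T"
    and psi: "\<psi> \<in> borel_measurable (time_measure T)" "\<And>t. \<bar>\<psi> t\<bar> \<le> B"
  shows "integrable (time_measure T) (\<lambda>t. \<psi> t * dual_quot T g h t (w t))"
proof (rule Bochner_Integration.integrable_bound)
  let ?M = "time_measure T"
  let ?C = "(\<integral>r. norm (g r) \<partial>?M)"
  show "integrable ?M (\<lambda>t. \<bar>B\<bar> * (2 * ?C * norm (w t) / \<bar>h\<bar>))"
    using L2_norm_integrable1[OF w] by simp
  show "(\<lambda>t. \<psi> t * dual_quot T g h t (w t)) \<in> borel_measurable ?M"
    using dual_prim_shift_measurable[OF g w, of h] dual_prim_shift_measurable[OF g w, of 0] psi(1)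
    unfolding dual_quot_def by simp
  show "AE t in ?M. norm (\<psi> t * dual_quot T g h t (w t)) \<le> norm (\<bar>B\<bar> * (2 * ?C * norm (w t) / \<bar>h\<bar>))"
  proof (intro AE_I2)
    fix t
    have "\<bar>\<psi> t\<bar> \<le> \<bar>B\<bar>" using psi(2)[of t] by simp
    moreover have "\<bar>dual_quot T g h t (w t)\<bar> \<le> 2 * ?C * norm (w t) / \<bar>h\<bar>"
      unfolding dual_quot_def abs_divide
      using dual_prim_bound[OF g, of "t + h" "w t"] dual_prim_bound[OF g, of t "w t"]
      by (intro divide_right_mono) linarith+
    ultimately have "\<bar>\<psi> t\<bar> * \<bar>dual_quot T g h t (w t)\<bar> \<le> \<bar>B\<bar> * (2 * ?C * norm (w t) / \<bar>h\<bar>)"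
      by (intro mult_mono) auto
    then have "\<bar>\<psi> t * dual_quot T g h t (w t)\<bar> \<le> \<bar>B\<bar> * (2 * ?C * norm (w t) / \<bar>h\<bar>)"
      by (simp only: abs_mult)
    also have "\<dots> \<le> \<bar>\<bar>B\<bar> * (2 * ?C * norm (w t) / \<bar>h\<bar>)\<bar>" by (rule abs_ge_self)
    finally show "norm (\<psi> t * dual_quot T g h t (w t)) \<le> norm (\<bar>B\<bar> * (2 * ?C * norm (w t) / \<bar>h\<bar>))"
      by (simp only: real_norm_def)
  qed
qed

lemma young_inequality:
  fixes a b e :: real
  assumes "e > 0" shows "a * b \<le> e / 2 * a\<^sup>2 + b\<^sup>2 / (2 * e)"
proof -
  have "2 * (e * a) * b \<le> (e * a)\<^sup>2 + b\<^sup>2" by (rule sum_squares_bound)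
  then show ?thesis using assms by (simp add: field_simps power2_eq_square)
qed

lemma dual_quot_young:
  assumes g: "g \<in> bochner_L2 T" and "e > 0"
  shows "\<bar>dual_quot T g h t \<xi>\<bar> \<le> e / 2 * ((prim T (\<lambda>r. (norm (g r))\<^sup>2) (t + h) - prim T (\<lambda>r. (norm (g r))\<^sup>2) t) / h)
      + (norm \<xi>)\<^sup>2 / (2 * e)"
proof -
  let ?M = "time_measure T"
  let ?q = "\<lambda>r. e / 2 * (norm (g r))\<^sup>2 + (norm \<xi>)\<^sup>2 / (2 * e) * 1"
  have one: "integrable ?M (\<lambda>r. 1::real)"
    by (rule finite_measure.integrable_const[OF finite_time_measure])
  have "\<bar>dual_quot T g h t \<xi>\<bar> \<le> (prim T ?q (t + h) - prim T ?q t) / h"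
    unfolding dual_quot_def dual_prim_def
  proof (rule prim_diffquot_abs_bound)
    show "integrable ?M (\<lambda>r. blinfun_apply (g r) \<xi>)" by (rule L2_apply_integrable[OF g])
    show "integrable ?M ?q" using L2_norm_integrable[OF g] one by (intro Bochner_Integration.integrable_add integrable_mult_right)
    fix r
    have "\<bar>blinfun_apply (g r) \<xi>\<bar> \<le> norm (g r) * norm \<xi>" using norm_blinfun[of "g r" \<xi>] by simp
    also have "\<dots> \<le> e / 2 * (norm (g r))\<^sup>2 + (norm \<xi>)\<^sup>2 / (2 * e)"
      by (rule young_inequality[OF \<open>e > 0\<close>])
    finally show "\<bar>blinfun_apply (g r) \<xi>\<bar> \<le> ?q r" by simp
  qed
  also have "\<dots> = e / 2 * ((prim T (\<lambda>r. (norm (g r))\<^sup>2) (t + h) - prim T (\<lambda>r. (norm (g r))\<^sup>2) t) / h)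
      + (norm \<xi>)\<^sup>2 / (2 * e) * ((prim T (\<lambda>r. 1) (t + h) - prim T (\<lambda>r. 1) t) / h)"
    unfolding prim_lincomb[OF L2_norm_integrable[OF g] one]
    by (simp add: add_divide_distrib diff_divide_distrib right_diff_distrib)
  also have "\<dots> \<le> e / 2 * ((prim T (\<lambda>r. (norm (g r))\<^sup>2) (t + h) - prim T (\<lambda>r. (norm (g r))\<^sup>2) t) / h)
      + (norm \<xi>)\<^sup>2 / (2 * e) * 1"
    using \<open>e > 0\<close> by (intro add_left_mono mult_left_mono prim_const_diffquot_le) auto
  finally show ?thesis by simp
qed

text \<open>
  If \<open>w\<close> is simple, the claim is a finite sum of scalar ones.  In general, the error of an
  approximation by simple functions is small uniformly in \<open>h\<close>: by Young's inequality it is controlled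
  by the difference quotient of the primitive of \<open>\<parallel>g\<parallel>\<^sup>2\<close>, whose integral is bounded.
\<close>

lemma dual_quot_weak_convergence:
  assumes T: "T > 0" and g: "g \<in> bochner_L2 T" and w: "w \<in> bochner_L2 T"
    and psi: "\<psi> \<in> borel_measurable (time_measure T)" "\<And>t. \<bar>\<psi> t\<bar> \<le> B"
  shows "((\<lambda>h. \<integral>t. \<psi> t * dual_quot T g h t (w t) \<partial>time_measure T)
      \<longlongrightarrow> (\<integral>t. \<psi> t * blinfun_apply (g t) (w t) \<partial>time_measure T)) (at 0)"
proof (rule LIM_I)
  let ?M = "time_measure T"
  let ?I = "\<lambda>h w. \<integral>t. \<psi> t * dual_quot T g h t (w t) \<partial>?M"
  let ?J = "\<lambda>w. \<integral>t. \<psi> t * blinfun_apply (g t) (w t) \<partial>?M"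
  let ?G = "\<integral>t. (norm (g t))\<^sup>2 \<partial>?M"
  have B0: "0 \<le> B" using psi(2)[of 0] by simp
  have G0: "0 \<le> ?G" by simp
  then have G1: "0 < ?G + 1" by linarith
  note mult = bounded_mult_integrable[OF psi]
  fix r :: real assume r: "r > 0"
  \<comment> \<open>Young's inequality with parameter \<open>e\<close> makes each of the two approximation errors less than \<open>r / 3\<close>.\<close>
  define e where "e = r / (3 * (B + 1) * (?G + 1))"
  have e: "e > 0" unfolding e_def using r B0 G1 by (intro divide_pos_pos mult_pos_pos) simp_all
  obtain s where s: "simple_function ?M s" "(\<integral>t. (norm (w t - s t))\<^sup>2 \<partial>?M) < e\<^sup>2"
    using L2_simple_approximation[OF w, of "e\<^sup>2"] e by auto
  note sL2 = L2_simple[OF s(1)]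
  have v: "w - s \<in> bochner_L2 T" by (rule L2_diff[OF w sL2])
  let ?N = "\<integral>t. (norm (w t - s t))\<^sup>2 \<partial>?M"
  have vint: "integrable ?M (\<lambda>t. (norm (w t - s t))\<^sup>2)" using L2_norm_integrable[OF v] by (simp add: fun_diff_def)
  have small: "B * (e / 2 * ?G + ?N / (2 * e)) < r / 3"
  proof -
    have "?N / (2 * e) \<le> e / 2" using s(2) e by (simp add: field_simps power2_eq_square)
    then have "B * (e / 2 * ?G + ?N / (2 * e)) \<le> B * (e / 2 * (?G + 1))"
      using B0 by (intro mult_left_mono) (auto simp: algebra_simps)
    also have "\<dots> < (B + 1) * (e * (?G + 1))"
    proof -
      have pos: "0 < e * (?G + 1)" using e G1 by (rule mult_pos_pos)
      have "B * (e / 2 * (?G + 1)) = B * (e * (?G + 1)) / 2" by simp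
      also have "\<dots> \<le> B * (e * (?G + 1))"
        using mult_nonneg_nonneg[OF B0 less_imp_le[OF pos]] by simp
      also have "\<dots> < (B + 1) * (e * (?G + 1))" using pos by (simp add: distrib_right)
      finally show ?thesis .
    qed
    also have "\<dots> = r / 3"
    proof -
      have "x * (r / (3 * x * y) * y) = r / 3" if "x \<noteq> 0" "y \<noteq> 0" for x y :: real
        using that by simp
      from this[of "B + 1" "?G + 1"] show ?thesis unfolding e_def using B0 G1 by linarith
    qed
    finally show ?thesis .
  qed
  have lin: "(\<integral>t. B * (e / 2 * p t + n t / (2 * e)) \<partial>?M)
      = B * (e / 2 * (\<integral>t. p t \<partial>?M) + (\<integral>t. n t \<partial>?M) / (2 * e))"
    if "integrable ?M p" "integrable ?M n" for p n
    using that by simp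
  have D: "\<bar>?I h w - ?I h s\<bar> < r / 3" if "h \<noteq> 0" for h
  proof -
    let ?Q = "\<lambda>t. (prim T (\<lambda>r. (norm (g r))\<^sup>2) (t + h) - prim T (\<lambda>r. (norm (g r))\<^sup>2) t) / h"
    note Qint = prim_shift_integrable[OF L2_norm_integrable[OF g], of h]
    have "?I h w - ?I h s = (\<integral>t. \<psi> t * dual_quot T g h t (w t) - \<psi> t * dual_quot T g h t (s t) \<partial>?M)"
      by (rule Bochner_Integration.integral_diff[symmetric, OF dual_quot_integrable[OF g w psi] dual_quot_integrable[OF g sL2 psi]])
    then have "\<bar>?I h w - ?I h s\<bar> = \<bar>\<integral>t. \<psi> t * dual_quot T g h t (w t - s t) \<partial>?M\<bar>"
      by (simp add: dual_quot_diff[OF g] right_diff_distrib)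
    also have "\<dots> \<le> (\<integral>t. \<bar>\<psi> t * dual_quot T g h t (w t - s t)\<bar> \<partial>?M)"
      by (rule integral_abs_bound)
    also have "\<dots> \<le> (\<integral>t. B * (e / 2 * ?Q t + (norm (w t - s t))\<^sup>2 / (2 * e)) \<partial>?M)"
    proof (rule integral_mono)
      show "integrable ?M (\<lambda>t. \<bar>\<psi> t * dual_quot T g h t (w t - s t)\<bar>)"
        using dual_quot_integrable[OF g v psi] by (auto simp: fun_diff_def)
      show "integrable ?M (\<lambda>t. B * (e / 2 * ?Q t + (norm (w t - s t))\<^sup>2 / (2 * e)))"
        by (intro integrable_mult_right Bochner_Integration.integrable_add integrable_divide_zero Qint vint)
      fix t
      show "\<bar>\<psi> t * dual_quot T g h t (w t - s t)\<bar> \<le> B * (e / 2 * ?Q t + (norm (w t - s t))\<^sup>2 / (2 * e))"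
        unfolding abs_mult by (intro mult_mono dual_quot_young g e psi(2)) (use B0 in auto)
    qed
    also have "\<dots> = B * (e / 2 * (\<integral>t. ?Q t \<partial>?M) + ?N / (2 * e))"
      by (rule lin[OF Qint vint])
    also have "\<dots> \<le> B * (e / 2 * ?G + ?N / (2 * e))"
      using e B0 \<open>h \<noteq> 0\<close> T L2_norm_integrable[OF g]
      by (intro mult_left_mono add_right_mono prim_diffquot_integral_le) auto
    finally show ?thesis using small by linarith
  qed
  have E: "\<bar>?J w - ?J s\<bar> < r / 3"
  proof -
    have "?J w - ?J s = (\<integral>t. \<psi> t * blinfun_apply (g t) (w t) - \<psi> t * blinfun_apply (g t) (s t) \<partial>?M)"
      by (intro Bochner_Integration.integral_diff[symmetric] mult L2_blinfun_integrable g w sL2)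
    then have "\<bar>?J w - ?J s\<bar> = \<bar>\<integral>t. \<psi> t * blinfun_apply (g t) (w t - s t) \<partial>?M\<bar>"
      by (simp add: blinfun.diff_right right_diff_distrib)
    also have "\<dots> \<le> (\<integral>t. \<bar>\<psi> t * blinfun_apply (g t) (w t - s t)\<bar> \<partial>?M)"
      by (rule integral_abs_bound)
    also have "\<dots> \<le> (\<integral>t. B * (e / 2 * (norm (g t))\<^sup>2 + (norm (w t - s t))\<^sup>2 / (2 * e)) \<partial>?M)"
    proof (rule integral_mono)
      show "integrable ?M (\<lambda>t. \<bar>\<psi> t * blinfun_apply (g t) (w t - s t)\<bar>)"
        using mult[OF L2_blinfun_integrable[OF g v]] by (auto simp: fun_diff_def)
      show "integrable ?M (\<lambda>t. B * (e / 2 * (norm (g t))\<^sup>2 + (norm (w t - s t))\<^sup>2 / (2 * e)))"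
        by (intro integrable_mult_right Bochner_Integration.integrable_add integrable_divide_zero L2_norm_integrable g vint)
      fix t
      have "\<bar>blinfun_apply (g t) (w t - s t)\<bar> \<le> norm (g t) * norm (w t - s t)"
        using norm_blinfun[of "g t" "w t - s t"] by simp
      also have "\<dots> \<le> e / 2 * (norm (g t))\<^sup>2 + (norm (w t - s t))\<^sup>2 / (2 * e)"
        by (rule young_inequality[OF e])
      finally show "\<bar>\<psi> t * blinfun_apply (g t) (w t - s t)\<bar> \<le> B * (e / 2 * (norm (g t))\<^sup>2 + (norm (w t - s t))\<^sup>2 / (2 * e))"
        unfolding abs_mult using psi(2)[of t] B0 by (intro mult_mono) auto
    qed
    also have "\<dots> = B * (e / 2 * ?G + ?N / (2 * e))"
      by (rule lin[OF L2_norm_integrable[OF g] vint])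
    finally show ?thesis using small by linarith
  qed
  have S: "((\<lambda>h. ?I h s) \<longlongrightarrow> ?J s) (at 0)"
  proof -
    let ?A = "\<lambda>\<xi>. {t \<in> {0<..<T}. s t = \<xi>}"
    let ?R = "s ` {0<..<T}"
    have pm: "(\<lambda>t. \<psi> t * indicat_real (?A \<xi>) t) \<in> borel_measurable ?M" for \<xi>
      using borel_measurable_times[OF psi(1) borel_measurable_indicator[OF simple_level_set[OF s(1)]]] .
    have pb: "\<bar>\<psi> t * indicat_real (?A \<xi>) t\<bar> \<le> B" for t \<xi>
      using psi(2)[of t] B0 by (auto simp: indicator_def)
    have I: "?I h s = (\<Sum>\<xi>\<in>?R. \<integral>t. (\<psi> t * indicat_real (?A \<xi>) t) * dual_quot T g h t \<xi> \<partial>?M)" for h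
    proof -
      have "?I h s = (\<integral>t. (\<Sum>\<xi>\<in>?R. (\<psi> t * indicat_real (?A \<xi>) t) * dual_quot T g h t \<xi>) \<partial>?M)"
      proof (intro Bochner_Integration.integral_cong refl)
        fix t assume "t \<in> space ?M"
        then have t: "t \<in> {0<..<T}" by simp
        show "\<psi> t * dual_quot T g h t (s t) = (\<Sum>\<xi>\<in>?R. (\<psi> t * indicat_real (?A \<xi>) t) * dual_quot T g h t \<xi>)"
          by (subst simple_function_expansion[OF s(1) t, of "dual_quot T g h t"]) (simp add: sum_distrib_left mult.assoc)
      qed
      also have "\<dots> = (\<Sum>\<xi>\<in>?R. \<integral>t. (\<psi> t * indicat_real (?A \<xi>) t) * dual_quot T g h t \<xi> \<partial>?M)"
        by (intro Bochner_Integration.integral_sum dual_quot_integrable[OF g L2_const pm pb])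
      finally show ?thesis .
    qed
    have J: "?J s = (\<Sum>\<xi>\<in>?R. \<integral>t. (\<psi> t * indicat_real (?A \<xi>) t) * blinfun_apply (g t) \<xi> \<partial>?M)"
    proof -
      have "?J s = (\<integral>t. (\<Sum>\<xi>\<in>?R. (\<psi> t * indicat_real (?A \<xi>) t) * blinfun_apply (g t) \<xi>) \<partial>?M)"
      proof (intro Bochner_Integration.integral_cong refl)
        fix t assume "t \<in> space ?M"
        then have t: "t \<in> {0<..<T}" by simp
        show "\<psi> t * blinfun_apply (g t) (s t) = (\<Sum>\<xi>\<in>?R. (\<psi> t * indicat_real (?A \<xi>) t) * blinfun_apply (g t) \<xi>)"
          by (subst simple_function_expansion[OF s(1) t, of "blinfun_apply (g t)"]) (simp add: sum_distrib_left mult.assoc)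
      qed
      also have "\<dots> = (\<Sum>\<xi>\<in>?R. \<integral>t. (\<psi> t * indicat_real (?A \<xi>) t) * blinfun_apply (g t) \<xi> \<partial>?M)"
        by (intro Bochner_Integration.integral_sum bounded_mult_integrable[OF pm pb] L2_apply_integrable g)
      finally show ?thesis .
    qed
    show ?thesis
      unfolding I J unfolding dual_quot_def dual_prim_def
      by (intro tendsto_sum prim_diffquot_weak[OF L2_apply_integrable[OF g] T pm pb])
  qed
  from LIM_D[OF S, of "r / 3"] r obtain d where "d > 0" and
    d: "\<forall>h. h \<noteq> 0 \<and> norm (h - 0) < d \<longrightarrow> norm (?I h s - ?J s) < r / 3"
    by auto
  show "\<exists>d>0. \<forall>h. h \<noteq> 0 \<and> norm (h - 0) < d \<longrightarrow> norm (?I h w - ?J w) < r"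
  proof (intro exI conjI allI impI)
    fix h :: real assume h: "h \<noteq> 0 \<and> norm (h - 0) < d"
    show "norm (?I h w - ?J w) < r"
      using d[rule_format, OF h] D[of h] E h unfolding real_norm_def by linarith
  qed (rule \<open>d > 0\<close>)
qed

section \<open>The energy identity\<close>

text \<open>
  The lemma of du Bois-Reymond applies to \<open>(j (w t), j \<xi>)\<close> for each \<open>\<xi>\<close>.  Only countably many \<open>\<xi>\<close>, which
  approximate the values of \<open>w\<close>, are admitted to the exceptional null set; for \<open>\<xi> = w r\<close> the equation
  follows by continuity.  The constants of integration, about which nothing is known as functions of
  \<open>\<xi>\<close>, cancel in the increments.
\<close>

lemma in_dual_increments:
  fixes j :: "'v::real_inner \<Rightarrow> 'h::real_inner"
  assumes j: "bounded_linear j" and T: "T > 0" and w: "w \<in> bochner_L2 T" and g: "g \<in> bochner_L2 T"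
    and wd: "is_weak_derivative T (in_dual j w) g"
  obtains G where "G \<subseteq> {0<..<T}" "AE t in time_measure T. t \<in> G"
    "\<And>r s t. r \<in> G \<Longrightarrow> s \<in> G \<Longrightarrow> t \<in> G \<Longrightarrow>
      inner (j (w t) - j (w s)) (j (w r)) = dual_prim T g t (w r) - dual_prim T g s (w r)"
proof -
  let ?M = "time_measure T"
  interpret bounded_linear j by fact
  have jw: "(\<lambda>t. j (w t)) \<in> bochner_L2 T" by (rule L2_bounded_linear[OF w j])
  have ap: "blinfun_apply (in_dual j w t) \<xi> = inner (j (w t)) (j \<xi>)" for t \<xi>
    by (simp add: in_dual_def pivot_to_dual_apply[OF j])
  have "\<exists>c. AE t in ?M. inner (j (w t)) (j \<xi>) = c + dual_prim T g t \<xi>" for \<xi>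
  proof -
    have "integrable ?M (\<lambda>t. inner (j (w t)) (j \<xi>))" by (rule L2_inner_integrable[OF jw L2_const])
    then obtain c where "AE t in ?M. inner (j (w t)) (j \<xi>) = c + prim T (\<lambda>r. blinfun_apply (g r) \<xi>) t"
      by (rule du_Bois_Reymond[OF T _ L2_apply_integrable[OF g, of \<xi>]])
         (use weak_derivative_apply[OF wd, of _ \<xi>] in \<open>simp_all add: ap\<close>)
    then show ?thesis by (auto simp: dual_prim_def)
  qed
  then obtain c where c: "\<And>\<xi>. AE t in ?M. inner (j (w t)) (j \<xi>) = c \<xi> + dual_prim T g t \<xi>" by metis
  obtain D where D: "countable D" "AE t in ?M. w t \<in> closure D"
    using strongly_measurable_essential_range[OF L2_strongly_measurable[OF w]] by blast
  define G where "G = {t \<in> {0<..<T}. w t \<in> closure D \<and> (\<forall>\<xi>\<in>D. inner (j (w t)) (j \<xi>) = c \<xi> + dual_prim T g t \<xi>)}"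
  have "AE t in ?M. \<forall>\<xi>\<in>D. inner (j (w t)) (j \<xi>) = c \<xi> + dual_prim T g t \<xi>"
    using c by (simp add: AE_ball_countable[OF D(1)])
  then have "AE t in ?M. t \<in> G"
    using D(2) AE_space by eventually_elim (simp add: G_def)
  moreover have "inner (j (w t) - j (w s)) (j (w r)) = dual_prim T g t (w r) - dual_prim T g s (w r)"
    if G: "r \<in> G" "s \<in> G" "t \<in> G" for r s t
  proof -
    let ?C = "{\<xi>. inner (j (w t) - j (w s)) (j \<xi>) = dual_prim T g t \<xi> - dual_prim T g s \<xi>}"
    have cont: "continuous_on UNIV (dual_prim T g x)" for x
      by (rule linear_continuous_on[OF dual_prim_bounded_linear[OF g]])
    have "closed ?C"
      by (intro closed_Collect_eq continuous_intros cont linear_continuous_on[OF j])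
    moreover have "D \<subseteq> ?C" using G by (auto simp: G_def inner_diff_left)
    ultimately have "closure D \<subseteq> ?C" by (rule closure_minimal[rotated])
    then show ?thesis using G(1) by (auto simp: G_def)
  qed
  ultimately show ?thesis by (intro that[of G]) (auto simp: G_def)
qed

lemma AE_lebesgue_shift:
  fixes P :: "real \<Rightarrow> bool"
  assumes "AE t in lebesgue. P t" shows "AE t in lebesgue. P (t + h)"
proof -
  have "negligible {t. \<not> P t}"
    using assms by (simp add: completion.AE_iff_null_sets negligible_iff_null_sets)
  then have "negligible ((+) (- h) ` {t. \<not> P t})" by (rule negligible_translation)
  also have "(+) (- h) ` {t. \<not> P t} = {t. \<not> P (t + h)}"
  proof (intro set_eqI iffI)
    fix x assume "x \<in> {t. \<not> P (t + h)}"
    then show "x \<in> (+) (- h) ` {t. \<not> P t}" by (intro image_eqI[of _ _ "x + h"]) auto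
  qed auto
  finally show ?thesis
    by (simp add: completion.AE_iff_null_sets negligible_iff_null_sets)
qed

lemma test_function_diffquot_integrable:
  assumes T: "T > 0" and psi: "is_test_function T \<psi>" and q: "integrable (time_measure T) q"
  shows "integrable (time_measure T) (\<lambda>t. \<psi> t * ((zero_ext T q (t + h) - zero_ext T q t) / h))"
proof (rule test_function_mult_integrable[OF psi T])
  have restr: "integrable (time_measure T) f" if "integrable lebesgue f" for f :: "real \<Rightarrow> real"
    unfolding integrable_restrict_space[OF time_interval_sets]
    using integrable_mult_indicator[OF _ that, of "{0<..<T}"] by simp
  show "integrable (time_measure T) (\<lambda>t. (zero_ext T q (t + h) - zero_ext T q t) / h)"
    using zero_ext_integrable[OF q, of h] zero_ext_integrable[OF q, of 0]
    by (intro integrable_divide_zero Bochner_Integration.integrable_diff restr) simp_all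
qed

text \<open>
  By convexity, \<open>\<parallel>b\<parallel>\<^sup>2 - \<parallel>a\<parallel>\<^sup>2 \<ge> 2 (b - a, a)\<close>.  With \<open>a = j (w t)\<close> and \<open>b = j (w (t + h))\<close>, the difference
  quotients of \<open>\<parallel>j w\<parallel>\<^sup>2\<close> are bounded from below for \<open>h > 0\<close>, and from above for \<open>h < 0\<close>, by those
  of the primitive of \<open>g\<close>, evaluated at \<open>w\<close>.  Since the latter have the same limit from both
  sides, equality follows.
\<close>

lemma weak_energy_identity_nonneg:
  fixes j :: "'v::real_inner \<Rightarrow> 'h::real_inner"
  assumes j: "bounded_linear j" and T: "T > 0" and w: "w \<in> bochner_L2 T" and g: "g \<in> bochner_L2 T"
    and wd: "is_weak_derivative T (in_dual j w) g"
    and psi: "is_test_function T \<psi>" "\<And>t. 0 \<le> \<psi> t"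
  shows "- (\<integral>t. deriv \<psi> t * (norm (j (w t)))\<^sup>2 \<partial>time_measure T)
    = 2 * (\<integral>t. \<psi> t * blinfun_apply (g t) (w t) \<partial>time_measure T)"
proof -
  let ?M = "time_measure T"
  define q where "q t = (norm (j (w t)))\<^sup>2" for t
  have q: "integrable ?M q"
    unfolding q_def by (rule L2_norm_integrable[OF L2_bounded_linear[OF w j]])
  let ?L = "\<lambda>h. \<integral>t. \<psi> t * ((zero_ext T q (t + h) - zero_ext T q t) / h) \<partial>?M"
  let ?R = "\<lambda>h. 2 * (\<integral>t. \<psi> t * dual_quot T g h t (w t) \<partial>?M)"
  obtain B where B: "\<And>x. \<bar>\<psi> x\<bar> \<le> B" by (rule test_function_bounded[OF psi(1) T]) (rule that)
  note meas = test_function_measurable[OF psi(1)]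
  obtain a b where ab: "0 < a" "a < b" "b < T" "\<And>x. x \<notin> {a..b} \<Longrightarrow> \<psi> x = 0"
    by (rule test_function_support[OF psi(1) T]) (rule that)
  obtain G where G: "G \<subseteq> {0<..<T}" "AE t in ?M. t \<in> G"
    and inc: "\<And>r s t. r \<in> G \<Longrightarrow> s \<in> G \<Longrightarrow> t \<in> G \<Longrightarrow>
      inner (j (w t) - j (w s)) (j (w r)) = dual_prim T g t (w r) - dual_prim T g s (w r)"
    by (rule in_dual_increments[OF j T w g wd]) (rule that)
  have aeL: "AE t in lebesgue. t \<in> {0<..<T} \<longrightarrow> t \<in> G"
    using G(2) by (simp add: AE_restrict_space_iff)
  have pointwise: "AE t in ?M. 2 * (\<psi> t * (dual_prim T g (t + h) (w t) - dual_prim T g t (w t)))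
      \<le> \<psi> t * (zero_ext T q (t + h) - zero_ext T q t)" if h: "\<bar>h\<bar> < min a (T - b)" for h
  proof -
    have "AE t in lebesgue. t + h \<in> {0<..<T} \<longrightarrow> t + h \<in> G"
      by (rule AE_lebesgue_shift[OF aeL])
    then have "AE t in ?M. t + h \<in> {0<..<T} \<longrightarrow> t + h \<in> G"
      by (auto simp: AE_restrict_space_iff elim: eventually_mono)
    then show ?thesis
      using G(2)
    proof eventually_elim
      case (elim t)
      show ?case
      proof (cases "t \<in> {a..b}")
        case True
        then have t: "t \<in> {0<..<T}" "t + h \<in> {0<..<T}" using h ab by auto
        let ?x = "j (w t)" and ?y = "j (w (t + h))"
        have "2 * (dual_prim T g (t + h) (w t) - dual_prim T g t (w t)) = 2 * inner (?y - ?x) ?x"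
          using inc[of t t "t + h"] elim t by simp
        also have "\<dots> \<le> 2 * inner (?y - ?x) ?x + (norm (?y - ?x))\<^sup>2" by simp
        also have "\<dots> = (norm ?y)\<^sup>2 - (norm ?x)\<^sup>2"
          by (simp add: power2_norm_eq_inner inner_diff_left inner_diff_right inner_commute)
        also have "\<dots> = zero_ext T q (t + h) - zero_ext T q t"
          using t by (simp add: zero_ext_def q_def)
        finally have "\<psi> t * (2 * (dual_prim T g (t + h) (w t) - dual_prim T g t (w t)))
            \<le> \<psi> t * (zero_ext T q (t + h) - zero_ext T q t)"
          by (intro mult_left_mono psi(2))
        then show ?thesis by (simp add: mult.left_commute)
      qed (simp add: ab(4))
    qed
  qed
  have Rint: "integrable ?M (\<lambda>t. 2 * (\<psi> t * dual_quot T g h t (w t)))" for h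
    by (intro integrable_mult_right dual_quot_integrable[OF g w meas B])
  have Lint: "integrable ?M (\<lambda>t. \<psi> t * ((zero_ext T q (t + h) - zero_ext T q t) / h))" for h
    by (rule test_function_diffquot_integrable[OF T psi(1) q])
  have Rpull: "?R h = (\<integral>t. 2 * (\<psi> t * dual_quot T g h t (w t)) \<partial>?M)" for h
    by simp
  have pos: "?R h \<le> ?L h" if h: "\<bar>h\<bar> < min a (T - b)" "h > 0" for h
    unfolding Rpull
  proof (rule integral_mono_AE[OF Rint Lint])
    show "AE t in ?M. 2 * (\<psi> t * dual_quot T g h t (w t)) \<le> \<psi> t * ((zero_ext T q (t + h) - zero_ext T q t) / h)"
      using pointwise[OF h(1)]
    proof eventually_elim
      case (elim t)
      from divide_right_mono[OF elim, of h] h(2) show ?case by (simp add: dual_quot_def)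
    qed
  qed
  have neg: "?L h \<le> ?R h" if h: "\<bar>h\<bar> < min a (T - b)" "h < 0" for h
    unfolding Rpull
  proof (rule integral_mono_AE[OF Lint Rint])
    show "AE t in ?M. \<psi> t * ((zero_ext T q (t + h) - zero_ext T q t) / h) \<le> 2 * (\<psi> t * dual_quot T g h t (w t))"
      using pointwise[OF h(1)]
    proof eventually_elim
      case (elim t)
      from divide_right_mono_neg[OF elim, of h] h(2) show ?case by (simp add: dual_quot_def)
    qed
  qed
  have L: "(?L \<longlongrightarrow> - (\<integral>t. deriv \<psi> t * q t \<partial>?M)) (at 0)"
    by (rule test_function_diffquot[OF T psi(1) q])
  have R: "(?R \<longlongrightarrow> 2 * (\<integral>t. \<psi> t * blinfun_apply (g t) (w t) \<partial>?M)) (at 0)"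
    by (intro tendsto_mult tendsto_const dual_quot_weak_convergence[OF T g w meas B])
  have m: "0 < min a (T - b)" using ab by simp
  have "\<forall>\<^sub>F h in at_right 0. h \<in> {0<..<min a (T - b)}" by (rule eventually_at_right_real[OF m])
  then have "\<forall>\<^sub>F h in at_right 0. ?R h \<le> ?L h"
    by eventually_elim (rule pos; simp)
  then have 1: "2 * (\<integral>t. \<psi> t * blinfun_apply (g t) (w t) \<partial>?M) \<le> - (\<integral>t. deriv \<psi> t * q t \<partial>?M)"
    by (rule tendsto_le[OF _ filterlim_mono[OF L order_refl at_le[OF subset_UNIV]]
          filterlim_mono[OF R order_refl at_le[OF subset_UNIV]], rotated]) simp
  have "\<forall>\<^sub>F h in at_left 0. h \<in> {- min a (T - b)<..<0}"
    by (rule eventually_at_left_real) (use m in simp)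
  then have "\<forall>\<^sub>F h in at_left 0. ?L h \<le> ?R h"
    by eventually_elim (rule neg; simp only: greaterThanLessThan_iff; linarith)
  then have 2: "- (\<integral>t. deriv \<psi> t * q t \<partial>?M) \<le> 2 * (\<integral>t. \<psi> t * blinfun_apply (g t) (w t) \<partial>?M)"
    by (rule tendsto_le[OF _ filterlim_mono[OF R order_refl at_le[OF subset_UNIV]]
          filterlim_mono[OF L order_refl at_le[OF subset_UNIV]], rotated]) simp
  show ?thesis using 1 2 unfolding q_def by (rule antisym[rotated])
qed

text \<open>
  A test function is the difference of two nonnegative ones, because it is dominated by a multiple
  of a bump that is positive on its support.
\<close>

lemma weak_energy_identity:
  fixes j :: "'v::real_inner \<Rightarrow> 'h::real_inner"
  assumes j: "bounded_linear j" and T: "T > 0" and w: "w \<in> bochner_L2 T" and g: "g \<in> bochner_L2 T"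
    and wd: "is_weak_derivative T (in_dual j w) g"
    and psi: "is_test_function T \<psi>"
  shows "(\<integral>t. deriv \<psi> t * (norm (j (w t)))\<^sup>2 \<partial>time_measure T)
    = - (\<integral>t. \<psi> t * (2 * blinfun_apply (g t) (w t)) \<partial>time_measure T)"
proof -
  let ?M = "time_measure T"
  let ?q = "\<lambda>t. (norm (j (w t)))\<^sup>2" and ?p = "\<lambda>t. blinfun_apply (g t) (w t)"
  have q: "integrable ?M ?q" by (rule L2_norm_integrable[OF L2_bounded_linear[OF w j]])
  have p: "integrable ?M ?p" by (rule L2_blinfun_integrable[OF g w])
  obtain a b where ab: "0 < a" "a < b" "b < T" "\<And>x. x \<notin> {a..b} \<Longrightarrow> \<psi> x = 0"
    by (rule test_function_support[OF psi T]) (rule that)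
  obtain B where B: "\<And>x. \<bar>\<psi> x\<bar> \<le> B" by (rule test_function_bounded[OF psi T]) (rule that)
  define \<beta> where "\<beta> = bump (a / 2) ((b + T) / 2) 1"
  have beta: "is_test_function T \<beta>" unfolding \<beta>_def using ab by (intro bump_test_function) auto
  have "\<exists>x\<in>{a..b}. \<forall>y\<in>{a..b}. \<beta> x \<le> \<beta> y"
    using ab by (intro continuous_attains_inf smooth_continuous test_function_smooth[OF beta]) auto
  then obtain x where x: "x \<in> {a..b}" "\<And>y. y \<in> {a..b} \<Longrightarrow> \<beta> x \<le> \<beta> y" by blast
  have bx: "0 < \<beta> x" unfolding \<beta>_def using ab x(1) by (intro bump_pos) auto
  define K where "K = B / \<beta> x"
  have K0: "0 \<le> K" unfolding K_def using B[of 0] bx by (intro divide_nonneg_pos) auto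
  have b0: "0 \<le> \<beta> t" for t unfolding \<beta>_def by (rule bump_bounds)
  define \<eta> where "\<eta> t = 1 * \<psi> t + K * \<beta> t" for t
  have eta: "is_test_function T \<eta>" unfolding \<eta>_def by (rule test_function_lincomb[OF psi beta T])
  have eta0: "0 \<le> \<eta> t" for t
  proof (cases "t \<in> {a..b}")
    case True
    have "B = K * \<beta> x" using bx by (simp add: K_def)
    also have "\<dots> \<le> K * \<beta> t" using K0 x(2)[OF True] by (intro mult_left_mono)
    finally show ?thesis using B[of t] by (simp add: \<eta>_def)
  qed (use K0 b0 in \<open>simp add: \<eta>_def ab(4)\<close>)
  have d: "deriv \<eta> t = deriv \<psi> t + K * deriv \<beta> t" for t
  proof (rule DERIV_imp_deriv)
    show "(\<eta> has_field_derivative deriv \<psi> t + K * deriv \<beta> t) (at t)"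
      unfolding \<eta>_def
      using DERIV_add[OF smooth_has_derivative[OF test_function_smooth[OF psi], of t]
          DERIV_cmult[OF smooth_has_derivative[OF test_function_smooth[OF beta], of t], of K]]
      by simp
  qed
  note E = weak_energy_identity_nonneg[OF j T w g wd]
  note di = test_function_mult_integrable[OF test_function_deriv[OF psi T] T q]
    test_function_mult_integrable[OF test_function_deriv[OF beta T] T q]
  note ii = test_function_mult_integrable[OF psi T p] test_function_mult_integrable[OF beta T p]
  have "(\<integral>t. deriv \<eta> t * ?q t \<partial>?M) = (\<integral>t. deriv \<psi> t * ?q t + K * (deriv \<beta> t * ?q t) \<partial>?M)"
    by (simp add: d distrib_right mult.assoc)
  also have "\<dots> = (\<integral>t. deriv \<psi> t * ?q t \<partial>?M) + K * (\<integral>t. deriv \<beta> t * ?q t \<partial>?M)"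
    using di by simp
  finally have 1: "(\<integral>t. deriv \<eta> t * ?q t \<partial>?M)
      = (\<integral>t. deriv \<psi> t * ?q t \<partial>?M) + K * (\<integral>t. deriv \<beta> t * ?q t \<partial>?M)" .
  have "(\<integral>t. \<eta> t * ?p t \<partial>?M) = (\<integral>t. \<psi> t * ?p t + K * (\<beta> t * ?p t) \<partial>?M)"
    by (simp add: \<eta>_def distrib_right mult.assoc)
  also have "\<dots> = (\<integral>t. \<psi> t * ?p t \<partial>?M) + K * (\<integral>t. \<beta> t * ?p t \<partial>?M)"
    using ii by simp
  finally have 2: "(\<integral>t. \<eta> t * ?p t \<partial>?M) = (\<integral>t. \<psi> t * ?p t \<partial>?M) + K * (\<integral>t. \<beta> t * ?p t \<partial>?M)" .
  have 3: "K * - (\<integral>t. deriv \<beta> t * ?q t \<partial>?M) = K * (2 * (\<integral>t. \<beta> t * ?p t \<partial>?M))"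
    by (rule arg_cong[OF E[OF beta b0]])
  have "(\<integral>t. \<psi> t * (2 * ?p t) \<partial>?M) = 2 * (\<integral>t. \<psi> t * ?p t \<partial>?M)"
    by (simp add: mult.left_commute[of _ 2])
  then show ?thesis
    using E[OF eta eta0] 1 2 3 by (simp add: algebra_simps)
qed

lemma energy_identity_AE:
  fixes j :: "'v::real_inner \<Rightarrow> 'h::real_inner"
  assumes j: "bounded_linear j" and T: "T > 0" and w: "w \<in> bochner_L2 T" and g: "g \<in> bochner_L2 T"
    and wd: "is_weak_derivative T (in_dual j w) g"
  obtains c where
    "AE t in time_measure T. (norm (j (w t)))\<^sup>2 = c + prim T (\<lambda>r. 2 * blinfun_apply (g r) (w r)) t"
  using weak_energy_identity[OF j T w g wd]
  by (rule du_Bois_Reymond[OF T L2_norm_integrable[OF L2_bounded_linear[OF w j]]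
        integrable_mult_right[OF L2_blinfun_integrable[OF g w]]]) (assumption, rule that)

section \<open>The continuous representative\<close>

lemma AE_dense:
  assumes T: "T > 0" and ae: "AE t in time_measure T. P t"
  shows "closure {t \<in> {0<..<T}. P t} = {0..T}"
proof
  show "closure {t \<in> {0<..<T}. P t} \<subseteq> {0..T}"
    by (intro closure_minimal) auto
  let ?G = "{t \<in> {0<..<T}. P t}"
  have "AE t in lebesgue. t \<in> {0<..<T} \<longrightarrow> P t" using ae by (simp add: AE_restrict_space_iff)
  then have N: "negligible {t. \<not> (t \<in> {0<..<T} \<longrightarrow> P t)}"
    by (simp add: completion.AE_iff_null_sets negligible_iff_null_sets)
  have "open ({0<..<T} - closure ?G)" by (intro open_Diff) auto
  moreover have "negligible ({0<..<T} - closure ?G)"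
    by (rule negligible_subset[OF N]) (use closure_subset[of ?G] in auto)
  ultimately have "{0<..<T} - closure ?G = {}" using open_not_negligible by blast
  then have "{0<..<T} \<subseteq> closure ?G" by blast
  then have "closure {0<..<T} \<subseteq> closure ?G" by (rule closure_minimal) simp
  then show "{0..T} \<subseteq> closure ?G" using T by simp
qed

lemma continuous_AE_unique:
  fixes u u' :: "real \<Rightarrow> 'h::real_normed_vector"
  assumes T: "T > 0" and u: "continuous_on {0..T} u" "continuous_on {0..T} u'"
    and ae: "AE t in time_measure T. u t = u' t" and t: "t \<in> {0..T}"
  shows "u t = u' t"
proof -
  have "closed {x \<in> {0..T}. u x - u' x = 0}"
    by (intro continuous_closed_preimage_constant continuous_intros u)
  moreover have "{t \<in> {0<..<T}. u t = u' t} \<subseteq> {x \<in> {0..T}. u x - u' x = 0}" by auto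
  ultimately have "closure {t \<in> {0<..<T}. u t = u' t} \<subseteq> {x \<in> {0..T}. u x - u' x = 0}"
    by (rule closure_minimal[rotated])
  then show ?thesis using t unfolding AE_dense[OF T ae] by auto
qed

text \<open>
  On \<open>(a, b]\<close>, some value of \<open>f\<close> outside the null set exceeds the mean by at most one.  The length of
  the interval is written as an increment of the primitive of the constant \<open>1\<close>.
\<close>

lemma mean_value_choice:
  assumes T: "T > 0" and f: "integrable (time_measure T) f" and G: "AE t in time_measure T. t \<in> G"
    and ab: "0 < a" "a < b" "b < T"
  shows "\<exists>s\<in>G. a < s \<and> s \<le> b \<and> f s * (prim T (\<lambda>r. 1) b - prim T (\<lambda>r. 1) a)
      \<le> prim T f b - prim T f a + (prim T (\<lambda>r. 1) b - prim T (\<lambda>r. 1) a)"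
proof (rule ccontr)
  let ?M = "time_measure T"
  let ?O = "prim T (\<lambda>r. 1) b - prim T (\<lambda>r. 1) a"
  let ?F = "prim T f b - prim T f a"
  have one: "integrable ?M (\<lambda>r. 1::real)"
    by (rule finite_measure.integrable_const[OF finite_time_measure])
  have "prim T (\<lambda>r. 1) a < prim T (\<lambda>r. 1) b"
  proof (rule DERIV_pos_imp_increasing[OF ab(2)])
    fix x assume "a \<le> x" "x \<le> b"
    then have "(prim T (\<lambda>r. 1) has_real_derivative 1) (at x)"
      using ab by (intro prim_has_derivative) auto
    then show "\<exists>y. (prim T (\<lambda>r. 1) has_real_derivative y) (at x) \<and> 0 < y" by (intro exI[of _ 1]) simp
  qed
  then have O: "0 < ?O" by simp
  assume "\<not> (\<exists>s\<in>G. a < s \<and> s \<le> b \<and> f s * ?O \<le> ?F + ?O)"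
  then have no: "?F + ?O < f s * ?O" if "s \<in> G" "a < s" "s \<le> b" for s
    using that by (meson not_le)
  have fO: "integrable ?M (\<lambda>r. indicat_real {a<..b} r * f r)" "integrable ?M (\<lambda>r. indicat_real {a<..b} r * 1)"
    by (intro integrable_indicator_mult f one; simp)+
  have "(\<integral>r. (?F + ?O) * (indicat_real {a<..b} r * 1) \<partial>?M) \<le> (\<integral>r. (indicat_real {a<..b} r * f r) * ?O \<partial>?M)"
  proof (rule integral_mono_AE)
    show "AE r in ?M. (?F + ?O) * (indicat_real {a<..b} r * 1) \<le> (indicat_real {a<..b} r * f r) * ?O"
      using G
    proof eventually_elim
      case (elim r)
      then show ?case using no[of r] by (cases "r \<in> {a<..b}") (auto simp: indicator_def)
    qed
  qed (intro integrable_mult_right integrable_mult_left fO)+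
  also have "\<dots> = ?F * ?O" using prim_diff[OF f, of a b] ab by simp
  finally have "(?F + ?O) * ?O \<le> ?F * ?O" using prim_diff[OF one, of a b] ab by simp
  then have "?O * ?O \<le> 0" by (simp add: distrib_right)
  then show False using mult_pos_pos[OF O O] by linarith
qed

text \<open>
  Of \<open>w\<close> only a bound in \<open>L\<^sub>2\<close> is available, and \<open>\<parallel>w t\<parallel>\<close> may be large.  Two times \<open>t\<close> and \<open>t'\<close> are
  therefore compared through an intermediate \<open>s\<close> at which \<open>\<parallel>w s\<parallel>\<^sup>2\<close> does not exceed its mean by more
  than one: in \<open>\<parallel>j (w t) - j (w s)\<parallel>\<^sup>2\<close> the energy identity and the identity for increments, tested
  with \<open>w s\<close>, leave only integrals over the interval.
\<close>

lemma continuous_representative: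
  fixes j :: "'v::real_inner \<Rightarrow> 'h::{real_inner, complete_space}"
  assumes j: "bounded_linear j" and T: "T > 0" and w: "w \<in> bochner_L2 T" and g: "g \<in> bochner_L2 T"
    and wd: "is_weak_derivative T (in_dual j w) g"
  obtains u where "continuous_on {0..T} u" "AE t in time_measure T. u t = j (w t)"
    "(norm (u T))\<^sup>2 - (norm (u 0))\<^sup>2 = 2 * (\<integral>t. blinfun_apply (g t) (w t) \<partial>time_measure T)"
proof -
  let ?M = "time_measure T"
  let ?p = "\<lambda>r. 2 * blinfun_apply (g r) (w r)"
  have p: "integrable ?M ?p" by (intro integrable_mult_right L2_blinfun_integrable g w)
  define one :: "real \<Rightarrow> real" where "one = (\<lambda>r. 1)"
  have one: "integrable ?M one"
    unfolding one_def by (rule finite_measure.integrable_const[OF finite_time_measure])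
  obtain G where G: "G \<subseteq> {0<..<T}" "AE t in ?M. t \<in> G"
    and inc: "\<And>r s t. r \<in> G \<Longrightarrow> s \<in> G \<Longrightarrow> t \<in> G \<Longrightarrow>
      inner (j (w t) - j (w s)) (j (w r)) = dual_prim T g t (w r) - dual_prim T g s (w r)"
    by (rule in_dual_increments[OF j T w g wd]) (rule that)
  obtain c where c: "AE t in ?M. (norm (j (w t)))\<^sup>2 = c + prim T ?p t"
    by (rule energy_identity_AE[OF j T w g wd]) (rule that)
  define H where "H = {t \<in> {0<..<T}. t \<in> G \<and> (norm (j (w t)))\<^sup>2 = c + prim T ?p t}"
  have HG: "t \<in> G" "t \<in> {0<..<T}" "(norm (j (w t)))\<^sup>2 = c + prim T ?p t" if "t \<in> H" for t
    using that by (auto simp: H_def)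
  have aeP: "AE t in ?M. t \<in> G \<and> (norm (j (w t)))\<^sup>2 = c + prim T ?p t"
    using G(2) c by eventually_elim simp
  have aeH: "AE t in ?M. t \<in> H"
    using aeP AE_space by eventually_elim (simp add: H_def)
  have clH: "closure H = {0..T}" unfolding H_def by (rule AE_dense[OF T aeP])
  let ?g2 = "\<lambda>r. (norm (g r))\<^sup>2" and ?w2 = "\<lambda>r. (norm (w r))\<^sup>2"
  note g2 = L2_norm_integrable[OF g] and w2 = L2_norm_integrable[OF w]
  define N where "N t = 2 * prim T ?g2 t + 2 * prim T ?w2 t + prim T one t" for t
  have Ncont: "continuous_on {0..T} N"
    unfolding N_def by (intro continuous_intros prim_continuous g2 w2 one)
  have mono: "prim T ?g2 x \<le> prim T ?g2 y" "prim T ?w2 x \<le> prim T ?w2 y" "prim T one x \<le> prim T one y"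
    if "x \<le> y" for x y
    by (intro prim_mono g2 w2 one that; simp add: one_def)+
  have near: "(norm (j (w t) - j (w s)))\<^sup>2 \<le> 2 * (prim T ?g2 b - prim T ?g2 a) + (prim T ?w2 b - prim T ?w2 a)
      + (norm (w s))\<^sup>2 * (prim T one b - prim T one a)"
    if st: "s \<in> H" "t \<in> H" "a \<le> s" "s \<le> b" "a \<le> t" "t \<le> b" for s t a b
  proof -
    have le: "\<bar>prim T f t - prim T f s\<bar> \<le> prim T h b - prim T h a"
      if "integrable ?M f" "integrable ?M h" "\<And>r. \<bar>f r\<bar> \<le> h r" for f h
    proof -
      have h0: "0 \<le> h r" for r using that(3)[of r] by linarith
      have m: "prim T h a \<le> prim T h (min s t)" "prim T h (max s t) \<le> prim T h b"
        using st by (intro prim_mono that(2) h0; simp)+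
      have "\<bar>prim T f (max s t) - prim T f (min s t)\<bar> \<le> prim T h (max s t) - prim T h (min s t)"
        by (intro prim_diff_bound that) simp
      moreover have "\<bar>prim T f (max s t) - prim T f (min s t)\<bar> = \<bar>prim T f t - prim T f s\<bar>"
        by (cases "s \<le> t") (auto simp: max_def min_def abs_minus_commute)
      ultimately show ?thesis using m by linarith
    qed
    have "(norm (j (w t) - j (w s)))\<^sup>2
        = (norm (j (w t)))\<^sup>2 - (norm (j (w s)))\<^sup>2 - 2 * inner (j (w t) - j (w s)) (j (w s))"
      by (simp add: power2_norm_eq_inner inner_diff_left inner_diff_right inner_commute)
    also have "\<dots> = (prim T ?p t - prim T ?p s)
        - 2 * (prim T (\<lambda>r. blinfun_apply (g r) (w s)) t - prim T (\<lambda>r. blinfun_apply (g r) (w s)) s)"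
      using inc[of s s t] HG[OF st(1)] HG[OF st(2)] by (simp add: dual_prim_def)
    also have "\<dots> \<le> \<bar>prim T ?p t - prim T ?p s\<bar>
        + 2 * \<bar>prim T (\<lambda>r. blinfun_apply (g r) (w s)) t - prim T (\<lambda>r. blinfun_apply (g r) (w s)) s\<bar>"
    proof -
      have "x - 2 * y \<le> \<bar>x\<bar> + 2 * \<bar>y\<bar>" for x y :: real by linarith
      then show ?thesis .
    qed
    also have "\<bar>prim T ?p t - prim T ?p s\<bar> \<le> (prim T ?g2 b - prim T ?g2 a) + (prim T ?w2 b - prim T ?w2 a)"
    proof -
      have "\<bar>?p r\<bar> \<le> 1 * ?g2 r + 1 * ?w2 r" for r
        using norm_blinfun[of "g r" "w r"] sum_squares_bound[of "norm (g r)" "norm (w r)"]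
        by (simp add: abs_mult)
      then have "\<bar>prim T ?p t - prim T ?p s\<bar>
          \<le> prim T (\<lambda>r. 1 * ?g2 r + 1 * ?w2 r) b - prim T (\<lambda>r. 1 * ?g2 r + 1 * ?w2 r) a"
        using g2 w2 by (intro le p) auto
      then show ?thesis unfolding prim_lincomb[OF g2 w2] by simp
    qed
    also have "2 * \<bar>prim T (\<lambda>r. blinfun_apply (g r) (w s)) t - prim T (\<lambda>r. blinfun_apply (g r) (w s)) s\<bar>
        \<le> (prim T ?g2 b - prim T ?g2 a) + (norm (w s))\<^sup>2 * (prim T one b - prim T one a)"
    proof -
      have "\<bar>blinfun_apply (g r) (w s)\<bar> \<le> 1 / 2 * ?g2 r + (norm (w s))\<^sup>2 / 2 * one r" for r
        using norm_blinfun[of "g r" "w s"] sum_squares_bound[of "norm (g r)" "norm (w s)"]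
        by (simp add: one_def)
      then have "\<bar>prim T (\<lambda>r. blinfun_apply (g r) (w s)) t - prim T (\<lambda>r. blinfun_apply (g r) (w s)) s\<bar>
          \<le> prim T (\<lambda>r. 1 / 2 * ?g2 r + (norm (w s))\<^sup>2 / 2 * one r) b
            - prim T (\<lambda>r. 1 / 2 * ?g2 r + (norm (w s))\<^sup>2 / 2 * one r) a"
        using g2 one
        by (intro le L2_apply_integrable g Bochner_Integration.integrable_add integrable_mult_right)
      then show ?thesis unfolding prim_lincomb[OF g2 one] by (simp add: algebra_simps)
    qed
    finally show ?thesis by simp
  qed
  have modulus: "(norm (j (w b) - j (w a)))\<^sup>2 \<le> 4 * (N b - N a)" if ab: "a \<in> H" "b \<in> H" "a < b" for a b
  proof -
    have int: "0 < a" "b < T" using HG(2)[OF ab(1)] HG(2)[OF ab(2)] by auto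
    obtain s where s: "s \<in> H" "a < s" "s \<le> b"
      and sw: "(norm (w s))\<^sup>2 * (prim T one b - prim T one a)
        \<le> prim T ?w2 b - prim T ?w2 a + (prim T one b - prim T one a)"
      using mean_value_choice[OF T w2 aeH int(1) ab(3) int(2)] unfolding one_def by blast
    have e: "(norm (j (w t) - j (w s)))\<^sup>2 \<le> N b - N a" if "t \<in> H" "a \<le> t" "t \<le> b" for t
      using near[of s t a b] s sw that unfolding N_def by simp
    have "norm (j (w b) - j (w a)) \<le> norm (j (w b) - j (w s)) + norm (j (w a) - j (w s))"
      by (metis diff_add_cancel diff_diff_eq2 norm_minus_commute norm_triangle_ineq add_diff_eq)
    then have "(norm (j (w b) - j (w a)))\<^sup>2 \<le> (norm (j (w b) - j (w s)) + norm (j (w a) - j (w s)))\<^sup>2"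
      by (intro power_mono) auto
    also have "\<dots> \<le> 2 * (norm (j (w b) - j (w s)))\<^sup>2 + 2 * (norm (j (w a) - j (w s)))\<^sup>2"
      using sum_squares_bound[of "norm (j (w b) - j (w s))" "norm (j (w a) - j (w s))"]
      by (simp add: power2_sum)
    also have "\<dots> \<le> 2 * (N b - N a) + 2 * (N b - N a)"
      using e[OF ab(2)] e[OF ab(1)] ab(3) by simp
    finally show ?thesis by simp
  qed
  have "uniformly_continuous_on H (\<lambda>t. j (w t))"
    unfolding uniformly_continuous_on_def
  proof (intro allI impI)
    fix e :: real assume e: "0 < e"
    have "uniformly_continuous_on {0..T} N" by (rule compact_uniformly_continuous[OF Ncont]) simp
    then obtain d where d: "d > 0" "\<And>x y. x \<in> {0..T} \<Longrightarrow> y \<in> {0..T} \<Longrightarrow> dist y x < d \<Longrightarrow> dist (N y) (N x) < e\<^sup>2 / 4"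
      unfolding uniformly_continuous_on_def using e by (metis zero_less_divide_iff zero_less_numeral zero_less_power)
    have close: "norm (j (w b) - j (w a)) < e" if ab: "a \<in> H" "b \<in> H" "dist b a < d" "a < b" for a b
    proof -
      have "dist (N b) (N a) < e\<^sup>2 / 4"
        by (intro d) (use HG(2)[OF ab(1)] HG(2)[OF ab(2)] ab(3) in auto)
      from le_less_trans[OF abs_ge_self this[unfolded dist_real_def]]
      have "4 * (N b - N a) < e\<^sup>2" by simp
      with modulus[OF ab(1,2,4)] have "(norm (j (w b) - j (w a)))\<^sup>2 < e\<^sup>2" by linarith
      then show ?thesis using e by (intro power_less_imp_less_base[of _ 2 e]) auto
    qed
    show "\<exists>d>0. \<forall>x\<in>H. \<forall>x'\<in>H. dist x' x < d \<longrightarrow> dist (j (w x')) (j (w x)) < e"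
    proof (intro exI conjI ballI impI)
      fix x x' assume x: "x \<in> H" "x' \<in> H" "dist x' x < d"
      show "dist (j (w x')) (j (w x)) < e"
      proof (cases x x' rule: linorder_cases)
        case less
        then show ?thesis using close[OF x(1,2,3)]
          by (simp add: dist_norm)
      next
        case greater
        then show ?thesis
          using close[OF x(2,1)] x(3)
          by (simp add: dist_norm norm_minus_commute dist_commute)
      qed (use e in simp)
    qed (rule d(1))
  qed
  then obtain u where u: "uniformly_continuous_on (closure H) u" "\<And>x. x \<in> H \<Longrightarrow> j (w x) = u x"
    by (rule uniformly_continuous_on_extension_on_closure) (rule that)
  have uc: "continuous_on {0..T} u"
    using uniformly_continuous_imp_continuous[OF u(1)] unfolding clH .
  have uae: "AE t in ?M. u t = j (w t)"
    using aeH by eventually_elim (simp add: u(2))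
  have "closed {x \<in> {0..T}. (norm (u x))\<^sup>2 - prim T ?p x = c}"
    by (intro continuous_closed_preimage_constant continuous_intros uc prim_continuous p)
  moreover have "H \<subseteq> {x \<in> {0..T}. (norm (u x))\<^sup>2 - prim T ?p x = c}"
  proof
    fix x assume x: "x \<in> H"
    then show "x \<in> {x \<in> {0..T}. (norm (u x))\<^sup>2 - prim T ?p x = c}"
      using HG(2,3)[OF x] u(2)[OF x] by simp
  qed
  ultimately have "closure H \<subseteq> {x \<in> {0..T}. (norm (u x))\<^sup>2 - prim T ?p x = c}"
    by (rule closure_minimal[rotated])
  then have "(norm (u x))\<^sup>2 - prim T ?p x = c" if "x \<in> {0..T}" for x using that unfolding clH by auto
  from this[of T] this[of 0] T have "(norm (u T))\<^sup>2 - (norm (u 0))\<^sup>2 = prim T ?p T - prim T ?p 0" by simp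
  also have "\<dots> = 2 * (\<integral>t. blinfun_apply (g t) (w t) \<partial>?M)"
    using prim_ge_T[of T T ?p] prim_le_0[of 0 T ?p] by simp
  finally show ?thesis using uc uae by (intro that[of u])
qed

section \<open>Linearity of the time derivative and of the traces\<close>

lemma trace_at_eq:
  assumes T: "T > 0" and u: "continuous_on {0..T} u" "AE s in time_measure T. u s = j (w s)" and t: "t \<in> {0..T}"
  shows "trace_at j T t w = u t"
proof -
  define u' where "u' = (SOME u. continuous_on {0..T} u \<and> (AE s in time_measure T. u s = j (w s)))"
  have u': "continuous_on {0..T} u' \<and> (AE s in time_measure T. u' s = j (w s))"
    unfolding u'_def by (rule someI[of _ u]) (use u in simp)
  have "AE s in time_measure T. u' s = u s" using conjunct2[OF u'] u(2) by eventually_elim simp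
  from continuous_AE_unique[OF T conjunct1[OF u'] u(1) this t] show ?thesis
    by (simp add: trace_at_def u'_def)
qed

lemma has_strong_integral_diff:
  fixes f g :: "real \<Rightarrow> 'b::real_normed_vector"
  assumes f: "has_strong_integral (time_measure T) f x" and g: "has_strong_integral (time_measure T) g y"
  shows "has_strong_integral (time_measure T) (\<lambda>t. f t - g t) (x - y)"
proof -
  let ?M = "time_measure T"
  obtain s where fm: "strongly_measurable ?M f" and s: "\<And>n. Bochner_Integration.simple_bochner_integrable ?M (s n)"
      "(\<lambda>n. \<integral>\<^sup>+ t. ennreal (norm (f t - s n t)) \<partial>?M) \<longlonglongrightarrow> 0"
      "(\<lambda>n. Bochner_Integration.simple_bochner_integral ?M (s n)) \<longlonglongrightarrow> x"
    using f unfolding has_strong_integral_def by blast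
  obtain r where gm: "strongly_measurable ?M g" and r: "\<And>n. Bochner_Integration.simple_bochner_integrable ?M (r n)"
      "(\<lambda>n. \<integral>\<^sup>+ t. ennreal (norm (g t - r n t)) \<partial>?M) \<longlonglongrightarrow> 0"
      "(\<lambda>n. Bochner_Integration.simple_bochner_integral ?M (r n)) \<longlonglongrightarrow> y"
    using g unfolding has_strong_integral_def by blast
  have nm: "(\<lambda>t. ennreal (norm (h t - q t))) \<in> borel_measurable ?M"
    if "strongly_measurable ?M h" "Bochner_Integration.simple_bochner_integrable ?M q" for h q :: "real \<Rightarrow> 'b"
  proof -
    have q: "simple_function ?M q" using that(2) by (rule simple_bochner_integrable.cases)
    have "(\<lambda>t. norm (h t - q t)) \<in> borel_measurable ?M"
      by (rule strongly_measurable_real[OF strongly_measurable_compose2[OF that(1) strongly_measurable_simple[OF q], of "\<lambda>x y. norm (x - y)"]])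
         (auto intro!: continuous_intros)
    then show ?thesis by measurable
  qed
  have "(\<lambda>n. \<integral>\<^sup>+ t. ennreal (norm ((f t - g t) - (s n t - r n t))) \<partial>?M) \<longlonglongrightarrow> 0"
  proof (rule tendsto_sandwich[OF _ _ tendsto_const])
    show "(\<lambda>n. (\<integral>\<^sup>+ t. ennreal (norm (f t - s n t)) \<partial>?M) + (\<integral>\<^sup>+ t. ennreal (norm (g t - r n t)) \<partial>?M)) \<longlonglongrightarrow> 0"
      using tendsto_add[OF s(2) r(2)] by simp
    have "(\<integral>\<^sup>+ t. ennreal (norm ((f t - g t) - (s n t - r n t))) \<partial>?M)
        \<le> (\<integral>\<^sup>+ t. ennreal (norm (f t - s n t)) + ennreal (norm (g t - r n t)) \<partial>?M)" for n
    proof (intro nn_integral_mono)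
      fix t
      have eq: "(f t - g t) - (s n t - r n t) = (f t - s n t) - (g t - r n t)" by simp
      have "norm ((f t - g t) - (s n t - r n t)) \<le> norm (f t - s n t) + norm (g t - r n t)"
        unfolding eq by (rule norm_triangle_ineq4)
      then show "ennreal (norm ((f t - g t) - (s n t - r n t))) \<le> ennreal (norm (f t - s n t)) + ennreal (norm (g t - r n t))"
        by (simp flip: ennreal_plus)
    qed
    also have "\<dots> n = (\<integral>\<^sup>+ t. ennreal (norm (f t - s n t)) \<partial>?M) + (\<integral>\<^sup>+ t. ennreal (norm (g t - r n t)) \<partial>?M)" for n
      by (intro nn_integral_add nm fm gm s r)
    finally show "\<forall>\<^sub>F n in sequentially. (\<integral>\<^sup>+ t. ennreal (norm ((f t - g t) - (s n t - r n t))) \<partial>?M)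
        \<le> (\<integral>\<^sup>+ t. ennreal (norm (f t - s n t)) \<partial>?M) + (\<integral>\<^sup>+ t. ennreal (norm (g t - r n t)) \<partial>?M)"
      by (intro always_eventually) auto
  qed auto
  moreover have "Bochner_Integration.simple_bochner_integrable ?M (\<lambda>t. s n t - r n t)" for n
    by (rule simple_bochner_integrable_compose2[OF _ s(1) r(1)]) simp
  moreover have "(\<lambda>n. Bochner_Integration.simple_bochner_integral ?M (\<lambda>t. s n t - r n t)) \<longlonglongrightarrow> x - y"
    unfolding simple_bochner_integral_diff[OF s(1) r(1)] by (intro tendsto_diff s r)
  moreover have "strongly_measurable ?M (\<lambda>t. f t - g t)"
    using strongly_measurable_lincomb[OF fm gm, of 1 "-1"] by simp
  ultimately show ?thesis
    unfolding has_strong_integral_def by (intro conjI exI[of _ "\<lambda>n t. s n t - r n t"]) auto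
qed

lemma is_weak_derivative_diff:
  assumes "is_weak_derivative T f g" "is_weak_derivative T f' g'"
  shows "is_weak_derivative T (f - f') (g - g')"
  unfolding is_weak_derivative_def
proof (intro allI impI)
  fix \<phi> assume phi: "is_test_function T \<phi>"
  obtain y where y: "has_strong_integral (time_measure T) (\<lambda>t. deriv \<phi> t *\<^sub>R f t) y"
      "has_strong_integral (time_measure T) (\<lambda>t. \<phi> t *\<^sub>R g t) (- y)"
    using assms(1) phi unfolding is_weak_derivative_def by blast
  obtain y' where y': "has_strong_integral (time_measure T) (\<lambda>t. deriv \<phi> t *\<^sub>R f' t) y'"
      "has_strong_integral (time_measure T) (\<lambda>t. \<phi> t *\<^sub>R g' t) (- y')"
    using assms(2) phi unfolding is_weak_derivative_def by blast
  show "\<exists>y. has_strong_integral (time_measure T) (\<lambda>t. deriv \<phi> t *\<^sub>R (f - f') t) y \<and>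
      has_strong_integral (time_measure T) (\<lambda>t. \<phi> t *\<^sub>R (g - g') t) (- y)"
    using has_strong_integral_diff[OF y(1) y'(1)] has_strong_integral_diff[OF y(2) y'(2)]
    by (intro exI[of _ "y - y'"]) (simp add: scaleR_diff_right)
qed

lemma X_space_weak_derivative:
  assumes "w \<in> X_space j T"
  shows "w \<in> bochner_L2 T" "weak_derivative T (in_dual j w) \<in> bochner_L2 T"
    "is_weak_derivative T (in_dual j w) (weak_derivative T (in_dual j w))"
proof -
  have "\<exists>g. g \<in> bochner_L2 T \<and> is_weak_derivative T (in_dual j w) g"
    using assms by (auto simp: X_space_def bochner_H1_def)
  from someI_ex[OF this] show "weak_derivative T (in_dual j w) \<in> bochner_L2 T"
    "is_weak_derivative T (in_dual j w) (weak_derivative T (in_dual j w))"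
    by (auto simp: weak_derivative_def)
qed (use assms in \<open>simp add: X_space_def\<close>)

lemma in_dual_diff:
  assumes "bounded_linear j" shows "in_dual j (u - v) = in_dual j u - in_dual j v"
proof -
  interpret bounded_linear j by fact
  show ?thesis
    by (intro ext blinfun_eqI)
       (simp add: in_dual_def fun_diff_def blinfun.diff_left pivot_to_dual_apply[OF assms] diff inner_diff_left)
qed

text \<open>
  Weak derivatives are only chosen up to null sets; this choice disappears in the functional.
\<close>

lemma X_space_diff:
  assumes j: "bounded_linear j" and T: "T > 0" and u: "u \<in> X_space j T" and v: "v \<in> X_space j T"
  shows "u - v \<in> X_space j T" "d_t j T (u - v) = d_t j T u - d_t j T v"
proof -
  note du = X_space_weak_derivative[OF u] and dv = X_space_weak_derivative[OF v]
  let ?g = "weak_derivative T (in_dual j u)" and ?h = "weak_derivative T (in_dual j v)"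
  have gh: "?g - ?h \<in> bochner_L2 T" by (rule L2_diff[OF du(2) dv(2)])
  have wd: "is_weak_derivative T (in_dual j (u - v)) (?g - ?h)"
    unfolding in_dual_diff[OF j] by (rule is_weak_derivative_diff[OF du(3) dv(3)])
  have "in_dual j u \<in> bochner_L2 T" "in_dual j v \<in> bochner_L2 T"
    using u v by (auto simp: X_space_def bochner_H1_def)
  then have "in_dual j (u - v) \<in> bochner_L2 T" unfolding in_dual_diff[OF j] by (rule L2_diff)
  then show X: "u - v \<in> X_space j T"
    using wd gh L2_diff[OF du(1) dv(1)] by (auto simp: X_space_def bochner_H1_def)
  note dw = X_space_weak_derivative[OF X]
  show "d_t j T (u - v) = d_t j T u - d_t j T v"
  proof
    fix \<phi> :: "real \<Rightarrow> 'a"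
    show "d_t j T (u - v) \<phi> = (d_t j T u - d_t j T v) \<phi>"
    proof (cases "\<phi> \<in> bochner_L2 T")
      case True
      have "d_t j T (u - v) \<phi> = (\<integral>t. blinfun_apply ((?g - ?h) t) (\<phi> t) \<partial>time_measure T)"
        using weak_derivative_pairing_unique[OF T dw(3,2) wd gh True] True
        by (simp add: d_t_def L2_functional_def)
      also have "\<dots> = (\<integral>t. blinfun_apply (?g t) (\<phi> t) \<partial>time_measure T) - (\<integral>t. blinfun_apply (?h t) (\<phi> t) \<partial>time_measure T)"
        using L2_blinfun_integrable[OF du(2) True] L2_blinfun_integrable[OF dv(2) True]
        by (simp add: fun_diff_def blinfun.diff_left)
      finally show ?thesis using True by (simp add: d_t_def L2_functional_def fun_diff_def)
    qed (simp add: d_t_def L2_functional_def fun_diff_def)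
  qed
qed

lemma X_space_trace:
  fixes j :: "'v::real_inner \<Rightarrow> 'h::{real_inner, complete_space}"
  assumes j: "bounded_linear j" and T: "T > 0" and w: "w \<in> X_space j T"
  obtains u where "continuous_on {0..T} u" "AE t in time_measure T. u t = j (w t)"
    "\<And>t. t \<in> {0..T} \<Longrightarrow> trace_at j T t w = u t"
  by (rule continuous_representative[OF j T X_space_weak_derivative[OF w]])
     (use that trace_at_eq[OF T] in blast)

lemma trace_at_diff:
  fixes j :: "'v::real_inner \<Rightarrow> 'h::{real_inner, complete_space}"
  assumes j: "bounded_linear j" and T: "T > 0" and v: "v \<in> X_space j T" and w: "w \<in> X_space j T"
    and t: "t \<in> {0..T}"
  shows "trace_at j T t (v - w) = trace_at j T t v - trace_at j T t w"
proof -
  interpret bounded_linear j by fact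
  obtain x where x: "continuous_on {0..T} x" "AE t in time_measure T. x t = j (v t)"
    "\<And>t. t \<in> {0..T} \<Longrightarrow> trace_at j T t v = x t" by (rule X_space_trace[OF j T v]) (rule that)
  obtain y where y: "continuous_on {0..T} y" "AE t in time_measure T. y t = j (w t)"
    "\<And>t. t \<in> {0..T} \<Longrightarrow> trace_at j T t w = y t" by (rule X_space_trace[OF j T w]) (rule that)
  have "trace_at j T t (v - w) = x t - y t"
  proof (rule trace_at_eq[OF T _ _ t])
    show "AE s in time_measure T. x s - y s = j ((v - w) s)"
      using x(2) y(2) by eventually_elim (simp add: fun_diff_def diff)
  qed (intro continuous_on_diff x y)
  then show ?thesis using x(3)[OF t] y(3)[OF t] by simp
qed

lemma energy_identity:
  fixes j :: "'v::real_inner \<Rightarrow> 'h::{real_inner, complete_space}"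
  assumes j: "bounded_linear j" and T: "T > 0" and w: "w \<in> X_space j T"
  shows "(norm (trace_at j T T w))\<^sup>2 - (norm (trace_at j T 0 w))\<^sup>2 = 2 * d_t j T w w"
proof -
  note dw = X_space_weak_derivative[OF w]
  obtain u where u: "continuous_on {0..T} u" "AE t in time_measure T. u t = j (w t)"
    "(norm (u T))\<^sup>2 - (norm (u 0))\<^sup>2 = 2 * (\<integral>t. blinfun_apply (weak_derivative T (in_dual j w) t) (w t) \<partial>time_measure T)"
    by (rule continuous_representative[OF j T dw]) (rule that)
  have "trace_at j T T w = u T" "trace_at j T 0 w = u 0"
    using T by (auto intro!: trace_at_eq[where j=j and w=w, OF T u(1) u(2)])
  then show ?thesis using u(3) dw(1) by (simp add: d_t_def L2_functional_def)
qed

section \<open>The dual of the space of square integrable functions\<close>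

definition L2_inner :: "real \<Rightarrow> (real \<Rightarrow> 'v::real_inner) \<Rightarrow> (real \<Rightarrow> 'v) \<Rightarrow> real" where
  "L2_inner T u v = (\<integral>t. inner (u t) (v t) \<partial>time_measure T)"

lemma L2_inner_lincomb:
  assumes "u \<in> bochner_L2 T" "v \<in> bochner_L2 T" "w \<in> bochner_L2 T"
  shows "L2_inner T (\<lambda>t. a *\<^sub>R u t + b *\<^sub>R v t) w = a * L2_inner T u w + b * L2_inner T v w"
    and "L2_inner T w (\<lambda>t. a *\<^sub>R u t + b *\<^sub>R v t) = a * L2_inner T w u + b * L2_inner T w v"
  using L2_inner_integrable[OF assms(1,3)] L2_inner_integrable[OF assms(2,3)]
    L2_inner_integrable[OF assms(3,1)] L2_inner_integrable[OF assms(3,2)]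
  by (simp_all add: L2_inner_def inner_add_left inner_add_right)

lemma L2_inner_lincomb2:
  assumes u: "u \<in> bochner_L2 T" and v: "v \<in> bochner_L2 T" and x: "x \<in> bochner_L2 T" and y: "y \<in> bochner_L2 T"
  shows "L2_inner T (\<lambda>t. a *\<^sub>R u t + b *\<^sub>R v t) (\<lambda>t. c *\<^sub>R x t + d *\<^sub>R y t)
    = a * (c * L2_inner T u x + d * L2_inner T u y) + b * (c * L2_inner T v x + d * L2_inner T v y)"
  unfolding L2_inner_lincomb(1)[OF u v L2_lincomb[OF x y]]
    L2_inner_lincomb(2)[OF x y u] L2_inner_lincomb(2)[OF x y v] ..

lemma L2_inner_commute: "L2_inner T u v = L2_inner T v u"
  by (simp add: L2_inner_def inner_commute)

lemma L2_inner_self: "L2_inner T u u = (bochner_L2_norm T u)\<^sup>2"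
  by (simp add: L2_inner_def L2_norm_square power2_norm_eq_inner)

lemma L2_Cauchy_Schwarz_square:
  fixes u v :: "real \<Rightarrow> 'v::real_inner"
  assumes u: "u \<in> bochner_L2 T" and v: "v \<in> bochner_L2 T"
  shows "(L2_inner T u v)\<^sup>2 \<le> L2_inner T u u * L2_inner T v v"
proof -
  define x y z where "x = L2_inner T u u" and "y = L2_inner T v v" and "z = L2_inner T u v"
  have q: "0 \<le> a\<^sup>2 * x + 2 * (a * b) * z + b\<^sup>2 * y" for a b
  proof -
    have "0 \<le> L2_inner T (\<lambda>t. a *\<^sub>R u t + b *\<^sub>R v t) (\<lambda>t. a *\<^sub>R u t + b *\<^sub>R v t)"
      by (simp add: L2_inner_self)
    also have "\<dots> = a\<^sup>2 * x + 2 * (a * b) * z + b\<^sup>2 * y"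
      unfolding L2_inner_lincomb2[OF u v u v]
      by (simp add: L2_inner_commute[of T v u] x_def y_def z_def power2_eq_square algebra_simps)
    finally show ?thesis .
  qed
  have x0: "0 \<le> x" and y0: "0 \<le> y" by (simp_all add: x_def y_def L2_inner_self)
  have "z\<^sup>2 \<le> x * y"
  proof (cases "y = 0")
    case False
    have "0 \<le> y\<^sup>2 * x + 2 * (y * - z) * z + (- z)\<^sup>2 * y" by (rule q)
    also have "\<dots> = y * (x * y - z\<^sup>2)" by (simp add: power2_eq_square algebra_simps)
    finally show ?thesis using False y0 by (simp add: zero_le_mult_iff)
  next
    case True
    show ?thesis
    proof (cases "x = 0")
      case False
      have "0 \<le> (- z)\<^sup>2 * x + 2 * (- z * x) * z + x\<^sup>2 * y" by (rule q)
      also have "\<dots> = x * (x * y - z\<^sup>2)" by (simp add: power2_eq_square algebra_simps)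
      finally show ?thesis using False x0 by (simp add: zero_le_mult_iff)
    next
      case x: True
      have "0 \<le> 1\<^sup>2 * x + 2 * (1 * - z) * z + (- z)\<^sup>2 * y" by (rule q)
      then show ?thesis using True x by (simp add: power2_eq_square)
    qed
  qed
  then show ?thesis by (simp add: x_def y_def z_def)
qed

lemma L2_Cauchy_Schwarz:
  fixes u v :: "real \<Rightarrow> 'v::real_inner"
  assumes "u \<in> bochner_L2 T" "v \<in> bochner_L2 T"
  shows "\<bar>L2_inner T u v\<bar> \<le> bochner_L2_norm T u * bochner_L2_norm T v"
  using L2_Cauchy_Schwarz_square[OF assms]
  by - (rule power2_le_imp_le, auto simp: L2_inner_self power_mult_distrib L2_norm_nonneg)

lemma L2_norm_scaleR: "bochner_L2_norm T (\<lambda>t. c *\<^sub>R v t) = \<bar>c\<bar> * bochner_L2_norm T v"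
  by (simp add: bochner_L2_norm_def power_mult_distrib real_sqrt_mult)

lemma L2_dual_bdd_above:
  fixes f :: "(real \<Rightarrow> 'v::real_normed_vector) \<Rightarrow> real"
  assumes f: "f \<in> L2_dual T"
  shows "bdd_above ((\<lambda>v. \<bar>f v\<bar>) ` {v \<in> bochner_L2 T. bochner_L2_norm T v \<le> 1})"
proof -
  obtain C where C: "\<And>v. v \<in> bochner_L2 T \<Longrightarrow> \<bar>f v\<bar> \<le> C * bochner_L2_norm T v"
    using f unfolding L2_dual_def by blast
  show ?thesis
  proof (rule bdd_aboveI2)
    fix v :: "real \<Rightarrow> 'v" assume v: "v \<in> {v \<in> bochner_L2 T. bochner_L2_norm T v \<le> 1}"
    then have "\<bar>f v\<bar> \<le> \<bar>C\<bar> * bochner_L2_norm T v"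
      using C[of v] mult_right_mono[OF abs_ge_self L2_norm_nonneg, of C T v] by auto
    also have "\<dots> \<le> \<bar>C\<bar> * 1" using v by (intro mult_left_mono) auto
    finally show "\<bar>f v\<bar> \<le> \<bar>C\<bar>" by simp
  qed
qed

lemma L2_dual_bounded:
  fixes f :: "(real \<Rightarrow> 'v::real_normed_vector) \<Rightarrow> real"
  assumes f: "f \<in> L2_dual T" and v: "v \<in> bochner_L2 T"
  shows "\<bar>f v\<bar> \<le> L2_dual_norm T f * bochner_L2_norm T v"
proof -
  obtain C where C: "\<And>v. v \<in> bochner_L2 T \<Longrightarrow> \<bar>f v\<bar> \<le> C * bochner_L2_norm T v"
    using f unfolding L2_dual_def by blast
  have sc: "f (\<lambda>t. c *\<^sub>R v t) = c * f v" if "v \<in> bochner_L2 T" for c v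
    using f that unfolding L2_dual_def by blast
  note bdd = L2_dual_bdd_above[OF f]
  show ?thesis
  proof (cases "bochner_L2_norm T v = 0")
    case True
    then show ?thesis using C[OF v] by simp
  next
    case False
    then have pos: "0 < bochner_L2_norm T v" using L2_norm_nonneg[of T v] by simp
    let ?u = "\<lambda>t. (1 / bochner_L2_norm T v) *\<^sub>R v t"
    have "\<bar>f ?u\<bar> \<le> L2_dual_norm T f"
      unfolding L2_dual_norm_def
      by (rule cSUP_upper[OF _ bdd]) (use pos L2_scaleR[OF v] in \<open>simp add: L2_norm_scaleR\<close>)
    then show ?thesis using pos by (simp add: sc[OF v] abs_mult field_simps)
  qed
qed

lemma L2_dual_norm_leI:
  fixes f :: "(real \<Rightarrow> 'v::real_normed_vector) \<Rightarrow> real"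
  assumes "\<And>v. v \<in> bochner_L2 T \<Longrightarrow> \<bar>f v\<bar> \<le> C * bochner_L2_norm T v" "0 \<le> C"
  shows "L2_dual_norm T f \<le> C"
  unfolding L2_dual_norm_def
proof (rule cSUP_least)
  have "(\<lambda>t. 0 :: 'v) \<in> {v \<in> bochner_L2 T. bochner_L2_norm T v \<le> 1}"
    using L2_const[of 0] by (simp add: bochner_L2_norm_def)
  then show "{v \<in> bochner_L2 T. bochner_L2_norm T v \<le> 1} \<noteq> ({} :: (real \<Rightarrow> 'v) set)" by blast
  fix v :: "real \<Rightarrow> 'v" assume v: "v \<in> {v \<in> bochner_L2 T. bochner_L2_norm T v \<le> 1}"
  then have "\<bar>f v\<bar> \<le> C * bochner_L2_norm T v" using assms(1) by blast
  also have "\<dots> \<le> C * 1" using v assms(2) by (intro mult_left_mono) auto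
  finally show "\<bar>f v\<bar> \<le> C" by simp
qed

lemma L2_dual_norm_nonneg:
  fixes f :: "(real \<Rightarrow> 'v::real_normed_vector) \<Rightarrow> real"
  assumes f: "f \<in> L2_dual T" shows "0 \<le> L2_dual_norm T f"
proof -
  have "\<bar>f (\<lambda>t. 0)\<bar> \<le> L2_dual_norm T f"
    unfolding L2_dual_norm_def
    by (rule cSUP_upper[OF _ L2_dual_bdd_above[OF f]]) (use L2_const[of 0] in \<open>simp add: bochner_L2_norm_def\<close>)
  then show ?thesis by linarith
qed

lemma L2_dual_almost_attained:
  fixes f :: "(real \<Rightarrow> 'v::real_normed_vector) \<Rightarrow> real"
  assumes f: "f \<in> L2_dual T" and "c < L2_dual_norm T f"
  obtains v where "v \<in> bochner_L2 T" "bochner_L2_norm T v \<le> 1" "c < f v"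
proof -
  have "(\<lambda>t. 0 :: 'v) \<in> {v \<in> bochner_L2 T. bochner_L2_norm T v \<le> 1}"
    using L2_const[of 0] by (simp add: bochner_L2_norm_def)
  then have "{v \<in> bochner_L2 T. bochner_L2_norm T v \<le> 1} \<noteq> ({} :: (real \<Rightarrow> 'v) set)" by blast
  from less_cSUP_iff[OF this L2_dual_bdd_above[OF f]] assms(2)
  obtain v where v: "v \<in> bochner_L2 T" "bochner_L2_norm T v \<le> 1" "c < \<bar>f v\<bar>"
    unfolding L2_dual_norm_def by auto
  show ?thesis
  proof (cases "0 \<le> f v")
    case True
    then show ?thesis using v that by simp
  next
    case False
    have "f (\<lambda>t. (-1) *\<^sub>R v t) = (-1) * f v"
      using f v(1) unfolding L2_dual_def by blast
    then show ?thesis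
      using False v L2_scaleR[OF v(1), of "-1"] L2_norm_scaleR[of T "-1" v]
      by (intro that[of "\<lambda>t. (-1) *\<^sub>R v t"]) auto
  qed
qed

lemma L2_dual_lincomb:
  assumes f: "f \<in> L2_dual T" and "u \<in> bochner_L2 T" "v \<in> bochner_L2 T"
  shows "f (\<lambda>t. a *\<^sub>R u t + b *\<^sub>R v t) = a * f u + b * f v"
proof -
  have "f (\<lambda>t. a *\<^sub>R u t + b *\<^sub>R v t) = f (\<lambda>t. a *\<^sub>R u t) + f (\<lambda>t. b *\<^sub>R v t)"
    using f L2_scaleR[OF assms(2), of a] L2_scaleR[OF assms(3), of b]
    by (simp add: L2_dual_def)
  also have "\<dots> = a * f u + b * f v" using f assms(2,3) by (simp add: L2_dual_def)
  finally show ?thesis .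
qed

lemma L2_dual_diff:
  fixes f g :: "(real \<Rightarrow> 'v::real_normed_vector) \<Rightarrow> real"
  assumes f: "f \<in> L2_dual T" and g: "g \<in> L2_dual T"
  shows "f - g \<in> L2_dual T"
proof -
  have "\<bar>(f - g) v\<bar> \<le> (L2_dual_norm T f + L2_dual_norm T g) * bochner_L2_norm T v"
    if "v \<in> bochner_L2 T" for v
    using L2_dual_bounded[OF f that] L2_dual_bounded[OF g that]
    by (simp add: fun_diff_def distrib_right)
  then have "\<exists>C. \<forall>v\<in>bochner_L2 T. \<bar>(f - g) v\<bar> \<le> C * bochner_L2_norm T v" by blast
  moreover have "(f - g) (\<lambda>t. v t + w t) = (f - g) v + (f - g) w"
    if "v \<in> bochner_L2 T" "w \<in> bochner_L2 T" for v w
    using f g that by (simp add: L2_dual_def fun_diff_def)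
  moreover have "(f - g) (\<lambda>t. c *\<^sub>R v t) = c * (f - g) v" if "v \<in> bochner_L2 T" for c v
    using f g that by (simp add: L2_dual_def fun_diff_def right_diff_distrib)
  moreover have "(f - g) v = 0" if "v \<notin> bochner_L2 T" for v
    using f g that by (simp add: L2_dual_def fun_diff_def)
  ultimately show ?thesis unfolding L2_dual_def by blast
qed

lemma L2_dual_norm_commute: "L2_dual_norm T (f - g) = L2_dual_norm T (g - f)"
  by (simp add: L2_dual_norm_def fun_diff_def abs_minus_commute)

text \<open>
  An approximate form of the Riesz representation theorem, which holds in every space with an inner
  product: if \<open>e\<close> almost attains the norm of \<open>f\<close>, then perturbing \<open>e\<close> in the direction \<open>v\<close> shows
  that \<open>f v\<close> is close to \<open>\<parallel>f\<parallel> (e, v)\<close>.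
\<close>

lemma L2_approximate_Riesz:
  fixes f :: "(real \<Rightarrow> 'v::real_inner) \<Rightarrow> real"
  assumes f: "f \<in> L2_dual T" and "\<epsilon> > 0"
  obtains R where "R \<in> bochner_L2 T"
    "\<And>v. v \<in> bochner_L2 T \<Longrightarrow> \<bar>f v - L2_inner T R v\<bar> \<le> \<epsilon> * bochner_L2_norm T v"
proof -
  define N where "N = L2_dual_norm T f"
  have N0: "0 \<le> N" unfolding N_def by (rule L2_dual_norm_nonneg[OF f])
  \<comment> \<open>The length \<open>t\<close> of the perturbation and the defect \<open>t \<epsilon> / 2\<close> of \<open>e\<close> are balanced so that both error
    terms, divided by \<open>t\<close>, are at most \<open>\<epsilon> / 2\<close>.\<close>
  define t where "t = \<epsilon> / (N + 1)"
  have t0: "0 < t" unfolding t_def using N0 \<open>\<epsilon> > 0\<close> by simp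
  have Nt: "N * t \<le> \<epsilon>" unfolding t_def using N0 \<open>\<epsilon> > 0\<close> by (simp add: field_simps)
  obtain e where e: "e \<in> bochner_L2 T" "bochner_L2_norm T e \<le> 1" "N - t * \<epsilon> / 2 < f e"
    using t0 \<open>\<epsilon> > 0\<close> by (rule_tac L2_dual_almost_attained[OF f, of "N - t * \<epsilon> / 2"]) (auto simp: N_def)
  let ?R = "\<lambda>r. N *\<^sub>R e r"
  have Rv: "L2_inner T ?R v = N * L2_inner T e v" if "v \<in> bochner_L2 T" for v
    using L2_inner_lincomb(1)[OF e(1,1) that, of N 0] by simp
  have key: "\<tau> * (f v - N * L2_inner T e v) \<le> t * \<epsilon> / 2 + N * \<tau>\<^sup>2 * (bochner_L2_norm T v)\<^sup>2 / 2"
    if v: "v \<in> bochner_L2 T" for v \<tau>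
  proof -
    let ?x = "\<lambda>r. 1 *\<^sub>R e r + \<tau> *\<^sub>R v r"
    have x: "?x \<in> bochner_L2 T" by (rule L2_lincomb[OF e(1) v])
    let ?n = "bochner_L2_norm T ?x"
    have "?n\<^sup>2 = L2_inner T e e + 2 * \<tau> * L2_inner T e v + \<tau>\<^sup>2 * L2_inner T v v"
      using L2_inner_lincomb(1)[OF e(1) v x, of 1 \<tau>] L2_inner_lincomb(2)[OF e(1) v e(1), of 1 \<tau>]
        L2_inner_lincomb(2)[OF e(1) v v, of 1 \<tau>] L2_inner_commute[of T v e]
      unfolding L2_inner_self[symmetric, of T ?x] by (simp add: power2_eq_square algebra_simps)
    also have "\<dots> \<le> 1 + 2 * \<tau> * L2_inner T e v + \<tau>\<^sup>2 * (bochner_L2_norm T v)\<^sup>2"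
      using power_mono[OF e(2) L2_norm_nonneg, of 2] by (simp add: L2_inner_self)
    finally have n2: "?n\<^sup>2 \<le> 1 + 2 * \<tau> * L2_inner T e v + \<tau>\<^sup>2 * (bochner_L2_norm T v)\<^sup>2" .
    have "?n \<le> (1 + ?n\<^sup>2) / 2" using sum_squares_bound[of 1 ?n] by simp
    also have "\<dots> \<le> 1 + \<tau> * L2_inner T e v + \<tau>\<^sup>2 * (bochner_L2_norm T v)\<^sup>2 / 2" using n2 by simp
    finally have n: "?n \<le> 1 + \<tau> * L2_inner T e v + \<tau>\<^sup>2 * (bochner_L2_norm T v)\<^sup>2 / 2" .
    have "f e + \<tau> * f v = f ?x" using L2_dual_lincomb[OF f e(1) v, of 1 \<tau>] by simp
    also have "\<dots> \<le> N * ?n" using L2_dual_bounded[OF f x] by (simp add: N_def)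
    also have "\<dots> \<le> N * (1 + \<tau> * L2_inner T e v + \<tau>\<^sup>2 * (bochner_L2_norm T v)\<^sup>2 / 2)"
      by (rule mult_left_mono[OF n N0])
    finally show ?thesis using e(3) by (simp add: algebra_simps)
  qed
  show ?thesis
  proof (rule that[of ?R])
    show "?R \<in> bochner_L2 T" by (rule L2_scaleR[OF e(1)])
    fix v :: "real \<Rightarrow> 'v" assume v: "v \<in> bochner_L2 T"
    let ?s = "bochner_L2_norm T v" and ?d = "f v - N * L2_inner T e v"
    have "\<bar>?d\<bar> \<le> \<epsilon> * ?s"
    proof (cases "?s = 0")
      case True
      then show ?thesis
        using L2_dual_bounded[OF f v] L2_Cauchy_Schwarz[OF e(1) v] by simp
    next
      case False
      then have s: "0 < ?s" using L2_norm_nonneg[of T v] by simp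
      have bound: "t * \<epsilon> / 2 + N * (t / ?s)\<^sup>2 * ?s\<^sup>2 / 2 \<le> t * \<epsilon>"
      proof -
        have "N * (t / ?s)\<^sup>2 * ?s\<^sup>2 = t * (N * t)" using s by (simp add: power_divide power2_eq_square)
        also have "\<dots> \<le> t * \<epsilon>" using Nt t0 by (intro mult_left_mono) auto
        finally show ?thesis by simp
      qed
      have "(t / ?s) * ?d \<le> t * \<epsilon>" using key[OF v, of "t / ?s"] bound by linarith
      moreover have "- ((t / ?s) * ?d) \<le> t * \<epsilon>" using key[OF v, of "- (t / ?s)"] bound by simp
      ultimately have "\<bar>(t / ?s) * ?d\<bar> \<le> t * \<epsilon>" by (rule abs_leI)
      then have "(t / ?s) * \<bar>?d\<bar> \<le> t * \<epsilon>" using t0 s by (simp add: abs_mult)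
      then show ?thesis using t0 s by (simp add: field_simps)
    qed
    then show "\<bar>f v - L2_inner T ?R v\<bar> \<le> \<epsilon> * ?s" by (simp add: Rv[OF v])
  qed
qed

lemma approximate_representative_norm:
  fixes f :: "(real \<Rightarrow> 'v::real_inner) \<Rightarrow> real"
  assumes f: "f \<in> L2_dual T" and R: "R \<in> bochner_L2 T" and "0 \<le> \<epsilon>"
    and app: "\<And>v. v \<in> bochner_L2 T \<Longrightarrow> \<bar>f v - L2_inner T R v\<bar> \<le> \<epsilon> * bochner_L2_norm T v"
  shows "\<bar>bochner_L2_norm T R - L2_dual_norm T f\<bar> \<le> \<epsilon>"
proof -
  have "L2_dual_norm T f \<le> bochner_L2_norm T R + \<epsilon>"
  proof (rule L2_dual_norm_leI)
    show "\<bar>f v\<bar> \<le> (bochner_L2_norm T R + \<epsilon>) * bochner_L2_norm T v" if "v \<in> bochner_L2 T" for v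
      using app[OF that] L2_Cauchy_Schwarz[OF R that] by (simp add: distrib_right)
  qed (use \<open>0 \<le> \<epsilon>\<close> L2_norm_nonneg[of T R] in linarith)
  moreover have "bochner_L2_norm T R \<le> L2_dual_norm T f + \<epsilon>"
  proof (cases "bochner_L2_norm T R = 0")
    case False
    then have pos: "0 < bochner_L2_norm T R" using L2_norm_nonneg[of T R] by simp
    have "bochner_L2_norm T R * bochner_L2_norm T R = L2_inner T R R"
      by (simp add: L2_inner_self power2_eq_square)
    also have "\<dots> \<le> (L2_dual_norm T f + \<epsilon>) * bochner_L2_norm T R"
      using app[OF R] L2_dual_bounded[OF f R] by (simp add: distrib_right)
    finally show ?thesis using pos by simp
  qed (use \<open>0 \<le> \<epsilon>\<close> L2_dual_norm_nonneg[OF f] in simp)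
  ultimately show ?thesis by linarith
qed

section \<open>A monotonicity inequality for functionals\<close>

text \<open>
  For \<open>d \<noteq> 0\<close>, the vector \<open>z = ((d, w) f + (f, d) w - (f, w) d) / \<parallel>d\<parallel>\<^sup>2\<close> is the image of \<open>f\<close> under the
  linear map that maps \<open>d\<close> to \<open>w\<close> and is the sum of a multiple of the identity and a skew map, which
  rotates the plane of \<open>d\<close> and \<open>w\<close> and vanishes on its complement.  Hence
  \<open>\<parallel>d\<parallel>\<^sup>2 (f, z) = (d, w) \<parallel>f\<parallel>\<^sup>2\<close>, and it remains to see that
  \<open>\<parallel>z - w\<parallel> \<le> \<parallel>f - d\<parallel> \<parallel>w\<parallel> / \<parallel>d\<parallel>\<close>.  With \<open>x = f - d\<close>, this is the nonnegativity of the Gram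
  determinant of \<open>x\<close>, \<open>w\<close> and \<open>d\<close>.  In the proof, \<open>y\<close> is \<open>\<parallel>d\<parallel>\<^sup>2 (z - w)\<close>.
\<close>

lemma L2_rotation_inequality:
  fixes f d w :: "real \<Rightarrow> 'v::real_inner"
  assumes f: "f \<in> bochner_L2 T" and d: "d \<in> bochner_L2 T" and w: "w \<in> bochner_L2 T"
  shows "L2_inner T d w * (bochner_L2_norm T f)\<^sup>2 \<le> (bochner_L2_norm T d)\<^sup>2 * L2_inner T f w
    + bochner_L2_norm T f * bochner_L2_norm T (f - d) * bochner_L2_norm T w * bochner_L2_norm T d"
proof -
  let ?i = "L2_inner T"
  define x where "x = f - d"
  have x_eq: "x = (\<lambda>t. 1 *\<^sub>R f t + (-1) *\<^sub>R d t)" by (simp add: x_def fun_diff_def)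
  have x: "x \<in> bochner_L2 T" unfolding x_def by (rule L2_diff[OF f d])
  define p k xd xw xx ww where "p = ?i d w" and "k = ?i d d" and "xd = ?i x d" and "xw = ?i x w"
    and "xx = ?i x x" and "ww = ?i w w"
  have k0: "0 \<le> k" and ww0: "0 \<le> ww" and xx0: "0 \<le> xx"
    by (simp_all add: k_def ww_def xx_def L2_inner_self)
  note comm = L2_inner_commute[of T d x] L2_inner_commute[of T w x] L2_inner_commute[of T w d]
  have gram: "p\<^sup>2 * xx + xd\<^sup>2 * ww + xw\<^sup>2 * k - 2 * p * xd * xw \<le> xx * ww * k"
  proof (cases "k = 0")
    case True
    have "p\<^sup>2 \<le> 0" "xd\<^sup>2 \<le> 0"
      using L2_Cauchy_Schwarz_square[OF d w] L2_Cauchy_Schwarz_square[OF x d] True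
      by (simp_all add: p_def xd_def k_def)
    then show ?thesis using True by simp
  next
    case False
    \<comment> \<open>Multiples of the projections of \<open>x\<close> and \<open>w\<close> onto the orthogonal complement of \<open>d\<close>.\<close>
    let ?x = "\<lambda>t. k *\<^sub>R x t + (- xd) *\<^sub>R d t" and ?w = "\<lambda>t. k *\<^sub>R w t + (- p) *\<^sub>R d t"
    have xL: "?x \<in> bochner_L2 T" and wL: "?w \<in> bochner_L2 T" by (intro L2_lincomb x d w)+
    have "?i ?x ?w = k * (k * xw - p * xd)"
      unfolding L2_inner_lincomb2[OF x d w d] comm
      by (simp add: algebra_simps flip: p_def k_def xd_def xw_def xx_def ww_def)
    moreover have "?i ?x ?x = k * (k * xx - xd\<^sup>2)"
      unfolding L2_inner_lincomb2[OF x d x d] comm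
      by (simp add: algebra_simps power2_eq_square flip: p_def k_def xd_def xw_def xx_def ww_def)
    moreover have "?i ?w ?w = k * (k * ww - p\<^sup>2)"
      unfolding L2_inner_lincomb2[OF w d w d] comm
      by (simp add: algebra_simps power2_eq_square flip: p_def k_def xd_def xw_def xx_def ww_def)
    ultimately have "(k * (k * xw - p * xd))\<^sup>2 \<le> (k * (k * xx - xd\<^sup>2)) * (k * (k * ww - p\<^sup>2))"
      using L2_Cauchy_Schwarz_square[OF xL wL] by simp
    also have "\<dots> = k\<^sup>2 * ((k * xx - xd\<^sup>2) * (k * ww - p\<^sup>2))" by (simp add: power2_eq_square)
    finally have "(k * xw - p * xd)\<^sup>2 \<le> (k * xx - xd\<^sup>2) * (k * ww - p\<^sup>2)"
      using False by (simp add: power_mult_distrib)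
    then have "0 \<le> k * (xx * ww * k - (p\<^sup>2 * xx + xd\<^sup>2 * ww + xw\<^sup>2 * k - 2 * p * xd * xw))"
      by (simp add: power2_eq_square algebra_simps)
    then show ?thesis using False k0 by (simp add: zero_le_mult_iff)
  qed
  let ?v = "\<lambda>t. p *\<^sub>R x t + xd *\<^sub>R w t"
  let ?y = "\<lambda>t. 1 *\<^sub>R ?v t + (- xw) *\<^sub>R d t"
  have vL: "?v \<in> bochner_L2 T" by (intro L2_lincomb x w)
  have yL: "?y \<in> bochner_L2 T" by (intro L2_lincomb vL d)
  have iy: "?i u ?y = p * ?i u x + xd * ?i u w - xw * ?i u d" if "u \<in> bochner_L2 T" for u
    using L2_inner_lincomb(2)[OF vL d that, of 1 "- xw"] L2_inner_lincomb(2)[OF x w that, of p xd] by simp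
  have "?i ?y ?y = ?i ?v ?y - xw * ?i d ?y"
    using L2_inner_lincomb(1)[OF vL d yL, of 1 "- xw"] by simp
  also have "?i ?v ?y = p * ?i x ?y + xd * ?i w ?y"
    using L2_inner_lincomb(1)[OF x w yL, of p xd] .
  also have "p * ?i x ?y + xd * ?i w ?y - xw * ?i d ?y = p\<^sup>2 * xx + xd\<^sup>2 * ww + xw\<^sup>2 * k - 2 * p * xd * xw"
    unfolding iy[OF x] iy[OF w] iy[OF d] comm
    by (simp add: power2_eq_square algebra_simps flip: p_def k_def xd_def xw_def xx_def ww_def)
  also have "\<dots> \<le> xx * ww * k" by (rule gram)
  also have "\<dots> = (bochner_L2_norm T x * bochner_L2_norm T w * bochner_L2_norm T d)\<^sup>2"
    by (simp add: xx_def ww_def k_def L2_inner_self power_mult_distrib)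
  finally have "(bochner_L2_norm T ?y)\<^sup>2 \<le> (bochner_L2_norm T x * bochner_L2_norm T w * bochner_L2_norm T d)\<^sup>2"
    by (simp add: L2_inner_self)
  then have ny: "bochner_L2_norm T ?y \<le> bochner_L2_norm T x * bochner_L2_norm T w * bochner_L2_norm T d"
    by (rule power2_le_imp_le) (intro mult_nonneg_nonneg L2_norm_nonneg)
  have fx: "?i u x = ?i u f - ?i u d" if "u \<in> bochner_L2 T" for u
    using L2_inner_lincomb(2)[OF f d that, of 1 "-1"] unfolding x_eq by simp
  have fd: "?i f d = xd + k" and fw: "?i f w = xw + p"
    using L2_inner_lincomb(1)[OF f d d, of 1 "-1"] L2_inner_lincomb(1)[OF f d w, of 1 "-1"]
    unfolding xd_def xw_def x_eq k_def p_def by simp_all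
  have "p * ?i f f = k * ?i f w + ?i f ?y"
    unfolding iy[OF f] fx[OF f] fd fw by (simp add: algebra_simps)
  also have "?i f ?y \<le> bochner_L2_norm T f * bochner_L2_norm T ?y"
    using L2_Cauchy_Schwarz[OF f yL] by linarith
  also have "\<dots> \<le> bochner_L2_norm T f * (bochner_L2_norm T x * bochner_L2_norm T w * bochner_L2_norm T d)"
    by (rule mult_left_mono[OF ny L2_norm_nonneg])
  finally show ?thesis by (simp add: p_def k_def x_def L2_inner_self mult.assoc)
qed

lemma LIMSEQ_abs_leI:
  fixes a :: "nat \<Rightarrow> real"
  assumes "\<And>n. \<bar>a n - l\<bar> \<le> c / real (Suc n)" shows "a \<longlonglongrightarrow> l"
proof (rule LIM_zero_cancel, rule Lim_null_comparison)
  show "\<forall>\<^sub>F n in sequentially. norm (a n - l) \<le> c * inverse (real (Suc n))"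
    using assms by (intro always_eventually) (simp add: field_simps)
  show "(\<lambda>n. c * inverse (real (Suc n))) \<longlonglongrightarrow> 0"
    by (intro tendsto_mult_right_zero LIMSEQ_inverse_real_of_nat)
qed

lemma L2_dual_rotation_inequality:
  fixes f d :: "(real \<Rightarrow> 'v::real_inner) \<Rightarrow> real"
  assumes f: "f \<in> L2_dual T" and d: "d \<in> L2_dual T" and w: "w \<in> bochner_L2 T"
  shows "d w * (L2_dual_norm T f)\<^sup>2 \<le> (L2_dual_norm T d)\<^sup>2 * f w
    + L2_dual_norm T f * L2_dual_norm T (f - d) * bochner_L2_norm T w * L2_dual_norm T d"
proof -
  have rep: "\<exists>R. R \<in> bochner_L2 T \<and>
      (\<forall>v\<in>bochner_L2 T. \<bar>l v - L2_inner T R v\<bar> \<le> 1 / real (Suc n) * bochner_L2_norm T v)"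
    if l: "l \<in> L2_dual T" for l :: "(real \<Rightarrow> 'v) \<Rightarrow> real" and n
    by (rule L2_approximate_Riesz[OF l, of "1 / real (Suc n)"]) auto
  obtain F where F: "\<And>n. F n \<in> bochner_L2 T"
    "\<And>n v. v \<in> bochner_L2 T \<Longrightarrow> \<bar>f v - L2_inner T (F n) v\<bar> \<le> 1 / real (Suc n) * bochner_L2_norm T v"
    using rep[OF f] by metis
  obtain D where D: "\<And>n. D n \<in> bochner_L2 T"
    "\<And>n v. v \<in> bochner_L2 T \<Longrightarrow> \<bar>d v - L2_inner T (D n) v\<bar> \<le> 1 / real (Suc n) * bochner_L2_norm T v"
    using rep[OF d] by metis
  have nF: "(\<lambda>n. bochner_L2_norm T (F n)) \<longlonglongrightarrow> L2_dual_norm T f"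
    by (rule LIMSEQ_abs_leI[of _ _ 1], rule approximate_representative_norm[OF f F(1) _ F(2)]) auto
  have nD: "(\<lambda>n. bochner_L2_norm T (D n)) \<longlonglongrightarrow> L2_dual_norm T d"
    by (rule LIMSEQ_abs_leI[of _ _ 1], rule approximate_representative_norm[OF d D(1) _ D(2)]) auto
  have nFD: "(\<lambda>n. bochner_L2_norm T (F n - D n)) \<longlonglongrightarrow> L2_dual_norm T (f - d)"
  proof (rule LIMSEQ_abs_leI[of _ _ 2], rule approximate_representative_norm[OF L2_dual_diff[OF f d] L2_diff[OF F(1) D(1)]])
    fix n and v :: "real \<Rightarrow> 'v" assume v: "v \<in> bochner_L2 T"
    have "L2_inner T (F n - D n) v = L2_inner T (F n) v - L2_inner T (D n) v"
      using L2_inner_lincomb(1)[OF F(1) D(1) v, of 1 n "-1" n] by (simp add: fun_diff_def)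
    then show "\<bar>(f - d) v - L2_inner T (F n - D n) v\<bar> \<le> 2 / real (Suc n) * bochner_L2_norm T v"
      using F(2)[OF v, of n] D(2)[OF v, of n] by (simp add: fun_diff_def)
  qed simp
  have iF: "(\<lambda>n. L2_inner T (F n) w) \<longlonglongrightarrow> f w"
    by (rule LIMSEQ_abs_leI[of _ _ "bochner_L2_norm T w"]) (use F(2)[OF w] in \<open>simp add: abs_minus_commute\<close>)
  have iD: "(\<lambda>n. L2_inner T (D n) w) \<longlonglongrightarrow> d w"
    by (rule LIMSEQ_abs_leI[of _ _ "bochner_L2_norm T w"]) (use D(2)[OF w] in \<open>simp add: abs_minus_commute\<close>)
  show ?thesis
  proof (rule LIMSEQ_le)
    show "(\<lambda>n. L2_inner T (D n) w * (bochner_L2_norm T (F n))\<^sup>2) \<longlonglongrightarrow> d w * (L2_dual_norm T f)\<^sup>2"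
      by (intro tendsto_intros iD nF)
    show "(\<lambda>n. (bochner_L2_norm T (D n))\<^sup>2 * L2_inner T (F n) w
        + bochner_L2_norm T (F n) * bochner_L2_norm T (F n - D n) * bochner_L2_norm T w * bochner_L2_norm T (D n))
      \<longlonglongrightarrow> (L2_dual_norm T d)\<^sup>2 * f w
        + L2_dual_norm T f * L2_dual_norm T (f - d) * bochner_L2_norm T w * L2_dual_norm T d"
      by (intro tendsto_intros nD nF nFD iF)
    show "\<exists>N. \<forall>n\<ge>N. L2_inner T (D n) w * (bochner_L2_norm T (F n))\<^sup>2
        \<le> (bochner_L2_norm T (D n))\<^sup>2 * L2_inner T (F n) w
          + bochner_L2_norm T (F n) * bochner_L2_norm T (F n - D n) * bochner_L2_norm T w * bochner_L2_norm T (D n)"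
      using L2_rotation_inequality[OF F(1) D(1) w] by blast
  qed
qed

section \<open>Lipschitz continuity of the inverse\<close>

text \<open>
  For \<open>w \<noteq> 0\<close>, the two assumptions on \<open>d\<close> give \<open>d(w) / \<parallel>d\<parallel>\<^sup>2 \<ge> m / L\<^sup>2\<close> and \<open>\<parallel>w\<parallel> / \<parallel>d\<parallel> \<le> 1 / m\<close>; these are
  the constants of monotonicity and of Lipschitz continuity of the inverse operator.  For \<open>w = 0\<close>
  the functional \<open>d\<close> vanishes, and the claim follows from \<open>m / L\<^sup>2 \<le> 1 / m\<close>.
\<close>

lemma inverse_monotonicity_inequality:
  fixes f d :: "(real \<Rightarrow> 'v::real_inner) \<Rightarrow> real"
  assumes f: "f \<in> L2_dual T" and d: "d \<in> L2_dual T" and w: "w \<in> bochner_L2 T"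
    and m: "0 < m" "m \<le> L" and mono: "m * (bochner_L2_norm T w)\<^sup>2 \<le> d w"
    and lip: "L2_dual_norm T d \<le> L * bochner_L2_norm T w"
  shows "m / L\<^sup>2 * (L2_dual_norm T f)\<^sup>2 \<le> f w + L2_dual_norm T f * L2_dual_norm T (f - d) / m"
proof -
  define a k \<phi> x where "a = bochner_L2_norm T w" and "k = L2_dual_norm T d" and "\<phi> = L2_dual_norm T f"
    and "x = L2_dual_norm T (f - d)"
  have nn: "0 \<le> a" "0 \<le> k" "0 \<le> \<phi>" "0 \<le> x"
    unfolding a_def k_def \<phi>_def x_def by (intro L2_norm_nonneg L2_dual_norm_nonneg L2_dual_diff f d)+
  have L0: "0 < L" using m by simp
  have ka: "k \<le> L * a" and pa: "m * a\<^sup>2 \<le> d w" using lip mono by (simp_all add: a_def k_def)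
  have pk: "d w \<le> k * a" using L2_dual_bounded[OF d w] by (simp add: a_def k_def)
  have "m / L\<^sup>2 * \<phi>\<^sup>2 \<le> f w + \<phi> * x / m"
  proof (cases "a = 0")
    case True
    then have fw: "f w = 0" using L2_dual_bounded[OF f w] by (simp add: a_def)
    have k: "k = 0" using ka True nn by simp
    have "\<phi> \<le> x + k" unfolding \<phi>_def x_def k_def
    proof (rule L2_dual_norm_leI)
      show "\<bar>f v\<bar> \<le> (L2_dual_norm T (f - d) + L2_dual_norm T d) * bochner_L2_norm T v" if v: "v \<in> bochner_L2 T" for v
        using L2_dual_bounded[OF L2_dual_diff[OF f d] v] L2_dual_bounded[OF d v]
        by (simp add: fun_diff_def distrib_right)
    qed (use nn in \<open>simp add: x_def k_def\<close>)
    then have pp: "\<phi> * \<phi> \<le> \<phi> * x" using k nn by (intro mult_left_mono) auto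
    have "m / L\<^sup>2 \<le> 1 / m"
    proof -
      have "m * m \<le> L * L" using m by (intro mult_mono) auto
      then show ?thesis using m L0 by (simp add: field_simps power2_eq_square)
    qed
    then have "m / L\<^sup>2 * (\<phi> * \<phi>) \<le> 1 / m * (\<phi> * \<phi>)" using nn by (intro mult_right_mono) auto
    moreover have "1 / m * (\<phi> * \<phi>) \<le> 1 / m * (\<phi> * x)"
      by (rule mult_left_mono[OF pp]) (use m in simp)
    ultimately show ?thesis using fw by (simp add: power2_eq_square)
  next
    case False
    then have a: "0 < a" using nn by simp
    then have "0 < m * a\<^sup>2" using m by simp
    then have "0 < k * a" using pa pk by linarith
    then have k: "0 < k" using a by (simp add: zero_less_mult_iff)
    have "d w * \<phi>\<^sup>2 \<le> k\<^sup>2 * f w + \<phi> * x * a * k"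
      using L2_dual_rotation_inequality[OF f d w] by (simp add: a_def k_def \<phi>_def x_def)
    then have main: "d w / k\<^sup>2 * \<phi>\<^sup>2 \<le> f w + \<phi> * x * (a / k)"
      using k by (simp add: field_simps power2_eq_square)
    have "m / L\<^sup>2 \<le> d w / k\<^sup>2"
    proof -
      have "k\<^sup>2 \<le> (L * a)\<^sup>2" using ka nn by (intro power_mono)
      then have "m * k\<^sup>2 \<le> m * (L\<^sup>2 * a\<^sup>2)" using m by (simp add: power_mult_distrib)
      also have "\<dots> \<le> L\<^sup>2 * d w" using mult_left_mono[OF pa, of "L\<^sup>2"] by (simp add: mult_ac)
      finally show ?thesis using k L0 by (simp add: divide_simps mult_ac)
    qed
    then have "m / L\<^sup>2 * \<phi>\<^sup>2 \<le> d w / k\<^sup>2 * \<phi>\<^sup>2" by (rule mult_right_mono) simp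
    moreover have "a / k \<le> 1 / m"
    proof -
      have "m * a * a \<le> k * a" using pa pk by (simp add: power2_eq_square)
      then have "m * a \<le> k" using a by simp
      then show ?thesis using m k by (simp add: field_simps)
    qed
    then have "\<phi> * x * (a / k) \<le> \<phi> * x * (1 / m)" using nn by (intro mult_left_mono) auto
    ultimately show ?thesis using main by simp
  qed
  then show ?thesis by (simp add: \<phi>_def x_def)
qed

text \<open>
  The assumption bounds \<open>\<mu> N\<^sup>2\<close>, where \<open>N\<close> is the left-hand side, by \<open>h\<^sup>2 + c l N\<close> with \<open>c = 1 + 1 / m\<close>.
  If the claim failed, then \<open>h < N\<close>, so that \<open>h\<^sup>2 \<le> c h N\<close> and \<open>\<mu> N\<^sup>2 \<le> c (l + h) N < \<mu> N\<^sup>2\<close>.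
\<close>

lemma lipschitz_bound_arithmetic:
  fixes a d g h l m \<mu> \<nu> :: real
  assumes nn: "0 \<le> a" "0 \<le> d" "0 \<le> g" "0 \<le> h" "0 \<le> l"
    and m: "0 < m" and mu: "0 < \<mu>" "\<mu> \<le> 1" "\<mu> \<le> m" "\<mu> \<le> \<nu>"
    and main: "g\<^sup>2 + m * a\<^sup>2 + \<nu> * d\<^sup>2 \<le> h\<^sup>2 + l * a + l * d / m"
  shows "sqrt (a\<^sup>2 + d\<^sup>2 + g\<^sup>2) \<le> 1 / \<mu> * (1 + 1 / m) * (l + h)"
proof (rule ccontr)
  define N where "N = sqrt (a\<^sup>2 + d\<^sup>2 + g\<^sup>2)"
  define c where "c = 1 + 1 / m"
  have c1: "1 \<le> c" unfolding c_def using m by simp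
  have N2: "N\<^sup>2 = a\<^sup>2 + d\<^sup>2 + g\<^sup>2" unfolding N_def by simp
  have aN: "a \<le> N" and dN: "d \<le> N"
    unfolding N_def by (rule real_le_rsqrt, simp)+
  assume "\<not> sqrt (a\<^sup>2 + d\<^sup>2 + g\<^sup>2) \<le> 1 / \<mu> * (1 + 1 / m) * (l + h)"
  then have "1 / \<mu> * c * (l + h) < N" unfolding N_def c_def by simp
  then have lt: "c * (l + h) < \<mu> * N" using mu by (simp add: field_simps)
  have "0 \<le> c * (l + h)" using c1 nn by simp
  then have "0 < \<mu> * N" using lt by linarith
  then have N0: "0 < N" using mu by (simp add: zero_less_mult_iff)
  have hN: "h \<le> N"
  proof -
    have "h \<le> 1 * (l + h)" using nn by simp
    also have "\<dots> \<le> c * (l + h)" using c1 nn by (intro mult_right_mono) auto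
    also have "\<dots> < \<mu> * N" by (rule lt)
    also have "\<dots> \<le> 1 * N" using mu N0 by (intro mult_right_mono) auto
    finally show ?thesis by simp
  qed
  have "\<mu> * N\<^sup>2 \<le> g\<^sup>2 + m * a\<^sup>2 + \<nu> * d\<^sup>2"
    using mult_right_mono[OF mu(2), of "g\<^sup>2"] mult_right_mono[OF mu(3), of "a\<^sup>2"]
      mult_right_mono[OF mu(4), of "d\<^sup>2"] unfolding N2 by (simp add: distrib_left)
  also have "\<dots> \<le> h\<^sup>2 + l * a + l * d / m" by (rule main)
  also have "\<dots> \<le> h * N + (l * N + l * N / m)"
  proof -
    have "l * a \<le> l * N" using aN nn by (intro mult_left_mono)
    moreover have "l * d / m \<le> l * N / m" using dN nn m by (intro divide_right_mono mult_left_mono) auto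
    moreover have "h\<^sup>2 \<le> h * N" using hN nn by (simp add: power2_eq_square mult_left_mono)
    ultimately show ?thesis by linarith
  qed
  also have "\<dots> \<le> c * (h * N) + c * (l * N)"
  proof -
    have "1 * (h * N) \<le> c * (h * N)" using c1 nn N0 by (intro mult_right_mono) auto
    moreover have "l * N + l * N / m = c * (l * N)" unfolding c_def by (simp add: distrib_right)
    ultimately show ?thesis by simp
  qed
  also have "\<dots> = (c * (l + h)) * N" by (simp add: algebra_simps)
  also have "\<dots> < \<mu> * N * N" by (rule mult_strict_right_mono[OF lt N0])
  finally show False by (simp add: power2_eq_square mult.assoc)
qed

theorem corollary4p10:
  fixes j :: "'v::{real_inner, complete_space} \<Rightarrow> 'h::{real_inner, complete_space}"
    and T L_A m_A m_S :: real
    and A :: "real \<Rightarrow> 'v \<Rightarrow> ('v \<Rightarrow>\<^sub>L real)"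
  assumes "gelfand_triple j"
    and "T > 0" and "L_A > 0" and "m_A > 0"
    and "\<And>w v. w \<in> bochner_L2 T \<Longrightarrow> v \<in> bochner_L2 T \<Longrightarrow>
           integrable (time_measure T) (\<lambda>t. blinfun_apply (A t (w t)) (v t))"
    and "\<And>w. w \<in> bochner_L2 T \<Longrightarrow> nemytskii T A w \<in> L2_dual T"
    and lipschitz: "\<And>w v. w \<in> bochner_L2 T \<Longrightarrow> v \<in> bochner_L2 T \<Longrightarrow>
           L2_dual_norm T (nemytskii T A w - nemytskii T A v) \<le> L_A * bochner_L2_norm T (w - v)"
    and strongly_monotone: "\<And>w v. w \<in> bochner_L2 T \<Longrightarrow> v \<in> bochner_L2 T \<Longrightarrow>
           (nemytskii T A w - nemytskii T A v) (w - v) \<ge> m_A * (bochner_L2_norm T (w - v))\<^sup>2"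
    and invertible: "\<And>l u\<^sub>0. l \<in> L2_dual T \<Longrightarrow>
           \<exists>u\<in>X_space j T. B_e j T A u = (l, u\<^sub>0) \<and>
             (\<forall>w\<in>X_space j T. B_e j T A w = (l, u\<^sub>0) \<longrightarrow> (AE t in time_measure T. w t = u t))"
    and "m_S = min 1 (min m_A (m_A / L_A\<^sup>2))"
  shows "\<forall>p\<in>L2_dual T \<times> UNIV. \<forall>q\<in>L2_dual T \<times> UNIV.
           X_norm j T (B_e_inverse j T A p - B_e_inverse j T A q)
             \<le> 1 / m_S * (1 + 1 / m_A) * data_norm T (fst p - fst q, snd p - snd q)"
proof (intro ballI)
  note operator_dual = assms(6)
  have j: "bounded_linear j" using assms(1) by (simp add: gelfand_triple_def)
  note T = assms(2) and L = assms(3) and m = assms(4)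
  fix p q :: "((real \<Rightarrow> 'v) \<Rightarrow> real) \<times> 'h"
  assume p: "p \<in> L2_dual T \<times> UNIV" and q: "q \<in> L2_dual T \<times> UNIV"
  have inv: "B_e_inverse j T A r \<in> X_space j T \<and> B_e j T A (B_e_inverse j T A r) = r"
    if "r \<in> L2_dual T \<times> UNIV" for r
  proof -
    have "\<exists>u\<in>X_space j T. B_e j T A u = r"
      using invertible[of "fst r" "snd r"] that by (auto simp: mem_Times_iff)
    then have "r \<in> B_e j T A ` X_space j T" by blast
    from inv_into_into[OF this] f_inv_into_f[OF this] show ?thesis
      unfolding B_e_inverse_def by blast
  qed
  define u v where "u = B_e_inverse j T A p" and "v = B_e_inverse j T A q"
  have u: "u \<in> X_space j T" "B_e j T A u = p" and v: "v \<in> X_space j T" "B_e j T A v = q"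
    using inv[OF p] inv[OF q] by (simp_all add: u_def v_def)
  note uL = X_space_weak_derivative(1)[OF u(1)] and vL = X_space_weak_derivative(1)[OF v(1)]
  let ?N = "nemytskii T A"
  define w where "w = u - v"
  have wX: "w \<in> X_space j T" and dw: "d_t j T w = d_t j T u - d_t j T v"
    unfolding w_def by (rule X_space_diff[OF j T u(1) v(1)])+
  note wL = X_space_weak_derivative(1)[OF wX]
  have pu: "fst p = (\<lambda>x. d_t j T u x + ?N u x)" "snd p = trace_at j T 0 u"
    using u(2) by (auto simp: B_e_def)
  have qv: "fst q = (\<lambda>x. d_t j T v x + ?N v x)" "snd q = trace_at j T 0 v"
    using v(2) by (auto simp: B_e_def)
  have pd: "fst p \<in> L2_dual T" and qd: "fst q \<in> L2_dual T" using p q by auto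
  have "d_t j T u = fst p - ?N u" "d_t j T v = fst q - ?N v"
    by (auto simp: pu qv fun_diff_def)
  then have dd: "d_t j T u \<in> L2_dual T" "d_t j T v \<in> L2_dual T"
    using L2_dual_diff[OF pd operator_dual[OF uL]] L2_dual_diff[OF qd operator_dual[OF vL]] by simp_all
  define \<delta> f l where "\<delta> = ?N u - ?N v" and "f = d_t j T v - d_t j T u" and "l = fst p - fst q"
  have \<delta>: "\<delta> \<in> L2_dual T" unfolding \<delta>_def by (intro L2_dual_diff operator_dual uL vL)
  have f: "f \<in> L2_dual T" unfolding f_def by (intro L2_dual_diff dd)
  have ld: "l \<in> L2_dual T" unfolding l_def by (intro L2_dual_diff pd qd)
  have fd: "f - \<delta> = fst q - fst p" by (auto simp: f_def \<delta>_def pu qv fun_diff_def)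
  have nfd: "L2_dual_norm T (f - \<delta>) = L2_dual_norm T l"
    unfolding fd l_def by (rule L2_dual_norm_commute)
  have nf: "L2_dual_norm T (d_t j T w) = L2_dual_norm T f"
    unfolding dw f_def by (rule L2_dual_norm_commute)
  have mono: "m_A * (bochner_L2_norm T w)\<^sup>2 \<le> \<delta> w"
    using strongly_monotone[OF uL vL] by (simp add: \<delta>_def w_def)
  have lip: "L2_dual_norm T \<delta> \<le> L_A * bochner_L2_norm T w"
    using lipschitz[OF uL vL] by (simp add: \<delta>_def w_def)
  have lw: "l w = d_t j T w w + \<delta> w" and fw: "f w = - d_t j T w w"
    by (simp_all add: l_def pu qv \<delta>_def f_def dw fun_diff_def)
  let ?a = "bochner_L2_norm T w" and ?d = "L2_dual_norm T f" and ?l = "L2_dual_norm T l"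
  define g h where "g = norm (trace_at j T T w)" and "h = norm (trace_at j T 0 w)"
  have energy: "g\<^sup>2 - h\<^sup>2 = 2 * d_t j T w w"
    unfolding g_def h_def by (rule energy_identity[OF j T wX])
  have hn: "h = norm (snd p - snd q)"
    unfolding h_def w_def using trace_at_diff[OF j T u(1) v(1), of 0] T by (simp add: pu qv)
  have nn: "0 \<le> ?a" "0 \<le> ?d" "0 \<le> ?l" "0 \<le> g" "0 \<le> h"
    by (simp_all add: L2_norm_nonneg L2_dual_norm_nonneg f ld g_def h_def)
  have first: "m_A * ?a\<^sup>2 \<le> ?l * ?a - d_t j T w w"
    using mono lw L2_dual_bounded[OF ld wL] by linarith
  \<comment> \<open>If \<open>L\<^sub>2(0,T;V)\<close> is nontrivial, then \<open>m\<^sub>A \<le> L\<^sub>A\<close>; otherwise all terms vanish.\<close>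
  have second: "m_A / L_A\<^sup>2 * ?d\<^sup>2 \<le> - d_t j T w w + ?d * ?l / m_A"
  proof (cases "\<exists>x :: real \<Rightarrow> 'v. x \<in> bochner_L2 T \<and> bochner_L2_norm T x \<noteq> 0")
    case True
    then obtain x :: "real \<Rightarrow> 'v" where x: "x \<in> bochner_L2 T" "bochner_L2_norm T x \<noteq> 0" by blast
    let ?z = "\<lambda>t. 0 :: 'v"
    have z: "?z \<in> bochner_L2 T" by (rule L2_const)
    have xz: "x - ?z = x" by (simp add: fun_diff_def)
    have "m_A * (bochner_L2_norm T x)\<^sup>2 \<le> (?N x - ?N ?z) x"
      using strongly_monotone[OF x(1) z] unfolding xz .
    also have "\<dots> \<le> L2_dual_norm T (?N x - ?N ?z) * bochner_L2_norm T x"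
      using L2_dual_bounded[OF L2_dual_diff[OF operator_dual[OF x(1)] operator_dual[OF z]] x(1)] by linarith
    also have "\<dots> \<le> L_A * bochner_L2_norm T x * bochner_L2_norm T x"
      using lipschitz[OF x(1) z] unfolding xz by (intro mult_right_mono L2_norm_nonneg)
    finally have "m_A * (bochner_L2_norm T x)\<^sup>2 \<le> L_A * (bochner_L2_norm T x)\<^sup>2"
      by (simp add: power2_eq_square mult.assoc)
    then have "m_A \<le> L_A" using x(2) by simp
    from inverse_monotonicity_inequality[OF f \<delta> wL m this mono lip] show ?thesis
      by (simp add: nfd fw)
  next
    case False
    then have "\<bar>f x\<bar> \<le> 0 * bochner_L2_norm T x" if "x \<in> bochner_L2 T" for x
      using L2_dual_bounded[OF f that] that by auto
    then have "?d \<le> 0" by (rule L2_dual_norm_leI) (assumption, rule order_refl)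
    moreover have "f w = 0" using L2_dual_bounded[OF f wL] False wL by auto
    ultimately show ?thesis using nn fw by simp
  qed
  have "X_norm j T w = sqrt (?a\<^sup>2 + ?d\<^sup>2 + g\<^sup>2)" by (simp add: X_norm_def nf g_def)
  also have "\<dots> \<le> 1 / m_S * (1 + 1 / m_A) * (?l + h)"
  proof (rule lipschitz_bound_arithmetic[where \<nu> = "m_A / L_A\<^sup>2"])
    show "g\<^sup>2 + m_A * ?a\<^sup>2 + m_A / L_A\<^sup>2 * ?d\<^sup>2 \<le> h\<^sup>2 + ?l * ?a + ?l * ?d / m_A"
      using energy first second by (simp add: mult.commute)
  qed (use nn m L assms(10) in auto)
  finally show "X_norm j T (B_e_inverse j T A p - B_e_inverse j T A q)
      \<le> 1 / m_S * (1 + 1 / m_A) * data_norm T (fst p - fst q, snd p - snd q)"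
    by (simp add: data_norm_def hn l_def w_def u_def v_def)
qed

end
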